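(* Let $T>0$. Assume that for some $M\ge0$: $\|F(0)\|\le M$ and $\|F(x)-F(y)\|\le M\|x-y\|_{-1}$ for all $x,y\in H$; $\|G(x)-G(y)\|\le M\|x-y\|_{-1}$ for all $x,y\in H$; $\|G(x)\|\le M$ for all $x\in H$. Assume also $\int_H\|z\|^2e^{K\|z\|}\nu(dz)<+\infty$ for every $K>0$. Let $g\in{\rm Lip}_b(H_{-1})$, and let $$v(t,x)=\sup_{u(\cdot)\in M_t}\Big\{\int_t^T-L_0(u(s))\,ds+g(X(T))\Big\},\qquad (t,x)\in[0,T]\times H,$$ where $X$ is the mild solution of $X'(s)=-AX(s)+F(X(s))+G(X(s))u(s)$, $X(t)=x$. Then there exist a constant $D_1$ and, for every $R>0$, a modulus $\omega_R$ such that $$|v(t,x)-v(s,y)|\le D_1\|x-y\|_{-1}+\omega_R(|t-s|)\quad\text{for }x,y\in H,\ \|x\|,\|y\|\le R,\ t,s\in[0,T].$$ Moreover $v$ is a viscosity solution of the Hamilton–Jacobi–Bellman equation $$v_t+\langle-Ax+F(x),Dv\rangle+H_0(G^*(x)Dv)=0\ \text{ in }(0,T)\times H,\qquad v(T,x)=g(x).$$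
   Context: $H$ is a real separable Hilbert space; $L(H)$ is the space of bounded linear operators on $H$; $F:H\to H$, $G:H\to L(H)$, $G^*(x)=G(x)^*$. $A$ is a linear, densely defined, maximal monotone operator in $H$; $S(\cdot)$ is the contraction $C_0$-semigroup generated by $-A$. $B$ is a bounded, linear, (strictly) positive, self-adjoint operator on $H$ such that $A^*B$ is bounded and $\langle(A^*B+c_0B)x,x\rangle\ge0$ for all $x\in H$, for some $c_0\ge0$. $\|x\|_{-1}=\|B^{1/2}x\|$, $H_{-1}$ is the completion of $H$ under this norm, and ${\rm Lip}_b(H_{-1})$ is the set of bounded Lipschitz functions on $H_{-1}$. $\nu$ is a Borel measure on $H$ with $\nu(\{0\})=0$ and $\int_H\|z\|^2\nu(dz)<\infty$. $$H_0(p)=\int_H[e^{\langle p,z\rangle}-1-\langle p,z\rangle]\nu(dz),\qquad L_0(z)=\sup_{y\in H}\{\langle z,y\rangle-H_0(y)\}\in[0,+\infty].$$ $M_t=\{u:[t,T]\to H:\ u\text{ strongly measurable}\}$; a control with $\int_t^TL_0(u(s))ds=+\infty$ has payoff $-\infty$ (if the integral is finite, $u$ is integrable). Mild solution: $X\in C([t,T];H)$ with $X(s)=S(s-t)x+\int_t^sS(s-\tau)[F(X(\tau))+G(X(\tau))u(\tau)]d\tau$. A modulus is a nondecreasing continuous $\omega:[0,\infty)\to[0,\infty)$ with $\omega(0)=0$. $B$-semicontinuity: $u:\Omega\to\mathbb{R}$, $\Omega\subset[0,T]\times H$, is $B$-upper (resp. $B$-lower) semicontinuous if whenever $t_k\to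 t$, $x_k\rightharpoonup x$ weakly, $Bx_k\to Bx$, $(t,x)\in\Omega$ (with $(t_k,x_k)\in\Omega$), then $\limsup u(t_k,x_k)\le u(t,x)$ (resp. $\liminf u(t_k,x_k)\ge u(t,x)$). Test functions (first order equation): $\varphi\in C^1((0,T)\times H)$, $B$-lower semicontinuous, with $\varphi,\varphi_t,D\varphi,A^*D\varphi$ uniformly continuous on $[\epsilon,T-\epsilon]\times H$ for every $\epsilon>0$ and $\varphi$ bounded on every set $[\epsilon,T-\epsilon]\times\{\|x\|_{-1}\le r\}$; and $h\in C^1([0,\infty))$ with $h'(0)=0$, $h'(r)\ge0$ for $r>0$, $h,h'$ uniformly continuous on $[0,\infty)$. A locally bounded $B$-upper semicontinuous $u:(0,T)\times H\to\mathbb{R}$ is a viscosity subsolution if whenever $u-\varphi-h(\|\cdot\|)$ has a maximum over $(0,T)\times H$ at $(t,x)$ for some test functions, then with $\psi=\varphi+h(\|\cdot\|)$, $\psi_t(t,x)-\langle x,A^*D\varphi(t,x)\rangle+\langle F(x),D\psi(t,x)\rangle+H_0(G^*(x)D\psi(t,x))\ge0$. A locally bounded $B$-lower semicontinuous $u$ is a viscosity supersolution if whenever $u+\varphi+h(\|\cdot\|)$ has a minimum over $(0,T)\times H$ at $(t,x)$, then with $\psi=-\varphi-h(\|\cdot\|)$, $\psi_t(t,x)+\langle x,A^*D\varphi(t,x)\rangle+\langle F(x),D\psi(t,x)\rangle+H_0(G^*(x)D\psi(t,x))\le0$. A viscosity solution is both. *)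

theory Defs
  imports "HOL-Analysis.Analysis"
begin

text \<open>
  An unbounded operator is given by its domain \<open>D\<close> together with a total function \<open>A\<close> of which
  only the values on \<open>D\<close> are relevant.
\<close>

definition linear_operator_on :: "'a::real_vector set \<Rightarrow> ('a \<Rightarrow> 'a) \<Rightarrow> bool" where
  "linear_operator_on D A \<longleftrightarrow> subspace D \<and>
     (\<forall>x\<in>D. \<forall>y\<in>D. A (x + y) = A x + A y) \<and> (\<forall>c. \<forall>x\<in>D. A (c *\<^sub>R x) = c *\<^sub>R A x)"

definition monotone_graph :: "('a::real_inner \<times> 'a) set \<Rightarrow> bool" where
  "monotone_graph \<Gamma> \<longleftrightarrow> (\<forall>(x, y)\<in>\<Gamma>. \<forall>(x', y')\<in>\<Gamma>. 0 \<le> (y - y') \<bullet> (x - x'))"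

definition maximal_monotone :: "'a::real_inner set \<Rightarrow> ('a \<Rightarrow> 'a) \<Rightarrow> bool" where
  "maximal_monotone D A \<longleftrightarrow> monotone_graph ((\<lambda>x. (x, A x)) ` D) \<and>
     (\<forall>\<Gamma>. monotone_graph \<Gamma> \<longrightarrow> (\<lambda>x. (x, A x)) ` D \<subseteq> \<Gamma> \<longrightarrow> \<Gamma> = (\<lambda>x. (x, A x)) ` D)"

definition adj_domain :: "'a::real_inner set \<Rightarrow> ('a \<Rightarrow> 'a) \<Rightarrow> 'a set" where
  "adj_domain D A = {y. \<exists>z. \<forall>x\<in>D. A x \<bullet> y = x \<bullet> z}"

text \<open>For dense \<open>D\<close> the element below exists and is unique for every \<open>y \<in> adj_domain D A\<close>.\<close>

definition adj_op :: "'a::real_inner set \<Rightarrow> ('a \<Rightarrow> 'a) \<Rightarrow> 'a \<Rightarrow> 'a" where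
  "adj_op D A y = (THE z. \<forall>x\<in>D. A x \<bullet> y = x \<bullet> z)"

definition contraction_C0_semigroup :: "(real \<Rightarrow> 'a::real_normed_vector \<Rightarrow>\<^sub>L 'a) \<Rightarrow> bool" where
  "contraction_C0_semigroup S \<longleftrightarrow> S 0 = id_blinfun \<and>
     (\<forall>s\<ge>0. \<forall>t\<ge>0. S (s + t) = S s o\<^sub>L S t) \<and>
     (\<forall>x. ((\<lambda>t. S t x) \<longlongrightarrow> x) (at_right 0)) \<and>
     (\<forall>t\<ge>0. norm (S t) \<le> 1)"

definition generator_of ::
    "(real \<Rightarrow> 'a::real_normed_vector \<Rightarrow>\<^sub>L 'a) \<Rightarrow> 'a set \<Rightarrow> ('a \<Rightarrow> 'a) \<Rightarrow> bool" where
  "generator_of S D C \<longleftrightarrow>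
     D = {x. \<exists>y. ((\<lambda>h. (S h x - x) /\<^sub>R h) \<longlongrightarrow> y) (at_right 0)} \<and>
     (\<forall>x\<in>D. ((\<lambda>h. (S h x - x) /\<^sub>R h) \<longlongrightarrow> C x) (at_right 0))"

definition self_adjoint :: "('a::real_inner \<Rightarrow>\<^sub>L 'a) \<Rightarrow> bool" where
  "self_adjoint B \<longleftrightarrow> (\<forall>x y. B x \<bullet> y = x \<bullet> B y)"

definition strictly_positive :: "('a::real_inner \<Rightarrow>\<^sub>L 'a) \<Rightarrow> bool" where
  "strictly_positive B \<longleftrightarrow> (\<forall>x. x \<noteq> 0 \<longrightarrow> 0 < B x \<bullet> x)"

definition sqrt_op :: "('a::real_inner \<Rightarrow>\<^sub>L 'a) \<Rightarrow> 'a \<Rightarrow>\<^sub>L 'a" where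
  "sqrt_op B = (THE R. self_adjoint R \<and> (\<forall>x. 0 \<le> R x \<bullet> x) \<and> R o\<^sub>L R = B)"

definition norm_m1 :: "('a::real_inner \<Rightarrow>\<^sub>L 'a) \<Rightarrow> 'a \<Rightarrow> real" where
  "norm_m1 B x = norm (sqrt_op B x)"

text \<open>
  The Banach space \<open>'b\<close>, with the embedding \<open>J\<close>, is a completion of \<open>'a\<close> under the norm \<open>N\<close>.
\<close>

definition is_completion :: "('a::real_vector \<Rightarrow> real) \<Rightarrow> ('a \<Rightarrow> 'b::banach) \<Rightarrow> bool" where
  "is_completion N J \<longleftrightarrow> linear J \<and> (\<forall>x. norm (J x) = N x) \<and> closure (range J) = UNIV"

definition Lip_b :: "('b::metric_space \<Rightarrow> real) set" where
  "Lip_b = {g. bounded (range g) \<and> (\<exists>C. C-lipschitz_on UNIV g)}"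

definition H0 :: "'a::real_inner measure \<Rightarrow> 'a \<Rightarrow> real" where
  "H0 \<nu> p = (\<integral>z. (exp (p \<bullet> z) - 1 - p \<bullet> z) \<partial>\<nu>)"

definition L0 :: "'a::real_inner measure \<Rightarrow> 'a \<Rightarrow> ereal" where
  "L0 \<nu> z = (SUP y. ereal (z \<bullet> y - H0 \<nu> y))"

text \<open>
  The state space is separable, so strong measurability is Borel measurability with respect to the
  Lebesgue sets of \<open>[t, T]\<close>.  The values of a control outside \<open>[t, T]\<close> are never used.
\<close>

definition controls :: "real \<Rightarrow> real \<Rightarrow> (real \<Rightarrow> 'a::{real_inner, banach, second_countable_topology}) set" where
  "controls T t = {u. set_borel_measurable lebesgue {t..T} u}"

definition mild_solution ::
    "(real \<Rightarrow> 'a \<Rightarrow>\<^sub>L 'a) \<Rightarrow> ('a \<Rightarrow> 'a) \<Rightarrow> ('a \<Rightarrow> 'a \<Rightarrow>\<^sub>L 'a) \<Rightarrow> real \<Rightarrow> real \<Rightarrow> 'a \<Rightarrow>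
     (real \<Rightarrow> 'a) \<Rightarrow> (real \<Rightarrow> 'a::{real_inner, banach, second_countable_topology}) \<Rightarrow> bool" where
  "mild_solution S F G T t x u X \<longleftrightarrow> continuous_on {t..T} X \<and>
     (\<forall>s\<in>{t..T}.
        set_integrable lebesgue {t..s} (\<lambda>\<tau>. S (s - \<tau>) (F (X \<tau>) + G (X \<tau>) (u \<tau>))) \<and>
        X s = S (s - t) x + (LINT \<tau>:{t..s}|lebesgue. S (s - \<tau>) (F (X \<tau>) + G (X \<tau>) (u \<tau>))))"

text \<open>Functions on \<open>[t, T]\<close> are made unique by the extensionality convention of \<open>FuncSet\<close>.\<close>

definition the_mild_solution ::
    "(real \<Rightarrow> 'a \<Rightarrow>\<^sub>L 'a) \<Rightarrow> ('a \<Rightarrow> 'a) \<Rightarrow> ('a \<Rightarrow> 'a \<Rightarrow>\<^sub>L 'a) \<Rightarrow> real \<Rightarrow> real \<Rightarrow> 'a \<Rightarrow>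
     (real \<Rightarrow> 'a) \<Rightarrow> real \<Rightarrow> 'a::{real_inner, banach, second_countable_topology}" where
  "the_mild_solution S F G T t x u =
     (THE X. X \<in> extensional {t..T} \<and> mild_solution S F G T t x u X)"

definition running_cost ::
    "'a::{real_inner, banach, second_countable_topology} measure \<Rightarrow> real \<Rightarrow> real \<Rightarrow> (real \<Rightarrow> 'a) \<Rightarrow> ennreal" where
  "running_cost \<nu> T t u = (\<integral>\<^sup>+s\<in>{t..T}. e2ennreal (L0 \<nu> (u s)) \<partial>lebesgue)"

definition payoff ::
    "'a measure \<Rightarrow> (real \<Rightarrow> 'a \<Rightarrow>\<^sub>L 'a) \<Rightarrow> ('a \<Rightarrow> 'a) \<Rightarrow> ('a \<Rightarrow> 'a \<Rightarrow>\<^sub>L 'a) \<Rightarrow> ('a \<Rightarrow> real) \<Rightarrow>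
     real \<Rightarrow> real \<Rightarrow> 'a \<Rightarrow> (real \<Rightarrow> 'a::{real_inner, banach, second_countable_topology}) \<Rightarrow> ereal" where
  "payoff \<nu> S F G g T t x u =
     (if running_cost \<nu> T t u = \<infinity> then - \<infinity>
      else ereal (- enn2real (running_cost \<nu> T t u) + g (the_mild_solution S F G T t x u T)))"

definition value_function ::
    "'a measure \<Rightarrow> (real \<Rightarrow> 'a \<Rightarrow>\<^sub>L 'a) \<Rightarrow> ('a \<Rightarrow> 'a) \<Rightarrow> ('a \<Rightarrow> 'a \<Rightarrow>\<^sub>L 'a) \<Rightarrow> ('a \<Rightarrow> real) \<Rightarrow>
     real \<Rightarrow> real \<Rightarrow> 'a::{real_inner, banach, second_countable_topology} \<Rightarrow> ereal" where
  "value_function \<nu> S F G g T t x = (SUP u\<in>controls T t. payoff \<nu> S F G g T t x u)"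

definition is_modulus :: "(real \<Rightarrow> real) \<Rightarrow> bool" where
  "is_modulus \<omega> \<longleftrightarrow> mono_on {0..} \<omega> \<and> continuous_on {0..} \<omega> \<and> (\<forall>r\<ge>0. 0 \<le> \<omega> r) \<and> \<omega> 0 = 0"

definition weakly_converges :: "(nat \<Rightarrow> 'a::real_inner) \<Rightarrow> 'a \<Rightarrow> bool" where
  "weakly_converges xs x \<longleftrightarrow> (\<forall>y. (\<lambda>k. xs k \<bullet> y) \<longlonglongrightarrow> x \<bullet> y)"

definition B_usc :: "('a::real_inner \<Rightarrow>\<^sub>L 'a) \<Rightarrow> (real \<times> 'a) set \<Rightarrow> (real \<times> 'a \<Rightarrow> real) \<Rightarrow> bool" where
  "B_usc B \<Omega> u \<longleftrightarrow> (\<forall>ts xs t x.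
     (\<forall>k. (ts k, xs k) \<in> \<Omega>) \<longrightarrow> (t, x) \<in> \<Omega> \<longrightarrow>
     ts \<longlonglongrightarrow> t \<longrightarrow> weakly_converges xs x \<longrightarrow> (\<lambda>k. B (xs k)) \<longlonglongrightarrow> B x \<longrightarrow>
     limsup (\<lambda>k. ereal (u (ts k, xs k))) \<le> ereal (u (t, x)))"

definition B_lsc :: "('a::real_inner \<Rightarrow>\<^sub>L 'a) \<Rightarrow> (real \<times> 'a) set \<Rightarrow> (real \<times> 'a \<Rightarrow> real) \<Rightarrow> bool" where
  "B_lsc B \<Omega> u \<longleftrightarrow> (\<forall>ts xs t x.
     (\<forall>k. (ts k, xs k) \<in> \<Omega>) \<longrightarrow> (t, x) \<in> \<Omega> \<longrightarrow>
     ts \<longlonglongrightarrow> t \<longrightarrow> weakly_converges xs x \<longrightarrow> (\<lambda>k. B (xs k)) \<longlonglongrightarrow> B x \<longrightarrow>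
     ereal (u (t, x)) \<le> liminf (\<lambda>k. ereal (u (ts k, xs k))))"

definition locally_bounded_on :: "'c::topological_space set \<Rightarrow> ('c \<Rightarrow> real) \<Rightarrow> bool" where
  "locally_bounded_on \<Omega> u \<longleftrightarrow> (\<forall>z\<in>\<Omega>. \<exists>U. open U \<and> z \<in> U \<and> bounded (u ` (U \<inter> \<Omega>)))"

definition time_deriv :: "(real \<times> 'a \<Rightarrow> real) \<Rightarrow> real \<times> 'a \<Rightarrow> real" where
  "time_deriv \<phi> = (\<lambda>(t, x). deriv (\<lambda>s. \<phi> (s, x)) t)"

definition space_grad :: "(real \<times> 'a::real_inner \<Rightarrow> real) \<Rightarrow> real \<times> 'a \<Rightarrow> 'a" where
  "space_grad \<phi> = (\<lambda>(t, x). THE p. GDERIV (\<lambda>y. \<phi> (t, y)) x :> p)"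

definition C1_on_cylinder :: "real \<Rightarrow> (real \<times> 'a::real_inner \<Rightarrow> real) \<Rightarrow> bool" where
  "C1_on_cylinder T \<phi> \<longleftrightarrow>
     (\<forall>z\<in>{0<..<T} \<times> UNIV. \<phi> differentiable (at z)) \<and>
     continuous_on ({0<..<T} \<times> UNIV) (time_deriv \<phi>) \<and>
     continuous_on ({0<..<T} \<times> UNIV) (space_grad \<phi>)"

definition test_phi ::
    "'a::real_inner set \<Rightarrow> ('a \<Rightarrow> 'a) \<Rightarrow> ('a \<Rightarrow>\<^sub>L 'a) \<Rightarrow> real \<Rightarrow> (real \<times> 'a \<Rightarrow> real) \<Rightarrow> bool" where
  "test_phi D A B T \<phi> \<longleftrightarrow>
     C1_on_cylinder T \<phi> \<and> B_lsc B ({0<..<T} \<times> UNIV) \<phi> \<and>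
     (\<forall>z\<in>{0<..<T} \<times> UNIV. space_grad \<phi> z \<in> adj_domain D A) \<and>
     (\<forall>\<epsilon>>0. uniformly_continuous_on ({\<epsilon>..T - \<epsilon>} \<times> UNIV) \<phi> \<and>
            uniformly_continuous_on ({\<epsilon>..T - \<epsilon>} \<times> UNIV) (time_deriv \<phi>) \<and>
            uniformly_continuous_on ({\<epsilon>..T - \<epsilon>} \<times> UNIV) (space_grad \<phi>) \<and>
            uniformly_continuous_on ({\<epsilon>..T - \<epsilon>} \<times> UNIV) (\<lambda>z. adj_op D A (space_grad \<phi> z)) \<and>
            (\<forall>r. bounded (\<phi> ` ({\<epsilon>..T - \<epsilon>} \<times> {x. norm_m1 B x \<le> r}))))"

definition test_h :: "(real \<Rightarrow> real) \<Rightarrow> bool" where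
  "test_h h \<longleftrightarrow> (\<exists>h'.
     (\<forall>r\<ge>0. (h has_real_derivative h' r) (at r within {0..})) \<and> continuous_on {0..} h' \<and>
     h' 0 = 0 \<and> (\<forall>r>0. 0 \<le> h' r) \<and>
     uniformly_continuous_on {0..} h \<and> uniformly_continuous_on {0..} h')"

definition viscosity_subsolution ::
    "'a set \<Rightarrow> ('a \<Rightarrow> 'a) \<Rightarrow> ('a \<Rightarrow>\<^sub>L 'a) \<Rightarrow> 'a measure \<Rightarrow> ('a \<Rightarrow> 'a) \<Rightarrow> ('a \<Rightarrow> 'a \<Rightarrow>\<^sub>L 'a) \<Rightarrow>
     real \<Rightarrow> (real \<times> 'a::real_inner \<Rightarrow> real) \<Rightarrow> bool" where
  "viscosity_subsolution D A B \<nu> F G T u \<longleftrightarrow>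
     locally_bounded_on ({0<..<T} \<times> UNIV) u \<and> B_usc B ({0<..<T} \<times> UNIV) u \<and>
     (\<forall>\<phi> h t x. test_phi D A B T \<phi> \<longrightarrow> test_h h \<longrightarrow> t \<in> {0<..<T} \<longrightarrow>
        (\<forall>s\<in>{0<..<T}. \<forall>y. u (s, y) - \<phi> (s, y) - h (norm y) \<le> u (t, x) - \<phi> (t, x) - h (norm x)) \<longrightarrow>
        (let \<psi> = (\<lambda>(s, y). \<phi> (s, y) + h (norm y)) in
           time_deriv \<psi> (t, x) - x \<bullet> adj_op D A (space_grad \<phi> (t, x))
           + F x \<bullet> space_grad \<psi> (t, x)
           + H0 \<nu> (adjoint (blinfun_apply (G x)) (space_grad \<psi> (t, x))) \<ge> 0))"

definition viscosity_supersolution ::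
    "'a set \<Rightarrow> ('a \<Rightarrow> 'a) \<Rightarrow> ('a \<Rightarrow>\<^sub>L 'a) \<Rightarrow> 'a measure \<Rightarrow> ('a \<Rightarrow> 'a) \<Rightarrow> ('a \<Rightarrow> 'a \<Rightarrow>\<^sub>L 'a) \<Rightarrow>
     real \<Rightarrow> (real \<times> 'a::real_inner \<Rightarrow> real) \<Rightarrow> bool" where
  "viscosity_supersolution D A B \<nu> F G T u \<longleftrightarrow>
     locally_bounded_on ({0<..<T} \<times> UNIV) u \<and> B_lsc B ({0<..<T} \<times> UNIV) u \<and>
     (\<forall>\<phi> h t x. test_phi D A B T \<phi> \<longrightarrow> test_h h \<longrightarrow> t \<in> {0<..<T} \<longrightarrow>
        (\<forall>s\<in>{0<..<T}. \<forall>y. u (t, x) + \<phi> (t, x) + h (norm x) \<le> u (s, y) + \<phi> (s, y) + h (norm y)) \<longrightarrow>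
        (let \<psi> = (\<lambda>(s, y). - \<phi> (s, y) - h (norm y)) in
           time_deriv \<psi> (t, x) + x \<bullet> adj_op D A (space_grad \<phi> (t, x))
           + F x \<bullet> space_grad \<psi> (t, x)
           + H0 \<nu> (adjoint (blinfun_apply (G x)) (space_grad \<psi> (t, x))) \<le> 0))"

definition viscosity_solution ::
    "'a set \<Rightarrow> ('a \<Rightarrow> 'a) \<Rightarrow> ('a \<Rightarrow>\<^sub>L 'a) \<Rightarrow> 'a measure \<Rightarrow> ('a \<Rightarrow> 'a) \<Rightarrow> ('a \<Rightarrow> 'a \<Rightarrow>\<^sub>L 'a) \<Rightarrow>
     real \<Rightarrow> (real \<times> 'a::real_inner \<Rightarrow> real) \<Rightarrow> bool" where
  "viscosity_solution D A B \<nu> F G T u \<longleftrightarrow>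
     viscosity_subsolution D A B \<nu> F G T u \<and> viscosity_supersolution D A B \<nu> F G T u"

end

theory Submission
  imports Defs
begin

text \<open>
  Since \<open>L0\<close> dominates \<open>R |u| - C\<^sub>R\<close> for every \<open>R\<close>, near-optimal controls are uniformly integrable.  Together
  with the weak \<open>B\<close>-condition, which gives \<open>|S(r)x|\<^sub>-\<^sub>1 \<le> e\<^bsup>c0 r\<^esup> |x|\<^sub>-\<^sub>1\<close> and
  \<open>|S(r)x - x|\<^sub>-\<^sub>1 = O(r\<^bsup>1/2\<^esup>)\<close> on bounded sets, and with Gronwall's inequality for an integrable kernel this yields
  the modulus of continuity of the value function.

  For the viscosity property a single short time step suffices.  The mean value theorem replaces
  \<open>\<phi>(t + \<epsilon>, X(t + \<epsilon>)) - \<phi>(t, x)\<close> by a pairing with a gradient \<open>q\<close> in the domain of \<open>A\<^sup>*\<close>, for which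
  \<open>\<langle>S(\<epsilon>)x - x, q\<rangle>\<close> is of order \<open>\<epsilon>\<close> for every \<open>x\<close>; contractivity of the semigroup takes care of the radial part.
  Then Fenchel's inequality \<open>\<langle>u, w\<rangle> \<le> L0(u) + H0(w)\<close>, applied pointwise along a near-optimal control, gives the
  subsolution inequality, and the constant control \<open>\<nabla>H0(p)\<close>, for which it is an equality, gives the
  supersolution inequality.
\<close>

subsection \<open>Operators on real Hilbert spaces\<close>

text \<open>The obstacle is that controls are unbounded. Over a short interval the integral of |u|
  is small uniformly among controls of bounded cost, but with no prescribed rate, so the subsolution
  argument avoids errors that multiply |u|. There every perturbation attached to \<open>u\<close> is
  moved by adjoints onto the dual variable, where Fenchel's inequality only asks for
  \<open>H0\<close> at a nearby point and continuity of \<open>H0\<close> absorbs the change.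
  Closeness of X to x without a rate is then enough. One one-sided expansion serves both viscosity
  inequalities: in each of them the increment of \<open>\<phi>\<close> + h has to be bounded from
  above, and this is the direction in which contractivity and h' \<ge> 0 help. \<open>D1\<close>
  does not depend on R because near-optimal controls have cost at most 2 \<open>C\<gamma>\<close> +
  1 from every initial state. The modulus does depend on R, while B-semicontinuity is stated for
  weakly convergent sequences; hence the boundedness theorem for these. The square root, the
  adjoint, gradients and the mild solution are given by description or choice operators and mean
  nothing before their existence is proved.\<close>

text \<open>The representing vector is the point of least norm on the hyperplane
  \<open>f = 1\<close>, rescaled. Minimality makes it orthogonal to the kernel of \<open>f\<close>,
  and the parallelogram law makes a minimising sequence Cauchy.\<close>

lemma Riesz_representation:
  fixes f :: "'a::{real_inner, banach} \<Rightarrow> real"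
  assumes "bounded_linear f"
  shows "\<exists>p. \<forall>x. f x = x \<bullet> p"
proof (cases "\<forall>x. f x = 0")
  case True
  then show ?thesis by (intro exI[of _ 0]) simp
next
  case False
  interpret bounded_linear f by fact
  from False obtain x0 where x0: "f x0 \<noteq> 0" by blast
  define V where "V = {x. f x = 1}"
  have ne: "x0 /\<^sub>R f x0 \<in> V" using x0 by (simp add: V_def scaleR)
  define d where "d = (INF x\<in>V. norm x ^ 2)"
  have bdd: "bdd_below ((\<lambda>x. norm x ^ 2) ` V)" by (intro bdd_belowI[of _ 0]) auto
  have dle: "d \<le> norm x ^ 2" if "x \<in> V" for x
    unfolding d_def using that bdd by (intro cINF_lower) auto
  have "\<exists>x\<in>V. norm x ^ 2 < d + 1 / Suc n" for n
    using cINF_less_iff[OF _ bdd, of "d + 1 / Suc n"] ne unfolding d_def by auto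
  then obtain X where X: "\<And>n. X n \<in> V" "\<And>n. norm (X n) ^ 2 < d + 1 / Suc n" by metis
  \<comment> \<open>The midpoint of two points of \<open>V\<close> lies in \<open>V\<close>, so the
    norm of the sum is bounded below by the infimum.\<close>
  have par: "norm (X m - X n) ^ 2 \<le> 2 / Suc m + 2 / Suc n" for m n
  proof -
    have "(X m + X n) /\<^sub>R 2 \<in> V" using X(1)[of m] X(1)[of n] by (simp add: V_def scaleR add)
    from dle[OF this] have "4 * d \<le> norm (X m + X n) ^ 2"
      by (simp add: power_mult_distrib power2_eq_square)
    moreover have "norm (X m - X n) ^ 2 + norm (X m + X n) ^ 2 = 2 * norm (X m) ^ 2 + 2 * norm (X n) ^ 2"
      by (simp add: power2_norm_eq_inner inner_simps inner_commute)
    ultimately show ?thesis using X(2)[of m] X(2)[of n] by simp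
  qed
  have "Cauchy X"
  proof (rule metric_CauchyI)
    fix e :: real assume "e > 0"
    obtain N where N: "N > 0" "4 / real N < e\<^sup>2"
    proof -
      obtain N where "4 / e\<^sup>2 < real N" using reals_Archimedean2 by blast
      moreover from this have "N > 0" using \<open>e > 0\<close> by (intro gr0I) (auto simp: field_simps)
      ultimately show ?thesis using that[of N] \<open>e > 0\<close> by (auto simp: field_simps)
    qed
    have "dist (X m) (X n) < e" if "m \<ge> N" "n \<ge> N" for m n
    proof -
      have "2 / Suc m \<le> 2 / real N" "2 / Suc n \<le> 2 / real N"
        using that N(1) by (intro divide_left_mono; simp)+
      then have "norm (X m - X n) ^ 2 < e\<^sup>2" using par[of m n] N(2) by simp
      then show ?thesis using \<open>e > 0\<close> by (simp add: dist_norm power_less_imp_less_base)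
    qed
    then show "\<exists>M. \<forall>m\<ge>M. \<forall>n\<ge>M. dist (X m) (X n) < e" by blast
  qed
  then obtain x where x: "X \<longlonglongrightarrow> x" using Cauchy_convergent convergent_def by blast
  have fx: "f x = 1"
  proof -
    have "(\<lambda>n. f (X n)) \<longlonglongrightarrow> f x" by (rule tendsto[OF x])
    moreover have "(\<lambda>n. f (X n)) \<longlonglongrightarrow> 1" using X(1) by (simp add: V_def)
    ultimately show ?thesis using LIMSEQ_unique by blast
  qed
  have xd: "norm x ^ 2 \<le> d"
  proof (rule LIMSEQ_le)
    show "(\<lambda>n. norm (X n) ^ 2) \<longlonglongrightarrow> norm x ^ 2" by (intro tendsto_intros x)
    show "(\<lambda>n. d + 1 / real (Suc n)) \<longlonglongrightarrow> d"
      using tendsto_add[OF tendsto_const[of d] lim_1_over_n[THEN LIMSEQ_Suc]] by simp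
    show "\<exists>N. \<forall>n\<ge>N. norm (X n) ^ 2 \<le> d + 1 / real (Suc n)" using X(2) by (meson less_imp_le)
  qed
  have orth: "x \<bullet> y = 0" if "f y = 0" for y
  proof (rule ccontr)
    assume a: "x \<bullet> y \<noteq> 0"
    then have y: "y \<noteq> 0" by auto
    \<comment> \<open>The coefficient of the projection of \<open>x\<close> on \<open>y\<close>:
      subtracting it stays in \<open>V\<close> and strictly lowers the norm unless \<open>x\<close>
      and \<open>y\<close> are orthogonal.\<close>
    define c where "c = (x \<bullet> y) / (y \<bullet> y)"
    have "x - c *\<^sub>R y \<in> V" using fx that by (simp add: V_def scaleR diff)
    from dle[OF this] xd have "norm x ^ 2 \<le> norm (x - c *\<^sub>R y) ^ 2" by linarith
    also have "\<dots> = norm x ^ 2 - (x \<bullet> y)\<^sup>2 / (y \<bullet> y)"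
      using y unfolding c_def
      by (simp add: power2_norm_eq_inner inner_simps inner_commute) (simp add: field_simps power2_eq_square)
    finally have "(x \<bullet> y)\<^sup>2 / (y \<bullet> y) \<le> 0" by simp
    moreover have "(x \<bullet> y)\<^sup>2 / (y \<bullet> y) > 0" using a y by simp
    ultimately show False by simp
  qed
  have xn: "x \<noteq> 0" using fx zero by auto
  have "f z = z \<bullet> (x /\<^sub>R (x \<bullet> x))" for z
  proof -
    have "x \<bullet> (z - f z *\<^sub>R x) = 0" by (intro orth) (simp add: diff scaleR fx)
    then show ?thesis using xn by (simp add: inner_simps inner_commute field_simps)
  qed
  then show ?thesis by blast
qed

text \<open>\<open>adjoint\<close> is a choice of a function satisfying the adjoint identity, so it
  has this property only once some such function exists; Riesz representation supplies one.\<close>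

lemma inner_adjoint_blinfun:
  fixes L :: "'a::{real_inner, banach} \<Rightarrow>\<^sub>L 'b::real_inner"
  shows "x \<bullet> adjoint (blinfun_apply L) y = L x \<bullet> y"
proof -
  have "\<exists>p. \<forall>x. L x \<bullet> y = x \<bullet> p" for y
    by (rule Riesz_representation) (rule bounded_linear_compose[OF bounded_linear_inner_left blinfun.bounded_linear_right])
  then obtain f where f: "\<And>x y. L x \<bullet> y = x \<bullet> f y" by metis
  then have "adjoint (blinfun_apply L) = f" by (intro adjoint_unique) auto
  then show ?thesis using f by simp
qed

lemma eq_of_inner_eq:
  fixes a b :: "'a::real_inner"
  assumes "\<And>x. x \<bullet> a = x \<bullet> b" shows "a = b"
  using assms[of "a - b"] by (metis inner_diff_right inner_eq_zero_iff right_minus_eq)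

lemma norm_adjoint_blinfun_le:
  fixes L :: "'a::{real_inner, banach} \<Rightarrow>\<^sub>L 'b::real_inner"
  shows "norm (adjoint (blinfun_apply L) y) \<le> norm L * norm y"
proof -
  let ?a = "adjoint (blinfun_apply L) y"
  have "norm ?a * norm ?a = L ?a \<bullet> y" 
    by (metis inner_adjoint_blinfun power2_eq_square power2_norm_eq_inner)
  also have "\<dots> \<le> norm (L ?a) * norm y" by (rule norm_cauchy_schwarz)
  also have "\<dots> \<le> norm L * norm ?a * norm y" by (intro mult_right_mono norm_blinfun) simp
  finally have "norm ?a * norm ?a \<le> (norm L * norm y) * norm ?a" by (simp add: mult_ac)
  then show ?thesis
    by (cases "norm ?a = 0") (auto simp: mult_le_cancel_right)
qed

lemma adjoint_blinfun_diff:
  fixes L :: "'a::{real_inner, banach} \<Rightarrow>\<^sub>L 'b::real_inner"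
  shows "adjoint (blinfun_apply L) (x - y) = adjoint (blinfun_apply L) x - adjoint (blinfun_apply L) y"
  by (rule eq_of_inner_eq) (simp add: inner_adjoint_blinfun inner_diff_right)

lemma adjoint_blinfun_diff_left:
  fixes K L :: "'a::{real_inner, banach} \<Rightarrow>\<^sub>L 'b::real_inner"
  shows "adjoint (blinfun_apply K) y - adjoint (blinfun_apply L) y = adjoint (blinfun_apply (K - L)) y"
  by (rule eq_of_inner_eq)
     (simp add: inner_adjoint_blinfun inner_diff_right inner_diff_left blinfun.diff_left)

section \<open>The positive square root of a positive operator\<close>

text \<open>If \<open>R y\<close> were nonzero, moving from \<open>y\<close> a little in the
  direction of -\<open>R y\<close> would make the quadratic form negative: it vanishes at
  \<open>y\<close>, its linear term is -2 s |R y|^2, and its quadratic term is of order s^2.\<close>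

lemma psd_kernel:
  fixes R :: "'a::real_inner \<Rightarrow>\<^sub>L 'a"
  assumes "self_adjoint R" "\<And>x. 0 \<le> R x \<bullet> x" "R y \<bullet> y = 0"
  shows "R y = 0"
proof (rule ccontr)
  assume a: "R y \<noteq> 0"
  define z where "z = R y"
  define b where "b = R z \<bullet> z"
  have zz: "z \<bullet> z > 0" using a by (simp add: z_def)
  have b: "b \<ge> 0" using assms by (simp add: b_def)
  define s where "s = (z \<bullet> z) / (b + 1)"
  have s: "s > 0" using zz b by (simp add: s_def)
  have yz: "R z \<bullet> y = z \<bullet> z" using assms(1) by (simp add: self_adjoint_def z_def)
  have "0 \<le> R (y - s *\<^sub>R z) \<bullet> (y - s *\<^sub>R z)" by (rule assms)
  also have "\<dots> = s * s * b - 2 * s * (z \<bullet> z)"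
    using assms(3) yz unfolding b_def
    by (simp add: blinfun.diff_right blinfun.scaleR_right inner_simps z_def[symmetric]) (simp add: algebra_simps)
  also have "\<dots> = s * (s * b - 2 * (z \<bullet> z))" by (simp add: algebra_simps)
  finally have "s * b \<ge> 2 * (z \<bullet> z)" using s by (simp add: zero_le_mult_iff)
  moreover have "s * b \<le> z \<bullet> z" 
    using b zz by (simp add: s_def field_simps)
  ultimately show False using zz by simp
qed

text \<open>The root of \<open>1 - Q\<close> is \<open>1 - Y\<close> where \<open>Y = (Q + Y\<^sup>2) / 2\<close>; the iteration for \<open>Y\<close> is
  majorised by the same iteration for the number \<open>1\<close>, hence converges in operator norm.\<close>

primrec sqrt_iter :: "('a::real_normed_vector \<Rightarrow>\<^sub>L 'a) \<Rightarrow> nat \<Rightarrow> 'a \<Rightarrow>\<^sub>L 'a" where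
  "sqrt_iter Q 0 = 0"
| "sqrt_iter Q (Suc n) = (1/2) *\<^sub>R (Q + (sqrt_iter Q n o\<^sub>L sqrt_iter Q n))"

primrec sqrt_iter_real :: "nat \<Rightarrow> real" where
  "sqrt_iter_real 0 = 0"
| "sqrt_iter_real (Suc n) = (1 + sqrt_iter_real n * sqrt_iter_real n) / 2"

lemma sqrt_iter_real_bounds: "0 \<le> sqrt_iter_real n \<and> sqrt_iter_real n \<le> 1"
proof (induction n)
  case (Suc n)
  then have "sqrt_iter_real n * sqrt_iter_real n \<le> 1 * 1" by (intro mult_mono) auto
  then show ?case using Suc by simp
qed simp

lemma sqrt_iter_real_incseq: "incseq sqrt_iter_real"
proof (rule incseq_SucI)
  fix n
  have "0 \<le> (1 - sqrt_iter_real n) * (1 - sqrt_iter_real n)" by simp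
  then show "sqrt_iter_real n \<le> sqrt_iter_real (Suc n)" by (simp add: algebra_simps)
qed

lemma norm_sqrt_iter_le:
  assumes "norm Q \<le> 1"
  shows "norm (sqrt_iter Q n) \<le> sqrt_iter_real n"
proof (induction n)
  case (Suc n)
  have "norm (Q + (sqrt_iter Q n o\<^sub>L sqrt_iter Q n)) \<le> 1 + sqrt_iter_real n * sqrt_iter_real n"
    by (intro norm_triangle_mono assms order_trans[OF norm_blinfun_compose] mult_mono Suc)
       (use sqrt_iter_real_bounds in auto)
  then show ?case by simp
qed simp

text \<open>The scalar increments telescope and the scalar iteration is increasing and bounded, so
  this domination makes the operator increments summable.\<close>

lemma norm_sqrt_iter_Suc_diff:
  assumes "norm Q \<le> 1"
  shows "norm (sqrt_iter Q (Suc n) - sqrt_iter Q n) \<le> sqrt_iter_real (Suc n) - sqrt_iter_real n"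
proof (induction n)
  case 0
  then show ?case using assms by simp
next
  case (Suc n)
  let ?Y = "sqrt_iter Q" and ?y = "sqrt_iter_real"
  let ?D = "?Y (Suc n) - ?Y n"
  \<comment> \<open>The mixed products cancel in this order of the factors, so the difference of
    squares factors without commutation. The scalar iteration satisfies the same identity, which is
    why the bound closes with equality.\<close>
  have eq: "?Y (Suc (Suc n)) - ?Y (Suc n) = (1/2) *\<^sub>R ((?Y (Suc n) o\<^sub>L ?D) + (?D o\<^sub>L ?Y n))"
  proof -
    have "?Y (Suc (Suc n)) - ?Y (Suc n)
        = (1/2) *\<^sub>R (Q + (?Y (Suc n) o\<^sub>L ?Y (Suc n))) - (1/2) *\<^sub>R (Q + (?Y n o\<^sub>L ?Y n))"
      by (simp only: sqrt_iter.simps(2))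
    also have "\<dots> = (1/2) *\<^sub>R ((?Y (Suc n) o\<^sub>L ?D) + (?D o\<^sub>L ?Y n))"
      by (rule blinfun_eqI) (simp del: sqrt_iter.simps add: blinfun.add_left blinfun.diff_left blinfun.diff_right
      blinfun.scaleR_left scaleR_diff_right[symmetric] scaleR_add_right[symmetric])
    finally show ?thesis .
  qed
  have "norm ((?Y (Suc n) o\<^sub>L ?D) + (?D o\<^sub>L ?Y n))
      \<le> ?y (Suc n) * (?y (Suc n) - ?y n) + (?y (Suc n) - ?y n) * ?y n"
    by (intro norm_triangle_mono order_trans[OF norm_blinfun_compose] mult_mono Suc norm_sqrt_iter_le assms)
       (use sqrt_iter_real_bounds[of n] sqrt_iter_real_bounds[of "Suc n"] incseq_SucD[OF sqrt_iter_real_incseq, of n] in auto)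
  then have "norm (?Y (Suc (Suc n)) - ?Y (Suc n)) \<le> (?y (Suc n) * (?y (Suc n) - ?y n) + (?y (Suc n) - ?y n) * ?y n) / 2"
    unfolding eq by simp
  also have "\<dots> = (1 + ?y (Suc n) * ?y (Suc n)) / 2 - (1 + ?y n * ?y n) / 2"
    by (simp add: field_simps del: sqrt_iter_real.simps)
  also have "\<dots> = ?y (Suc (Suc n)) - ?y (Suc n)" by simp
  finally show ?case .
qed

lemma sqrt_iter_convergent:
  fixes Q :: "'a::banach \<Rightarrow>\<^sub>L 'a"
  assumes "norm Q \<le> 1"
  shows "convergent (sqrt_iter Q)"
proof -
  have "convergent sqrt_iter_real"
    using sqrt_iter_real_bounds sqrt_iter_real_incseq by (intro Bseq_monoseq_convergent BseqI'[of _ 1] )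
      (auto simp: incseq_imp_monoseq)
  then have "summable (\<lambda>n. sqrt_iter_real (Suc n) - sqrt_iter_real n)"
    by (metis convergent_def sums_summable telescope_sums)
  then have "summable (\<lambda>n. sqrt_iter Q (Suc n) - sqrt_iter Q n)"
    by (rule summable_comparison_test') (rule norm_sqrt_iter_Suc_diff[OF assms])
  then have "convergent (\<lambda>n. \<Sum>i<n. sqrt_iter Q (Suc i) - sqrt_iter Q i)"
    by (simp add: summable_iff_convergent)
  then show ?thesis by (simp only: sum_lessThan_telescope) simp
qed

text \<open>Polarisation: for unit vectors a and b along x and Qx, 4 Qa \<bullet> b is the
  difference of the quadratic form at a + b and at a - b, hence at most |a + b|^2 \<le> 4, while Qa
  \<bullet> b = |Qx| / |x|.\<close>

lemma norm_le_one_of_psd: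
  fixes Q :: "'a::real_inner \<Rightarrow>\<^sub>L 'a"
  assumes sa: "self_adjoint Q" and Q0: "\<And>x. 0 \<le> Q x \<bullet> x" and Q1: "\<And>x. Q x \<bullet> x \<le> x \<bullet> x"
  shows "norm Q \<le> 1"
proof (rule norm_blinfun_bound)
  fix x
  let ?s = "norm x" and ?r = "norm (Q x)"
  show "norm (Q x) \<le> 1 * norm x"
  proof (cases "x = 0 \<or> Q x = 0")
    case False
    then have p: "?s > 0" "?r > 0" by auto
    define a where "a = x /\<^sub>R ?s" define b where "b = Q x /\<^sub>R ?r"
    have ab: "a \<bullet> a = 1" "b \<bullet> b = 1"
      using False by (auto simp: a_def b_def dot_square_norm power2_eq_square)
    have Qab: "Q a \<bullet> b = Q b \<bullet> a" using sa by (simp add: self_adjoint_def inner_commute)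
    have "4 * (Q a \<bullet> b) = Q (a + b) \<bullet> (a + b) - Q (a - b) \<bullet> (a - b)"
      using Qab by (simp add: blinfun.add_right blinfun.diff_right inner_simps)
    also have "\<dots> \<le> (a + b) \<bullet> (a + b)" using Q0[of "a - b"] Q1[of "a + b"] by linarith
    also have "\<dots> \<le> 4"
    proof -
      have "a \<bullet> b \<le> 1" using norm_cauchy_schwarz[of a b] ab by (simp add: norm_eq_sqrt_inner)
      then show ?thesis using ab by (simp add: inner_simps inner_commute)
    qed
    finally have "Q a \<bullet> b \<le> 1" by simp
    moreover have "Q a \<bullet> b = ?r / ?s"
      using p by (simp add: a_def b_def blinfun.scaleR_right dot_square_norm power2_eq_square field_simps)
    ultimately show ?thesis using p by (simp add: field_simps)
  qed auto
qed simp

text \<open>The last conclusion is what uniqueness rests on: any other root of \<open>B\<close>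
  commutes with \<open>B\<close>, hence with this one. It holds because the root is a limit of
  polynomials in \<open>B\<close>.\<close>

lemma sqrt_op_exists:
  fixes B :: "'a::{real_inner, banach} \<Rightarrow>\<^sub>L 'a"
  assumes sa: "self_adjoint B" and B0: "\<And>x. 0 \<le> B x \<bullet> x"
  obtains R where "self_adjoint R" "\<And>x. 0 \<le> R x \<bullet> x" "R o\<^sub>L R = B"
    "\<And>C. C o\<^sub>L B = B o\<^sub>L C \<Longrightarrow> C o\<^sub>L R = R o\<^sub>L C"
proof -
  \<comment> \<open>Scaling by more than the norm puts 1 - B/c between 0 and 1 as a quadratic form;
    the summand 1 keeps the divisor positive when \<open>B\<close> is zero.\<close>
  define c where "c = norm B + 1"
  have c: "c > 0" by (simp add: c_def add_pos_nonneg add.commute)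
  define Q where "Q = id_blinfun - (1/c) *\<^sub>R B"
  have Qapp: "Q x = x - (1/c) *\<^sub>R B x" for x
    by (simp add: Q_def blinfun.diff_left blinfun.scaleR_left)
  have saQ: "self_adjoint Q"
    using sa by (auto simp: self_adjoint_def Qapp inner_simps)
  have nQ: "norm Q \<le> 1"
  proof (rule norm_le_one_of_psd[OF saQ])
    fix x
    have "B x \<bullet> x \<le> norm B * norm x * norm x"
      by (rule order_trans[OF norm_cauchy_schwarz]) (intro mult_right_mono norm_blinfun; simp)
    also have "\<dots> \<le> c * (x \<bullet> x)"
      by (simp add: c_def dot_square_norm power2_eq_square algebra_simps)
    finally show "0 \<le> Q x \<bullet> x" using c by (simp add: Qapp inner_simps field_simps)
    show "Q x \<bullet> x \<le> x \<bullet> x" using c B0[of x] by (simp add: Qapp inner_simps)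
  qed
  obtain Y where Y: "sqrt_iter Q \<longlonglongrightarrow> Y"
    using sqrt_iter_convergent[OF nQ] by (auto simp: convergent_def)
  have Yx: "(\<lambda>n. sqrt_iter Q n x) \<longlonglongrightarrow> Y x" for x
    by (rule blinfun.tendsto[OF Y tendsto_const])
  have nY: "norm Y \<le> 1"
    by (rule LIMSEQ_le_const2[OF tendsto_norm[OF Y]])
       (use norm_sqrt_iter_le[OF nQ] sqrt_iter_real_bounds in \<open>meson order_trans\<close>)
  have fixY: "Y = (1/2) *\<^sub>R (Q + (Y o\<^sub>L Y))"
  proof (rule LIMSEQ_unique)
    show "(\<lambda>n. sqrt_iter Q (Suc n)) \<longlonglongrightarrow> Y" using Y by (rule LIMSEQ_Suc)
    show "(\<lambda>n. sqrt_iter Q (Suc n)) \<longlonglongrightarrow> (1/2) *\<^sub>R (Q + (Y o\<^sub>L Y))"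
      unfolding sqrt_iter.simps
      by (intro tendsto_intros bounded_bilinear.tendsto[OF bounded_bilinear_blinfun_compose] Y)
  qed
  have saY: "self_adjoint Y"
  proof -
    have "self_adjoint (sqrt_iter Q n)" for n
      by (induction n) (use saQ in \<open>auto simp: self_adjoint_def blinfun.scaleR_left blinfun.add_left inner_simps\<close>)
    then have "(\<lambda>n. sqrt_iter Q n x \<bullet> y) = (\<lambda>n. x \<bullet> sqrt_iter Q n y)" for x y
      by (auto simp: self_adjoint_def)
    moreover have "(\<lambda>n. sqrt_iter Q n x \<bullet> y) \<longlonglongrightarrow> Y x \<bullet> y" for x y by (intro tendsto_intros Yx)
    moreover have "(\<lambda>n. x \<bullet> sqrt_iter Q n y) \<longlonglongrightarrow> x \<bullet> Y y" for x y by (intro tendsto_intros Yx)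
    ultimately show ?thesis unfolding self_adjoint_def using LIMSEQ_unique by metis
  qed
  define R where "R = sqrt c *\<^sub>R (id_blinfun - Y)"
  have Rapp: "R x = sqrt c *\<^sub>R (x - Y x)" for x
    by (simp add: R_def blinfun.diff_left blinfun.scaleR_left)
  show ?thesis
  proof
    show "self_adjoint R" using saY by (auto simp: self_adjoint_def Rapp inner_simps)
    show "0 \<le> R x \<bullet> x" for x
    proof -
      have "Y x \<bullet> x \<le> norm (Y x) * norm x" by (rule norm_cauchy_schwarz)
      also have "\<dots> \<le> (1 * norm x) * norm x"
        by (intro mult_right_mono order_trans[OF norm_blinfun] nY) auto
      finally have "Y x \<bullet> x \<le> x \<bullet> x" by (simp add: dot_square_norm power2_eq_square)
      then show ?thesis using c by (simp add: Rapp inner_simps)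
    qed
    show "R o\<^sub>L R = B"
    proof (rule blinfun_eqI)
      fix x
      have "Y x = (1/2) *\<^sub>R (Q x + Y (Y x))"
        by (subst fixY) (simp add: blinfun.scaleR_left blinfun.add_left)
      then have "2 *\<^sub>R Y x = 2 *\<^sub>R ((1/2) *\<^sub>R (Q x + Y (Y x)))" by (rule arg_cong)
      then have "2 *\<^sub>R Y x = Q x + Y (Y x)" by simp
      then have "B x = c *\<^sub>R (x - 2 *\<^sub>R Y x + Y (Y x))"
        using c by (simp add: Qapp)
      also have "\<dots> = R (R x)"
        using c by (simp add: Rapp blinfun.scaleR_right blinfun.diff_right scaleR_2 algebra_simps)
      finally show "(R o\<^sub>L R) x = B x" by simp
    qed
    fix C :: "'a \<Rightarrow>\<^sub>L 'a" assume C: "C o\<^sub>L B = B o\<^sub>L C"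
    then have "C (B x) = B (C x)" for x by (metis blinfun_apply_blinfun_compose)
    then have CQ: "C (Q x) = Q (C x)" for x by (simp add: Qapp blinfun.diff_right blinfun.scaleR_right)
    have "C (sqrt_iter Q n x) = sqrt_iter Q n (C x)" for n x
      by (induction n arbitrary: x)
         (simp_all add: CQ blinfun.scaleR_left blinfun.scaleR_right blinfun.add_left blinfun.add_right)
    then have "C (Y x) = Y (C x)" for x
      using LIMSEQ_unique[OF _ Yx[of "C x"]] blinfun.tendsto[OF tendsto_const Yx[of x], of C] by simp
    then show "C o\<^sub>L R = R o\<^sub>L C"
      by (intro blinfun_eqI) (simp add: Rapp blinfun.diff_right blinfun.scaleR_right)
  qed
qed

text \<open>Uniqueness, which the definite description requires: if U and R are commuting positive
  roots, R + U annihilates y = Rx - Ux. Both forms then vanish at y, so Ry = Uy = 0, and moving R -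
  U across the inner product gives |y|^2 = 0.\<close>

lemma sqrt_op:
  fixes B :: "'a::{real_inner, banach} \<Rightarrow>\<^sub>L 'a"
  assumes "self_adjoint B" and "\<And>x. 0 \<le> B x \<bullet> x"
  shows "self_adjoint (sqrt_op B)" "sqrt_op B o\<^sub>L sqrt_op B = B"
proof -
  obtain R where R: "self_adjoint R" "\<And>x. 0 \<le> R x \<bullet> x" "R o\<^sub>L R = B"
    and comm: "\<And>C. C o\<^sub>L B = B o\<^sub>L C \<Longrightarrow> C o\<^sub>L R = R o\<^sub>L C"
    using sqrt_op_exists[OF assms] by metis
  have uniq: "U = R" if U: "self_adjoint U" "\<And>x. 0 \<le> U x \<bullet> x" "U o\<^sub>L U = B" for U
  proof (rule blinfun_eqI)
    fix x
    have BU: "B z = U (U z)" and BR: "B z = R (R z)" for z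
      using U(3) R(3) by (auto simp flip: blinfun_apply_blinfun_compose)
    have "U o\<^sub>L R = R o\<^sub>L U" by (rule comm) (rule blinfun_eqI, simp add: BU)
    then have UR: "U (R z) = R (U z)" for z by (metis blinfun_apply_blinfun_compose)
    define y where "y = R x - U x"
    have "R y + U y = 0" using BU[of x] BR[of x] by (simp add: y_def blinfun.diff_right UR)
    then have s: "R y \<bullet> y + U y \<bullet> y = 0" by (metis inner_add_left inner_zero_left)
    then have "R y \<bullet> y = 0" "U y \<bullet> y = 0" using R(2)[of y] U(2)[of y] by auto
    then have "R y = 0" "U y = 0" using psd_kernel R(1,2) U(1,2) by blast+
    then have "y \<bullet> y = 0"
      unfolding y_def using R(1) U(1) by (metis inner_diff_left inner_zero_right diff_zero self_adjoint_def)
    then show "U x = R x" by (simp add: y_def)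
  qed
  have "self_adjoint (sqrt_op B) \<and> (\<forall>x. 0 \<le> sqrt_op B x \<bullet> x) \<and> sqrt_op B o\<^sub>L sqrt_op B = B"
    unfolding sqrt_op_def by (rule theI[of _ R], use R in blast, use uniq in blast)
  then show "self_adjoint (sqrt_op B)" "sqrt_op B o\<^sub>L sqrt_op B = B" by auto
qed

section \<open>The weak norm, and weakly convergent sequences\<close>

lemma norm_m1_power2:
  fixes B :: "'a::{real_inner, banach} \<Rightarrow>\<^sub>L 'a"
  assumes "self_adjoint B" and "\<And>x. 0 \<le> B x \<bullet> x"
  shows "(norm_m1 B x)\<^sup>2 = B x \<bullet> x"
proof -
  have "(norm_m1 B x)\<^sup>2 = sqrt_op B (sqrt_op B x) \<bullet> x"
    using sqrt_op(1)[OF assms] by (simp add: norm_m1_def power2_norm_eq_inner self_adjoint_def)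
  then show ?thesis using sqrt_op(2)[OF assms] by (simp flip: blinfun_apply_blinfun_compose)
qed

lemma norm_m1_nonneg [simp]: "0 \<le> norm_m1 B x"
  by (simp add: norm_m1_def)

lemma norm_m1_le: "norm_m1 B x \<le> norm (sqrt_op B) * norm x"
  by (simp add: norm_m1_def norm_blinfun)

lemma norm_m1_triangle: "norm_m1 B (x + y) \<le> norm_m1 B x + norm_m1 B y"
  by (simp add: norm_m1_def blinfun.add_right norm_triangle_ineq)

text \<open>Gliding hump: the signs of increments of norm \<open>3\<^sup>-\<^sup>n\<close> are chosen so that the pairing with the
  \<open>n\<close>-th term of a fast growing subsequence is not cancelled, and the later increments are too small to undo it.\<close>

lemma weakly_converges_bounded:
  fixes xs :: "nat \<Rightarrow> 'a::{real_inner, banach}"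
  assumes "weakly_converges xs x"
  shows "\<exists>C. \<forall>k. norm (xs k) \<le> C"
proof (rule ccontr)
  assume neg: "\<not> ?thesis"
  then have "\<exists>k. norm (xs k) > C" for C by (meson not_less)
  \<comment> \<open>Growth 4^n against increments of size 3^-n leaves pairings of order (4/3)^n,
    which is unbounded.\<close>
  then have "\<exists>k. norm (xs k) \<ge> 4 ^ n" for n :: nat by (meson less_imp_le)
  then obtain k where k: "\<And>n. norm (xs (k n)) \<ge> 4 ^ n" by metis
  have kp: "norm (xs (k n)) > 0" for n
    by (rule less_le_trans[OF _ k[of n]]) simp
  define e where "e n = (1/3) ^ n *\<^sub>R (xs (k n) /\<^sub>R norm (xs (k n)))" for n
  have ne: "norm (e n) = (1/3) ^ n" for n using kp[of n] by (simp add: e_def)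
  have ex: "xs (k n) \<bullet> e n = (1/3) ^ n * norm (xs (k n))" for n
    using kp[of n] by (simp add: e_def dot_square_norm power2_eq_square)
  define y where "y = rec_nat (0::'a) (\<lambda>n y. if xs (k n) \<bullet> y \<ge> 0 then y + e n else y - e n)"
  have ys: "y (Suc n) = (if xs (k n) \<bullet> y n \<ge> 0 then y n + e n else y n - e n)" for n
    by (simp add: y_def)
  have d: "norm (y (Suc n) - y n) = (1/3) ^ n" for n using ne[of n] by (simp add: ys)
  have big: "\<bar>xs (k n) \<bullet> y (Suc n)\<bar> \<ge> (1/3) ^ n * norm (xs (k n))" for n
    using ex[of n] by (auto simp: ys inner_add_right inner_diff_right)
  have sm: "summable (\<lambda>n. y (Suc n) - y n)"
    by (rule summable_comparison_test'[of "\<lambda>n. (1/3) ^ n"]) (auto simp: d)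
  then have "convergent (\<lambda>n. \<Sum>i<n. y (Suc i) - y i)" by (simp add: summable_iff_convergent)
  then have "convergent y" by (simp only: sum_lessThan_telescope) (simp add: y_def)
  then obtain l where l: "y \<longlonglongrightarrow> l" by (auto simp: convergent_def)
  have yd: "norm (y (Suc n + m) - y (Suc n)) \<le> (1/3) ^ n * (1/2)" for n m
  proof -
    \<comment> \<open>The exact geometric partial sum is carried along, since the bound by its limit
      would not reproduce itself in the induction. The limit is half of the increment made at stage
      n, so at least half of the pairing survives.\<close>
    have "norm (y (Suc n + m) - y (Suc n)) \<le> (1/3) ^ n * (1/2) * (1 - (1/3) ^ m)"
    proof (induction m)
      case (Suc m)
      have "norm (y (Suc n + Suc m) - y (Suc n)) \<le> norm (y (Suc (Suc n + m)) - y (Suc n + m)) + norm (y (Suc n + m) - y (Suc n))"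
        using norm_triangle_ineq[of "y (Suc (Suc n + m)) - y (Suc n + m)" "y (Suc n + m) - y (Suc n)"] by simp
      also have "\<dots> \<le> (1/3) ^ (Suc n + m) + (1/3) ^ n * (1/2) * (1 - (1/3) ^ m)"
        using Suc d by (metis add_mono order_refl)
      also have "\<dots> = (1/3) ^ n * (1/2) * (1 - (1/3) ^ Suc m)"
        by (simp add: power_add field_simps)
      finally show ?case .
    qed simp
    also have "\<dots> \<le> (1/3) ^ n * (1/2)" by simp
    finally show ?thesis .
  qed
  have ld: "norm (l - y (Suc n)) \<le> (1/3) ^ n * (1/2)" for n
  proof (rule LIMSEQ_le_const2)
    show "(\<lambda>m. norm (y (Suc n + m) - y (Suc n))) \<longlonglongrightarrow> norm (l - y (Suc n))"
      by (intro tendsto_intros LIMSEQ_ignore_initial_segment[OF l, of "Suc n", simplified add.commute[of _ "Suc n"]])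
  qed (use yd in blast)
  have unb: "\<bar>xs (k n) \<bullet> l\<bar> \<ge> (4/3) ^ n * (1/2)" for n
  proof -
    have "\<bar>xs (k n) \<bullet> (l - y (Suc n))\<bar> \<le> norm (xs (k n)) * ((1/3) ^ n * (1/2))"
      by (rule order_trans[OF Cauchy_Schwarz_ineq2]) (intro mult_left_mono ld; simp)
    then have "\<bar>xs (k n) \<bullet> l\<bar> \<ge> (1/3) ^ n * (1/2) * norm (xs (k n))"
      using big[of n] unfolding inner_diff_right by (simp add: mult.commute abs_if split: if_splits)
    moreover have "(1/3) ^ n * (1/2) * norm (xs (k n)) \<ge> (1/3) ^ n * (1/2) * 4 ^ n"
      by (intro mult_left_mono k) simp
    moreover have "(1/3) ^ n * (1/2) * 4 ^ n = (4/3 :: real) ^ n * (1/2)" by (simp add: power_divide)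
    ultimately show ?thesis by linarith
  qed
  have "Bseq (\<lambda>j. xs j \<bullet> l)"
    using assms by (intro convergent_imp_Bseq) (auto simp: weakly_converges_def convergent_def)
  then obtain C where C: "\<And>j. \<bar>xs j \<bullet> l\<bar> \<le> C" by (auto simp: Bseq_def)
  obtain n where "(4/3 :: real) ^ n > 2 * C" using real_arch_pow[of "4/3" "2 * C"] by auto
  then show False using unb[of n] C[of "k n"] by simp
qed

subsection \<open>Integrals over intervals and a Gronwall inequality with integrable kernel\<close>

lemma set_borel_measurable_iff_lebesgue_on:
  fixes f :: "real \<Rightarrow> 'b::real_normed_vector"
  shows "set_borel_measurable lebesgue {a..b} f \<longleftrightarrow> f \<in> borel_measurable (lebesgue_on {a..b})"
  unfolding set_borel_measurable_def by (subst borel_measurable_restrict_space_iff) auto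

lemma set_borel_measurable_of_integrable:
  fixes f :: "real \<Rightarrow> 'b::{banach, second_countable_topology}"
  assumes "set_integrable lebesgue {a..b} f"
  shows "set_borel_measurable lebesgue {a..b} f"
  using assms unfolding set_integrable_def set_borel_measurable_def by (rule borel_measurable_integrable)

lemma set_borel_measurable_continuous:
  fixes f :: "real \<Rightarrow> 'b::{banach, second_countable_topology}"
  assumes "continuous_on {a..b} f"
  shows "set_borel_measurable lebesgue {a..b} f"
  unfolding set_borel_measurable_iff_lebesgue_on
  using assms by (intro continuous_imp_measurable_on_sets_lebesgue) auto

lemma set_integrable_dominated:
  fixes f :: "real \<Rightarrow> 'b::{banach, second_countable_topology}"
  assumes "set_integrable lebesgue {a..b} w" "set_borel_measurable lebesgue {a..b} f"
    and "\<And>x. x \<in> {a..b} \<Longrightarrow> norm (f x) \<le> w x"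
  shows "set_integrable lebesgue {a..b} f"
  by (rule set_integrable_bound[OF assms(1,2)]) (use assms(3) in \<open>auto intro!: AE_I2 order_trans[OF assms(3)]\<close>)

lemma set_integrable_continuous_interval:
  fixes f :: "real \<Rightarrow> 'b::{banach, second_countable_topology}"
  assumes "continuous_on {a..b} f"
  shows "set_integrable lebesgue {a..b} f"
proof -
  have "compact (f ` {a..b})" using assms by (intro compact_continuous_image) auto
  then obtain C where C: "\<And>x. x \<in> {a..b} \<Longrightarrow> norm (f x) \<le> C"
    using compact_imp_bounded by (fastforce simp: bounded_iff)
  have "set_integrable lebesgue {a..b} (\<lambda>x. C)"
    using lmeasurable_iff_integrable[of "{a..b}"] by (simp add: set_integrable_def)
  then show ?thesis by (rule set_integrable_dominated[OF _ set_borel_measurable_continuous[OF assms] C])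
qed

lemma set_integrable_mult_continuous:
  fixes k f :: "real \<Rightarrow> real"
  assumes k: "set_integrable lebesgue {a..b} k" and f: "continuous_on {a..b} f"
  shows "set_integrable lebesgue {a..b} (\<lambda>x. k x * f x)"
proof -
  have "compact (f ` {a..b})" using f by (intro compact_continuous_image) auto
  then obtain C where C: "\<And>x. x \<in> {a..b} \<Longrightarrow> \<bar>f x\<bar> \<le> C"
    using compact_imp_bounded by (fastforce simp: bounded_iff)
  show ?thesis
  proof (rule set_integrable_dominated)
    show "set_integrable lebesgue {a..b} (\<lambda>x. C * \<bar>k x\<bar>)"
      using set_integrable_abs[OF k] by simp
    show "set_borel_measurable lebesgue {a..b} (\<lambda>x. k x * f x)"
      using set_borel_measurable_of_integrable[OF k] set_borel_measurable_continuous[OF f]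
      unfolding set_borel_measurable_iff_lebesgue_on by measurable
    show "norm (k x * f x) \<le> C * \<bar>k x\<bar>" if "x \<in> {a..b}" for x
      using mult_right_mono[OF C[OF that], of "\<bar>k x\<bar>"] by (simp add: abs_mult mult.commute)
  qed
qed

lemma set_integrable_subinterval:
  fixes f :: "real \<Rightarrow> 'b::{banach, second_countable_topology}"
  assumes "set_integrable lebesgue {a..b} f" "a \<le> c" "d \<le> b"
  shows "set_integrable lebesgue {c..d} f"
  by (rule set_integrable_subset[OF assms(1)]) (use assms in auto)

lemma set_integral_interval_split:
  fixes f :: "real \<Rightarrow> 'b::{banach, second_countable_topology}"
  assumes "set_integrable lebesgue {a..c} f" "a \<le> b" "b \<le> c"
  shows "(LINT x:{a..c}|lebesgue. f x) = (LINT x:{a..b}|lebesgue. f x) + (LINT x:{b..c}|lebesgue. f x)"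
proof -
  have "AE x in lebesgue. x \<noteq> b" by (rule AE_I'[of "{b}"]) auto
  then have ae: "AE x in lebesgue. \<not> (x \<in> {a..b} \<and> x \<in> {b..c})" by eventually_elim auto
  have "{a..c} = {a..b} \<union> {b..c}" using assms by auto
  then show ?thesis
    using set_integral_Un_AE[OF ae _ _ set_integrable_subinterval[OF assms(1)] set_integrable_subinterval[OF assms(1)]] assms
    by simp
qed

lemma set_integral_singleton [simp]:
  fixes f :: "real \<Rightarrow> 'b::{banach, second_countable_topology}"
  shows "(LINT x:{a}|lebesgue. f x) = 0"
proof -
  have "AE x in lebesgue. x \<noteq> a" by (rule AE_I'[of "{a}"]) auto
  then show ?thesis
    unfolding set_lebesgue_integral_def by (intro integral_eq_zero_AE) (auto elim!: eventually_mono)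
qed

lemma norm_set_integral_le:
  fixes f :: "real \<Rightarrow> 'b::{banach, second_countable_topology}"
  assumes "set_integrable lebesgue {a..b} f" "set_integrable lebesgue {a..b} w"
    and "\<And>x. x \<in> {a..b} \<Longrightarrow> norm (f x) \<le> w x"
  shows "norm (LINT x:{a..b}|lebesgue. f x) \<le> (LINT x:{a..b}|lebesgue. w x)"
  unfolding set_lebesgue_integral_def
proof (rule order_trans[OF integral_norm_bound])
  show "(LINT x|lebesgue. norm (indicat_real {a..b} x *\<^sub>R f x)) \<le> (LINT x|lebesgue. indicat_real {a..b} x *\<^sub>R w x)"
    using assms unfolding set_integrable_def
    by (intro integral_mono integrable_norm) (auto simp: indicator_def)
qed

lemma set_integral_interval_const:
  "(LINT x:{a..b}|lebesgue. c) = max 0 (b - a) *\<^sub>R (c :: 'b::{banach, second_countable_topology})"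
  by (simp add: set_lebesgue_integral_def max_def)

lemma set_integral_nonneg_mono:
  fixes f :: "real \<Rightarrow> real"
  assumes "set_integrable lebesgue {a..b} f" "\<And>x. x \<in> {a..b} \<Longrightarrow> 0 \<le> f x" "a \<le> c" "d \<le> b"
  shows "(LINT x:{c..d}|lebesgue. f x) \<le> (LINT x:{a..b}|lebesgue. f x)"
  unfolding set_lebesgue_integral_def
proof (rule integral_mono)
  show "integrable lebesgue (\<lambda>x. indicat_real {c..d} x *\<^sub>R f x)"
    using set_integrable_subinterval[OF assms(1,3,4)] by (simp add: set_integrable_def)
  show "integrable lebesgue (\<lambda>x. indicat_real {a..b} x *\<^sub>R f x)"
    using assms(1) by (simp add: set_integrable_def)
qed (use assms in \<open>auto simp: indicator_def\<close>)

text \<open>The upper limit and the integrand move together, as they do in a convolution with the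
  semigroup. The indicators converge except at the single point x = s, so dominated convergence
  applies.\<close>

lemma continuous_on_set_integral_param:
  fixes h :: "real \<Rightarrow> real \<Rightarrow> 'b::{banach, second_countable_topology}"
  assumes w: "set_integrable lebesgue {a..b} w"
    and meas: "\<And>s. s \<in> {a..b} \<Longrightarrow> set_borel_measurable lebesgue {a..b} (h s)"
    and bound: "\<And>s x. s \<in> {a..b} \<Longrightarrow> x \<in> {a..b} \<Longrightarrow> norm (h s x) \<le> w x"
    and cont: "\<And>x. x \<in> {a..b} \<Longrightarrow> continuous_on {a..b} (\<lambda>s. h s x)"
  shows "continuous_on {a..b} (\<lambda>s. LINT x:{a..s}|lebesgue. h s x)"
  unfolding continuous_on_sequentially comp_def
proof (intro ballI allI impI, elim conjE)
  fix xs s assume s: "s \<in> {a..b}" and xs: "\<forall>n. xs n \<in> {a..b}" and lim: "xs \<longlonglongrightarrow> s"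
  show "(\<lambda>n. LINT x:{a..xs n}|lebesgue. h (xs n) x) \<longlonglongrightarrow> (LINT x:{a..s}|lebesgue. h s x)"
    unfolding set_lebesgue_integral_def
  proof (rule integral_dominated_convergence)
    show "integrable lebesgue (\<lambda>x. indicat_real {a..b} x *\<^sub>R w x)"
      using w by (simp add: set_integrable_def)
    show "(\<lambda>x. indicat_real {a..s} x *\<^sub>R h s x) \<in> borel_measurable lebesgue"
      using set_borel_measurable_subset[OF meas[OF s], of "{a..s}"] s by (simp add: set_borel_measurable_def)
    show "(\<lambda>x. indicat_real {a..xs n} x *\<^sub>R h (xs n) x) \<in> borel_measurable lebesgue" for n
      using set_borel_measurable_subset[OF meas, of "xs n" "{a..xs n}"] xs by (simp add: set_borel_measurable_def)
    show "AE x in lebesgue. norm (indicat_real {a..xs n} x *\<^sub>R h (xs n) x) \<le> indicat_real {a..b} x *\<^sub>R w x" for n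
    proof (rule AE_I2)
      fix x
      have "xs n \<in> {a..b}" "x \<in> {a..xs n} \<Longrightarrow> x \<in> {a..b}"
        using spec[OF xs, of n] by auto
      then show "norm (indicat_real {a..xs n} x *\<^sub>R h (xs n) x) \<le> indicat_real {a..b} x *\<^sub>R w x"
        using bound[of "xs n" x] order_trans[OF norm_ge_zero bound[OF s, of x]]
        by (cases "x \<in> {a..xs n}"; cases "x \<in> {a..b}") auto
    qed
    have "AE x in lebesgue. x \<noteq> s" by (rule AE_I'[of "{s}"]) auto
    then show "AE x in lebesgue. (\<lambda>n. indicat_real {a..xs n} x *\<^sub>R h (xs n) x) \<longlonglongrightarrow> indicat_real {a..s} x *\<^sub>R h s x"
    proof eventually_elim
      case (elim x)
      consider "x < a" | "a \<le> x" "x < s" | "s < x" using elim by linarith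
      then show ?case
      proof cases
        case 1 then show ?thesis by (simp add: indicator_def)
      next
        case 2
        have "eventually (\<lambda>n. x < xs n) sequentially" using lim 2 by (simp add: order_tendstoD)
        then have "eventually (\<lambda>n. h (xs n) x = indicat_real {a..xs n} x *\<^sub>R h (xs n) x) sequentially"
          by eventually_elim (use 2 in auto)
        moreover have "(\<lambda>n. h (xs n) x) \<longlonglongrightarrow> h s x"
          using cont[of x] 2 s xs lim unfolding continuous_on_sequentially comp_def by auto
        ultimately show ?thesis using 2 by (simp add: Lim_transform_eventually)
      next
        case 3
        have "eventually (\<lambda>n. xs n < x) sequentially" using lim 3 by (simp add: order_tendstoD)
        then have "eventually (\<lambda>n. 0 = indicat_real {a..xs n} x *\<^sub>R h (xs n) x) sequentially"
          by eventually_elim auto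
        then show ?thesis using 3 by (simp add: Lim_transform_eventually[OF tendsto_const])
      qed
    qed
  qed
qed

lemma continuous_on_indefinite_set_integral:
  fixes f :: "real \<Rightarrow> 'b::{banach, second_countable_topology}"
  assumes "set_integrable lebesgue {a..b} f"
  shows "continuous_on {a..b} (\<lambda>s. LINT x:{a..s}|lebesgue. f x)"
  by (rule continuous_on_set_integral_param[where w = "\<lambda>x. norm (f x)"])
     (use assms in \<open>auto intro!: set_borel_measurable_of_integrable simp: set_integrable_norm\<close>)

text \<open>A substitute for the chain rule for absolutely continuous functions: halving the increment
  of \<open>K\<close> halves the error bound, so the increment of \<open>D\<close> vanishes.\<close>

lemma increment_nonpos_of_quadratic_bound:
  fixes D K :: "real \<Rightarrow> real"
  assumes K: "continuous_on {a..b} K" and ab: "a \<le> b"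
    and bound: "\<And>r s. a \<le> r \<Longrightarrow> r \<le> s \<Longrightarrow> s \<le> b \<Longrightarrow> D s - D r \<le> C * (K s - K r)\<^sup>2"
  shows "D b \<le> D a"
proof -
  have *: "D s - D r \<le> C * (K s - K r)\<^sup>2 / 2 ^ n" if "a \<le> r" "r \<le> s" "s \<le> b" for r s n
    using that
  proof (induction n arbitrary: r s)
    case 0
    then show ?case using bound by simp
  next
    case (Suc n)
    have c: "continuous_on {r..s} K" using K Suc.prems by (auto intro: continuous_on_subset)
    have "\<exists>m. r \<le> m \<and> m \<le> s \<and> K m = (K r + K s) / 2"
    proof (cases "K r \<le> K s")
      case True
      then show ?thesis using IVT'[of K r "(K r + K s) / 2" s] c Suc.prems by auto
    next
      case False
      then show ?thesis using IVT2'[of K s "(K r + K s) / 2" r] c Suc.prems by auto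
    qed
    then obtain m where m: "r \<le> m" "m \<le> s" "K m = (K r + K s) / 2" by blast
    have "D s - D m \<le> C * (K s - K m)\<^sup>2 / 2 ^ n" "D m - D r \<le> C * (K m - K r)\<^sup>2 / 2 ^ n"
      using Suc.IH Suc.prems m by auto
    moreover have "K s - K m = (K s - K r) / 2" "K m - K r = (K s - K r) / 2"
      using m(3) by (auto simp: field_simps)
    ultimately show ?case by (simp add: power_divide)
  qed
  have "(\<lambda>n. C * (K b - K a)\<^sup>2 * (1/2) ^ n) \<longlonglongrightarrow> C * (K b - K a)\<^sup>2 * 0"
    by (intro tendsto_intros LIMSEQ_realpow_zero) auto
  moreover have "D b - D a \<le> C * (K b - K a)\<^sup>2 * (1/2) ^ n" for n
    using *[of a b n] ab by (simp add: power_one_over)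
  ultimately have "D b - D a \<le> C * (K b - K a)\<^sup>2 * 0"
    by (intro LIMSEQ_le_const) blast+
  then show ?thesis by simp
qed

section \<open>Gronwall's inequality in an exponentially weighted norm\<close>

text \<open>Formally the integrand is half the derivative of exp (2 K), but K is only an indefinite
  integral. On a subinterval both the integral and the increment of the exponential agree with their
  linearisations up to the square of the increment of K, and the preceding lemma turns this into the
  global bound.\<close>

lemma integral_kernel_exp_le:
  fixes k :: "real \<Rightarrow> real"
  assumes k: "set_integrable lebesgue {a..b} k" and k0: "\<And>x. x \<in> {a..b} \<Longrightarrow> 0 \<le> k x"
    and s: "s \<in> {a..b}"
  defines "K \<equiv> \<lambda>s. LINT x:{a..s}|lebesgue. k x"
  shows "(LINT x:{a..s}|lebesgue. k x * exp (2 * K x)) \<le> exp (2 * K s) / 2"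
proof -
  have Kc: "continuous_on {a..b} K" unfolding K_def by (rule continuous_on_indefinite_set_integral[OF k])
  have kek: "set_integrable lebesgue {a..b} (\<lambda>x. k x * exp (2 * K x))"
    by (rule set_integrable_mult_continuous[OF k]) (intro continuous_intros Kc)
  have Kd: "K y - K x = (LINT z:{x..y}|lebesgue. k z)" if "a \<le> x" "x \<le> y" "y \<le> b" for x y
    unfolding K_def using set_integral_interval_split[of a y k x] set_integrable_subinterval[OF k] that by simp
  have Kmono: "K x \<le> K y" if "a \<le> x" "x \<le> y" "y \<le> b" for x y
  proof -
    have "0 \<le> (LINT z:{x..y}|lebesgue. k z)"
      unfolding set_lebesgue_integral_def using that k0 by (intro integral_nonneg_AE AE_I2) (auto simp: indicator_def)
    then show ?thesis using Kd[OF that] by simp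
  qed
  define D where "D s = 2 * (LINT x:{a..s}|lebesgue. k x * exp (2 * K x)) - exp (2 * K s)" for s
  have "D s \<le> D a"
  proof (rule increment_nonpos_of_quadratic_bound[where K = K and D = D and a = a and b = s and C = "4 * exp (2 * K b)"])
    show "continuous_on {a..s} K" using Kc by (rule continuous_on_subset) (use s in auto)
    fix x y assume xy: "a \<le> x" "x \<le> y" "y \<le> s"
    then have yb: "y \<le> b" using s by simp
    have e1: "D y - D x = 2 * (LINT z:{x..y}|lebesgue. k z * exp (2 * K z)) - (exp (2 * K y) - exp (2 * K x))"
      unfolding D_def using set_integral_interval_split[of a y "\<lambda>x. k x * exp (2 * K x)" x]
        set_integrable_subinterval[OF kek] xy yb by simp
    have "(LINT z:{x..y}|lebesgue. k z * exp (2 * K z)) \<le> (LINT z:{x..y}|lebesgue. k z * exp (2 * K y))"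
      using xy yb by (intro set_integral_mono set_integrable_subinterval[OF kek] set_integrable_mult_left
          set_integrable_subinterval[OF k] mult_left_mono k0) (auto intro: Kmono)
    also have "\<dots> = (K y - K x) * exp (2 * K y)" using Kd xy yb by simp
    finally have e2: "(LINT z:{x..y}|lebesgue. k z * exp (2 * K z)) \<le> (K y - K x) * exp (2 * K y)" .
    have e3: "exp (2 * K y) - exp (2 * K x) \<ge> exp (2 * K x) * (2 * K y - 2 * K x)"
      using exp_ge_add_one_self[of "2 * K y - 2 * K x"]
        mult_left_mono[of "1 + (2 * K y - 2 * K x)" "exp (2 * K y - 2 * K x)" "exp (2 * K x)"]
      by (simp add: exp_diff algebra_simps)
    have 1: "D y - D x \<le> 2 * (K y - K x) * (exp (2 * K y) - exp (2 * K x))"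
      using e1 e2 e3 by (simp add: algebra_simps)
    have "exp (2 * K y) - exp (2 * K x) \<le> exp (2 * K y) * (2 * K y - 2 * K x)"
      using exp_ge_add_one_self[of "2 * K x - 2 * K y"]
        mult_left_mono[of "1 + (2 * K x - 2 * K y)" "exp (2 * K x - 2 * K y)" "exp (2 * K y)"]
      by (simp add: exp_diff algebra_simps)
    also have "\<dots> \<le> exp (2 * K b) * (2 * K y - 2 * K x)"
      using Kmono[of x y] Kmono[of y b] xy yb by (intro mult_right_mono) auto
    finally have "2 * (K y - K x) * (exp (2 * K y) - exp (2 * K x)) \<le> 2 * (K y - K x) * (exp (2 * K b) * (2 * K y - 2 * K x))"
      using Kmono[of x y] xy yb by (intro mult_left_mono) auto
    also have "\<dots> = 4 * exp (2 * K b) * (K y - K x)\<^sup>2" by (simp add: power2_eq_square algebra_simps)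
    finally show "D y - D x \<le> 4 * exp (2 * K b) * (K y - K x)\<^sup>2" using 1 by simp
  qed (use s in auto)
  moreover have "D a \<le> 0" by (simp add: D_def K_def)
  ultimately have "D s \<le> 0" by linarith
  then show ?thesis by (simp add: D_def)
qed

text \<open>The maximum m of \<open>\<phi>\<close> exp (-2 K) satisfies m \<le> c + m/2, because the
  factor 2 in the weight makes the integral operator a contraction with constant 1/2. This costs the
  factors 2 in the conclusion, which are harmless here.\<close>

lemma Gronwall_integrable_kernel:
  fixes k \<phi> :: "real \<Rightarrow> real"
  assumes k: "set_integrable lebesgue {a..b} k" and k0: "\<And>x. x \<in> {a..b} \<Longrightarrow> 0 \<le> k x"
    and cont: "continuous_on {a..b} \<phi>"
    and ineq: "\<And>s. s \<in> {a..b} \<Longrightarrow> \<phi> s \<le> c + (LINT x:{a..s}|lebesgue. k x * \<phi> x)"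
    and c: "0 \<le> c" and s: "s \<in> {a..b}"
  shows "\<phi> s \<le> 2 * c * exp (2 * (LINT x:{a..b}|lebesgue. k x))"
proof -
  define K where "K = (\<lambda>s. LINT x:{a..s}|lebesgue. k x)"
  have Kc: "continuous_on {a..b} K" unfolding K_def by (rule continuous_on_indefinite_set_integral[OF k])
  have "continuous_on {a..b} (\<lambda>s. \<phi> s * exp (- 2 * K s))" by (intro continuous_intros cont Kc)
  then obtain s0 where s0: "s0 \<in> {a..b}" "\<And>s. s \<in> {a..b} \<Longrightarrow> \<phi> s * exp (- 2 * K s) \<le> \<phi> s0 * exp (- 2 * K s0)"
    using continuous_attains_sup[OF compact_Icc, of a b] s by blast
  \<comment> \<open>The truncation at 0 covers functions without a sign; a negative maximum needs no
    argument.\<close>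
  define m where "m = max 0 (\<phi> s0 * exp (- 2 * K s0))"
  have m0: "m \<ge> 0" by (simp add: m_def)
  have \<phi>m: "\<phi> s \<le> m * exp (2 * K s)" if "s \<in> {a..b}" for s
  proof -
    have "\<phi> s * exp (- 2 * K s) \<le> m" using s0(2)[OF that] by (simp add: m_def)
    then have "\<phi> s * exp (- 2 * K s) * exp (2 * K s) \<le> m * exp (2 * K s)" by (rule mult_right_mono) simp
    then show ?thesis by (simp add: mult.assoc flip: exp_add)
  qed
  have step: "\<phi> s \<le> c + m / 2 * exp (2 * K s)" if "s \<in> {a..b}" for s
  proof -
    have sub: "set_integrable lebesgue {a..s} k" using k that by (auto intro: set_integrable_subinterval)
    have "(LINT x:{a..s}|lebesgue. k x * \<phi> x) \<le> (LINT x:{a..s}|lebesgue. k x * (m * exp (2 * K x)))"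
      using that by (intro set_integral_mono set_integrable_mult_continuous sub mult_left_mono \<phi>m k0)
        (auto intro!: continuous_intros continuous_on_subset[OF cont] continuous_on_subset[OF Kc])
    also have "\<dots> = m * (LINT x:{a..s}|lebesgue. k x * exp (2 * K x))"
      by (simp flip: set_integral_mult_right add: mult.left_commute)
    also have "\<dots> \<le> m * (exp (2 * K s) / 2)"
      unfolding K_def by (intro mult_left_mono integral_kernel_exp_le[OF k k0 that] m0)
    finally show ?thesis using ineq[OF that] by simp
  qed
  have Kpos: "K s \<ge> 0" if "s \<in> {a..b}" for s
    unfolding K_def set_lebesgue_integral_def using that k0
    by (intro integral_nonneg_AE AE_I2) (auto simp: indicator_def)
  have "m \<le> 2 * c"
  proof (cases "\<phi> s0 * exp (- 2 * K s0) \<le> 0")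
    case True
    then show ?thesis using c by (simp add: m_def)
  next
    case False
    then have "m = \<phi> s0 * exp (- 2 * K s0)" by (simp add: m_def)
    also have "\<dots> \<le> (c + m / 2 * exp (2 * K s0)) * exp (- 2 * K s0)"
      by (intro mult_right_mono step s0) simp
    also have "\<dots> = c * exp (- 2 * K s0) + m / 2" by (simp add: distrib_right mult.assoc flip: exp_add)
    also have "\<dots> \<le> c * 1 + m / 2" using Kpos[OF s0(1)] c by (intro add_mono mult_left_mono) auto
    finally show ?thesis by simp
  qed
  have "K s \<le> K b" unfolding K_def using s by (intro set_integral_nonneg_mono[OF set_integrable_subinterval[OF k]] k0) auto
  then have "m * exp (2 * K s) \<le> 2 * c * exp (2 * K b)"
    using \<open>m \<le> 2 * c\<close> c by (intro mult_mono) auto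
  then show ?thesis using \<phi>m[OF s] by (simp add: K_def)
qed

subsection \<open>The semigroup and the weak norm\<close>

locale generated_contraction =
  fixes domA :: "'a::{real_inner, banach, second_countable_topology} set"
    and A :: "'a \<Rightarrow> 'a" and S :: "real \<Rightarrow> 'a \<Rightarrow>\<^sub>L 'a"
  assumes dense: "closure domA = UNIV"
    and semigroup: "contraction_C0_semigroup S"
    and gen: "generator_of S domA (\<lambda>x. - A x)"
begin

lemma S_0 [simp]: "S 0 x = x"
  using semigroup by (simp add: contraction_C0_semigroup_def)

lemma S_add: "0 \<le> r \<Longrightarrow> 0 \<le> s \<Longrightarrow> S (r + s) x = S r (S s x)"
  using semigroup by (simp add: contraction_C0_semigroup_def)

lemma norm_S_le: "0 \<le> r \<Longrightarrow> norm (S r x) \<le> norm x"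
  using semigroup norm_blinfun[of "S r" x] mult_right_mono[of "norm (S r)" 1 "norm x"]
  by (force simp: contraction_C0_semigroup_def)

lemma norm_S_diff_le: "0 \<le> r \<Longrightarrow> norm (S r x - S r y) \<le> norm (x - y)"
  using norm_S_le[of r "x - y"] by (simp add: blinfun.diff_right)

lemma S_near_id:
  assumes "e > 0"
  shows "\<exists>d>0. \<forall>h. 0 \<le> h \<and> h < d \<longrightarrow> norm (S h x - x) < e"
proof -
  have "((\<lambda>t. S t x) \<longlongrightarrow> x) (at_right 0)" using semigroup by (simp add: contraction_C0_semigroup_def)
  from tendstoD[OF this assms] obtain d where "d > 0" "\<And>h. 0 < h \<Longrightarrow> h < d \<Longrightarrow> dist (S h x) x < e"
    unfolding eventually_at_right_field by auto
  then show ?thesis using assms by (intro exI[of _ d]) (auto simp: dist_norm le_less)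
qed

lemma norm_S_time_diff:
  assumes "0 \<le> r" "0 \<le> s"
  shows "norm (S r x - S s x) \<le> norm (S \<bar>r - s\<bar> x - x)"
proof -
  have *: "norm (S r x - S s x) \<le> norm (S (r - s) x - x)" if "s \<le> r" "0 \<le> s" for r s
    using S_add[of s "r - s" x] norm_S_diff_le[of s "S (r - s) x" x] that by simp
  show ?thesis
  proof (cases "s \<le> r")
    case True then show ?thesis using * assms by simp
  next
    case False then show ?thesis using *[of r s] assms by (simp add: norm_minus_commute abs_minus_commute)
  qed
qed

text \<open>Joint continuity from strong continuity at time 0: the intermediate value with the new
  time and the old vector splits the difference, contractivity bounds one part, and the smaller of
  the two times can be factored out of the other.\<close>

lemma continuous_on_S:
  assumes "continuous_on U f" "continuous_on U g" "\<And>x. x \<in> U \<Longrightarrow> 0 \<le> f x"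
  shows "continuous_on U (\<lambda>x. S (f x) (g x))"
  unfolding continuous_on_def
proof
  fix x assume x: "x \<in> U"
  have f: "(f \<longlongrightarrow> f x) (at x within U)" and g: "(g \<longlongrightarrow> g x) (at x within U)"
    using assms x by (auto simp: continuous_on_def)
  have "((\<lambda>y. S \<bar>f y - f x\<bar> (g x) - g x) \<longlongrightarrow> 0) (at x within U)"
  proof (rule tendstoI)
    fix e :: real assume "e > 0"
    then obtain d where d: "d > 0" "\<And>h. 0 \<le> h \<Longrightarrow> h < d \<Longrightarrow> norm (S h (g x) - g x) < e"
      using S_near_id by blast
    from tendstoD[OF f d(1)] show "\<forall>\<^sub>F y in at x within U. dist (S \<bar>f y - f x\<bar> (g x) - g x) 0 < e"
      by eventually_elim (use d in \<open>auto simp: dist_real_def\<close>)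
  qed
  moreover have "((\<lambda>y. g y - g x) \<longlongrightarrow> 0) (at x within U)" using g by (simp add: LIM_zero)
  ultimately have lim: "((\<lambda>y. norm (g y - g x) + norm (S \<bar>f y - f x\<bar> (g x) - g x)) \<longlongrightarrow> 0) (at x within U)"
    using tendsto_add[OF tendsto_norm_zero tendsto_norm_zero] by fastforce
  have "((\<lambda>y. S (f y) (g y) - S (f x) (g x)) \<longlongrightarrow> 0) (at x within U)"
  proof (rule Lim_null_comparison[OF _ lim])
    have "\<forall>\<^sub>F y in at x within U. y \<in> U" by (simp add: eventually_at_filter)
    then show "\<forall>\<^sub>F y in at x within U. norm (S (f y) (g y) - S (f x) (g x))
        \<le> norm (g y - g x) + norm (S \<bar>f y - f x\<bar> (g x) - g x)"
    proof eventually_elim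
      case (elim y)
      show ?case
        by (rule norm_diff_triangle_le[where y = "S (f y) (g x)"])
           (use norm_S_diff_le norm_S_time_diff assms(3) x elim in auto)
    qed
  qed
  then show "((\<lambda>x. S (f x) (g x)) \<longlongrightarrow> S (f x) (g x)) (at x within U)" by (rule LIM_zero_cancel)
qed

text \<open>Nothing is known of \<open>S\<close> at negative times. Truncating the time gives a map
  that is continuous on the whole product, hence one that preserves measurability.\<close>

lemma borel_measurable_S:
  assumes "f \<in> borel_measurable N" "g \<in> borel_measurable N"
  shows "(\<lambda>x. S (max 0 (f x)) (g x)) \<in> borel_measurable N"
  by (rule borel_measurable_continuous_Pair[where H = "\<lambda>r z. S (max 0 r) z", OF assms], rule continuous_on_S)
     (auto intro!: continuous_intros)

lemma S_domA:
  assumes x: "x \<in> domA" and r: "0 \<le> r"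
  shows "S r x \<in> domA" "A (S r x) = S r (A x)"
proof -
  have Q: "((\<lambda>h. (S h x - x) /\<^sub>R h) \<longlongrightarrow> - A x) (at_right 0)"
    using gen x by (simp add: generator_of_def)
  have "((\<lambda>h. S r ((S h x - x) /\<^sub>R h)) \<longlongrightarrow> S r (- A x)) (at_right 0)"
    by (intro tendsto_intros Q)
  moreover have "\<forall>\<^sub>F h in at_right 0. S r ((S h x - x) /\<^sub>R h) = (S h (S r x) - S r x) /\<^sub>R h"
  proof -
    have "S r (S h x) = S h (S r x)" if "0 < h" for h
      using S_add[of r h x] S_add[of h r x] r that by (simp add: add.commute)
    then show ?thesis
      unfolding eventually_at_filter by (simp add: blinfun.scaleR_right blinfun.diff_right)
  qed
  ultimately have lim: "((\<lambda>h. (S h (S r x) - S r x) /\<^sub>R h) \<longlongrightarrow> S r (- A x)) (at_right 0)"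
    by (rule Lim_transform_eventually)
  then show D: "S r x \<in> domA" using gen by (auto simp: generator_of_def)
  then have "((\<lambda>h. (S h (S r x) - S r x) /\<^sub>R h) \<longlongrightarrow> - A (S r x)) (at_right 0)"
    using gen by (simp add: generator_of_def)
  with lim have "S r (- A x) = - A (S r x)" by (meson tendsto_unique trivial_limit_at_right_real)
  then show "A (S r x) = S r (A x)" by (simp add: blinfun.minus_right)
qed

text \<open>The generator gives a one-sided limit at time 0 only. For a time on either side of r,
  the semigroup at the smaller time is factored out; what remains is the difference quotient at 0
  plus the modulus of continuity of the orbit of \<open>A x\<close>.\<close>

lemma S_has_vector_derivative:
  assumes x: "x \<in> domA" and r: "0 \<le> r"
  shows "((\<lambda>r. S r x) has_vector_derivative - A (S r x)) (at r within {0..})"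
  unfolding has_vector_derivative_def has_derivative_within_alt
proof (intro conjI allI impI bounded_linear_scaleR_left)
  fix e :: real assume e: "e > 0"
  have "((\<lambda>h. (S h x - x) /\<^sub>R h) \<longlongrightarrow> - A x) (at_right 0)"
    using gen x by (simp add: generator_of_def)
  from tendstoD[OF this, of "e/2"] e obtain d1 where d1: "d1 > 0"
    "\<And>h. 0 < h \<Longrightarrow> h < d1 \<Longrightarrow> dist ((S h x - x) /\<^sub>R h) (- A x) < e/2"
    unfolding eventually_at_right_field by auto
  obtain d2 where d2: "d2 > 0" "\<And>h. 0 \<le> h \<Longrightarrow> h < d2 \<Longrightarrow> norm (S h (A x) - A x) < e/2"
    using S_near_id[of "e/2" "A x"] e by auto
  have Q: "norm (S h x - x + h *\<^sub>R A x) \<le> h * (e/2)" if "0 \<le> h" "h < d1" for h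
  proof (cases "h = 0")
    case False
    have "S h x - x + h *\<^sub>R A x = h *\<^sub>R ((S h x - x) /\<^sub>R h + A x)" using False by (simp add: scaleR_add_right)
    then have "norm (S h x - x + h *\<^sub>R A x) = h * norm ((S h x - x) /\<^sub>R h + A x)" using that by simp
    also have "\<dots> \<le> h * (e/2)" using d1(2)[of h] that False by (intro mult_left_mono) (auto simp: dist_norm)
    finally show ?thesis .
  qed simp
  show "\<exists>d>0. \<forall>y\<in>{0..}. norm (y - r) < d \<longrightarrow>
      norm (S y x - S r x - (y - r) *\<^sub>R - A (S r x)) \<le> e * norm (y - r)"
  proof (intro exI[of _ "min d1 d2"] conjI ballI impI)
    fix y :: real assume y: "y \<in> {0..}" "norm (y - r) < min d1 d2"
    define m where "m = min y r" define h where "h = \<bar>y - r\<bar>"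
    have mh: "0 \<le> m" "0 \<le> h" "h < d1" "h < d2" "max y r = m + h" using y r by (auto simp: m_def h_def)
    let ?e = "S m (S h x - x + h *\<^sub>R A x) - h *\<^sub>R (S m (A x) - S r (A x))"
    have "S m (S h x) = S (max y r) x" using mh by (simp add: S_add)
    then have "norm (S y x - S r x - (y - r) *\<^sub>R - A (S r x)) = norm ?e"
    proof (cases "y \<le> r")
      case True
      then have "m = y" "h = r - y" "max y r = r" by (auto simp: m_def h_def)
      then have "S y x - S r x - (y - r) *\<^sub>R - A (S r x) = - ?e"
        using \<open>S m (S h x) = S (max y r) x\<close>
        by (simp add: S_domA[OF x r] blinfun.diff_right blinfun.add_right blinfun.scaleR_right scaleR_diff_left scaleR_diff_right)
      then show ?thesis by (simp only: norm_minus_cancel)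
    next
      case False
      then have "m = r" "h = y - r" "max y r = y" by (auto simp: m_def h_def)
      then have "S y x - S r x - (y - r) *\<^sub>R - A (S r x) = ?e"
        using \<open>S m (S h x) = S (max y r) x\<close>
        by (simp add: S_domA[OF x r] blinfun.diff_right blinfun.add_right blinfun.scaleR_right scaleR_diff_left scaleR_diff_right)
      then show ?thesis by (simp only:)
    qed
    also have "\<dots> \<le> h * (e/2) + h * (e/2)"
    proof (rule order_trans[OF norm_triangle_ineq4 add_mono])
      show "norm (S m (S h x - x + h *\<^sub>R A x)) \<le> h * (e/2)"
        using Q[of h] norm_S_le[of m] mh order_trans by blast
      have "\<bar>m - r\<bar> < d2" using mh y by (auto simp: m_def h_def)
      then have "norm (S m (A x) - S r (A x)) \<le> e/2"
        using norm_S_time_diff[of m r "A x"] d2(2)[of "\<bar>m - r\<bar>"] mh r by fastforce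
      then show "norm (h *\<^sub>R (S m (A x) - S r (A x))) \<le> h * (e/2)"
        using mh mult_left_mono[of _ "e/2" h] by simp
    qed
    finally show "norm (S y x - S r x - (y - r) *\<^sub>R - A (S r x)) \<le> e * norm (y - r)"
      by (simp add: h_def mult.commute)
  qed (use d1 d2 in auto)
qed

text \<open>Density of the domain makes the adjoint value unique, so the definite description
  denotes it.\<close>

lemma adj_op_eq:
  assumes "w \<in> adj_domain domA A" "x \<in> domA"
  shows "A x \<bullet> w = x \<bullet> adj_op domA A w"
proof -
  obtain z where z: "\<forall>x\<in>domA. A x \<bullet> w = x \<bullet> z" using assms by (auto simp: adj_domain_def)
  have "z' = z" if "\<forall>x\<in>domA. A x \<bullet> w = x \<bullet> z'" for z'
  proof (rule eq_of_inner_eq)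
    fix y
    have "domA \<subseteq> {y. y \<bullet> z' = y \<bullet> z}" using z that by auto
    moreover have "closed {y. y \<bullet> z' = y \<bullet> z}" by (intro closed_Collect_eq continuous_intros)
    ultimately have "closure domA \<subseteq> {y. y \<bullet> z' = y \<bullet> z}" by (rule closure_minimal)
    then show "y \<bullet> z' = y \<bullet> z" using dense by auto
  qed
  with z have "\<forall>x\<in>domA. A x \<bullet> w = x \<bullet> adj_op domA A w"
    unfolding adj_op_def by (rule theI)
  then show ?thesis using assms by simp
qed

lemma domA_approx: obtains xs where "\<And>n. xs n \<in> domA" "xs \<longlonglongrightarrow> x"
  using dense closure_sequential[of x domA] by auto

text \<open>The right-hand side contains the adjoint of \<open>A\<close> at w but not
  \<open>A\<close> at z. The scalar mean value theorem on the domain of \<open>A\<close> therefore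
  extends by density to every z, the intermediate times being handled by compactness.\<close>

lemma S_mean_value:
  assumes w: "w \<in> adj_domain domA A" and d: "0 \<le> d"
  shows "\<exists>\<rho>\<in>{0..d}. (S d z - z) \<bullet> w = - d * (S \<rho> z \<bullet> adj_op domA A w)"
proof -
  have dom: "\<exists>\<rho>\<in>{0..d}. (S d z - z) \<bullet> w = - d * (S \<rho> z \<bullet> adj_op domA A w)" if z: "z \<in> domA" for z
  proof -
    have der: "((\<lambda>r. S r z \<bullet> w) has_derivative (\<lambda>h. h * (- A (S r z) \<bullet> w))) (at r within {0..d})"
      if "r \<in> {0..d}" for r
    proof -
      have "((\<lambda>r. S r z) has_vector_derivative - A (S r z)) (at r within {0..d})"
        by (rule has_vector_derivative_within_subset[OF S_has_vector_derivative[OF z]]) (use that in auto)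
      then show ?thesis unfolding has_vector_derivative_def
        by (rule has_derivative_eq_rhs[OF has_derivative_inner_left]) auto
    qed
    obtain \<rho> where \<rho>: "\<rho> \<in> {0..d}" "S d z \<bullet> w - S 0 z \<bullet> w = (d - 0) * (- A (S \<rho> z) \<bullet> w)"
      using mvt_very_simple[of 0 d "\<lambda>r. S r z \<bullet> w" "\<lambda>r h. h * (- A (S r z) \<bullet> w)"] der d by auto
    have "A (S \<rho> z) \<bullet> w = S \<rho> z \<bullet> adj_op domA A w"
      by (rule adj_op_eq[OF w]) (use S_domA(1)[OF z] \<rho> in auto)
    then show ?thesis using \<rho> by (auto simp: inner_diff_left)
  qed
  obtain zs where zs: "\<And>n. zs n \<in> domA" "zs \<longlonglongrightarrow> z" using domA_approx by metis
  obtain \<rho> where \<rho>: "\<And>n. \<rho> n \<in> {0..d}"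
    "\<And>n. (S d (zs n) - zs n) \<bullet> w = - d * (S (\<rho> n) (zs n) \<bullet> adj_op domA A w)"
    using dom[OF zs(1)] by metis
  obtain l k where l: "l \<in> {0..d}" "strict_mono (k :: nat \<Rightarrow> nat)" "(\<rho> \<circ> k) \<longlonglongrightarrow> l"
    using compact_imp_seq_compact[OF compact_Icc, of 0 d] \<rho>(1) unfolding seq_compact_def by metis
  have zk: "(\<lambda>n. zs (k n)) \<longlonglongrightarrow> z" using LIMSEQ_subseq_LIMSEQ[OF zs(2) l(2)] by (simp add: comp_def)
  have "continuous_on ({0..} \<times> UNIV) (\<lambda>p. S (fst p) (snd p))"
    by (rule continuous_on_S) (auto intro!: continuous_intros)
  then have "(\<lambda>n. S (\<rho> (k n)) (zs (k n))) \<longlonglongrightarrow> S l z"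
    unfolding continuous_on_sequentially comp_def
    by (elim ballE[of _ _ "(l, z)"] allE[of _ "\<lambda>n. (\<rho> (k n), zs (k n))"])
       (use tendsto_Pair[OF l(3)[unfolded comp_def] zk] l(1) \<rho>(1) in auto)
  then have "(\<lambda>n. - d * (S (\<rho> (k n)) (zs (k n)) \<bullet> adj_op domA A w)) \<longlonglongrightarrow> - d * (S l z \<bullet> adj_op domA A w)"
    by (intro tendsto_mult tendsto_const tendsto_inner)
  moreover have "(\<lambda>n. (S d (zs (k n)) - zs (k n)) \<bullet> w) \<longlonglongrightarrow> (S d z - z) \<bullet> w"
    by (intro tendsto_intros zk)
  ultimately have "(S d z - z) \<bullet> w = - d * (S l z \<bullet> adj_op domA A w)"
    using \<rho>(2) LIMSEQ_unique by force
  then show ?thesis using l by blast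
qed

text \<open>Expanding the square and using contractivity bounds it by 2 (p - S(r)p) \<bullet> p.
  Strong continuity of the adjoint semigroup thus follows from that of \<open>S\<close>, with a
  square root in the rate.\<close>

lemma norm_adjoint_S_diff:
  assumes "0 \<le> r"
  shows "(norm (adjoint (blinfun_apply (S r)) p - p))\<^sup>2 \<le> 2 * norm p * norm (S r p - p)"
proof -
  let ?q = "adjoint (blinfun_apply (S r)) p"
  have "norm ?q \<le> 1 * norm p"
    using semigroup assms by (intro order_trans[OF norm_adjoint_blinfun_le] mult_right_mono)
      (auto simp: contraction_C0_semigroup_def)
  then have "?q \<bullet> ?q \<le> p \<bullet> p" by (simp add: norm_le)
  moreover have "p \<bullet> ?q = S r p \<bullet> p" by (rule inner_adjoint_blinfun)
  ultimately have "(norm (?q - p))\<^sup>2 \<le> 2 * ((p - S r p) \<bullet> p)"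
    by (simp add: power2_norm_eq_inner inner_diff_left inner_diff_right inner_commute)
  also have "\<dots> \<le> 2 * (norm (p - S r p) * norm p)" by (intro mult_left_mono norm_cauchy_schwarz) simp
  finally show ?thesis by (simp add: norm_minus_commute mult_ac)
qed

end

section \<open>The semigroup in the weak norm\<close>

locale weak_contraction = generated_contraction domA A S
  for domA :: "'a::{real_inner, banach, second_countable_topology} set"
    and A :: "'a \<Rightarrow> 'a" and S :: "real \<Rightarrow> 'a \<Rightarrow>\<^sub>L 'a" +
  fixes B :: "'a \<Rightarrow>\<^sub>L 'a" and c0 :: real
  assumes saB: "self_adjoint B"
    and spB: "strictly_positive B"
    and B_adj: "\<forall>x. B x \<in> adj_domain domA A"
    and AB_bounded: "bounded_linear (\<lambda>x. adj_op domA A (B x))"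
    and c0: "c0 \<ge> 0"
    and weak_B: "\<forall>x. (adj_op domA A (B x) + c0 *\<^sub>R B x) \<bullet> x \<ge> 0"
begin

lemma B_nonneg: "0 \<le> B x \<bullet> x"
  using spB by (cases "x = 0") (auto simp: strictly_positive_def less_imp_le)

lemmas norm_m1_sq = norm_m1_power2[OF saB B_nonneg]

text \<open>On the domain of \<open>A\<close> the function exp (-2 c0 s) |S(s)x|_-1^2 has derivative
  -2 exp (-2 c0 s) times the quadratic form of the weak B-condition, which is nonnegative; density
  gives the rest.\<close>

lemma norm_m1_S_le:
  assumes r: "0 \<le> r"
  shows "norm_m1 B (S r x) \<le> exp (c0 * r) * norm_m1 B x"
proof -
  have dom: "norm_m1 B (S r x) \<le> exp (c0 * r) * norm_m1 B x" if x: "x \<in> domA" for x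
  proof -
    define q where "q s = B (S s x) \<bullet> S s x" for s
    have der: "((\<lambda>s. exp (- 2 * c0 * s) * q s) has_real_derivative
        - 2 * exp (- 2 * c0 * s) * ((adj_op domA A (B (S s x)) + c0 *\<^sub>R B (S s x)) \<bullet> S s x)) (at s within {0..r})"
      if s: "s \<in> {0..r}" for s
    proof -
      have d: "((\<lambda>r. S r x) has_vector_derivative - A (S s x)) (at s within {0..r})"
        by (rule has_vector_derivative_within_subset[OF S_has_vector_derivative[OF x]]) (use s in auto)
      have "A (S s x) \<bullet> B (S s x) = S s x \<bullet> adj_op domA A (B (S s x))"
        by (rule adj_op_eq) (use B_adj S_domA(1)[OF x] s in auto)
      moreover have "B (S s x) \<bullet> A (S s x) = B (A (S s x)) \<bullet> S s x" "S s x \<bullet> B (A (S s x)) = B (S s x) \<bullet> A (S s x)"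
        using saB by (auto simp: self_adjoint_def inner_commute)
      ultimately have e: "B (S s x) \<bullet> - A (S s x) + B (- A (S s x)) \<bullet> S s x = - 2 * (adj_op domA A (B (S s x)) \<bullet> S s x)"
        by (simp add: blinfun.minus_right inner_commute)
      have "(q has_derivative (\<lambda>h. B (S s x) \<bullet> (h *\<^sub>R - A (S s x)) + B (h *\<^sub>R - A (S s x)) \<bullet> S s x)) (at s within {0..r})"
        unfolding q_def using d unfolding has_vector_derivative_def
        by (intro has_derivative_inner bounded_linear.has_derivative[OF blinfun.bounded_linear_right])
      then have "(q has_real_derivative - 2 * (adj_op domA A (B (S s x)) \<bullet> S s x)) (at s within {0..r})"
        unfolding has_field_derivative_def
        by (rule has_derivative_eq_rhs)
           (auto simp only: fun_eq_iff blinfun.scaleR_right e[symmetric] inner_scaleR_left inner_scaleR_right distrib_left mult.commute)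
      then show ?thesis
        by (auto intro!: derivative_eq_intros) (simp add: inner_add_left q_def algebra_simps)
    qed
    have "exp (- 2 * c0 * r) * q r \<le> exp (- 2 * c0 * 0) * q 0"
    proof -
      define D where "D s = - 2 * exp (- 2 * c0 * s) * ((adj_op domA A (B (S s x)) + c0 *\<^sub>R B (S s x)) \<bullet> S s x)" for s
      have "\<exists>s\<in>{0..r}. exp (- 2 * c0 * r) * q r - exp (- 2 * c0 * 0) * q 0 = D s * (r - 0)"
      proof (rule mvt_very_simple[OF r, of "\<lambda>s. exp (- 2 * c0 * s) * q s" "\<lambda>s h. D s * h"])
        fix s assume "0 \<le> s" "s \<le> r"
        then have "s \<in> {0..r}" by simp
        from der[OF this, folded D_def]
        show "((\<lambda>s. exp (- 2 * c0 * s) * q s) has_derivative (\<lambda>h. D s * h)) (at s within {0..r})"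
          unfolding has_field_derivative_def .
      qed
      then obtain s where "exp (- 2 * c0 * r) * q r - exp (- 2 * c0 * 0) * q 0 = D s * (r - 0)" by blast
      moreover have "0 \<le> exp (- 2 * c0 * s) * ((adj_op domA A (B (S s x)) + c0 *\<^sub>R B (S s x)) \<bullet> S s x) * r"
        using weak_B r by (intro mult_nonneg_nonneg) auto
      ultimately show ?thesis by (simp add: D_def mult_ac)
    qed
    then have "exp (- 2 * c0 * r) * (norm_m1 B (S r x))\<^sup>2 \<le> (norm_m1 B x)\<^sup>2"
      by (simp add: q_def norm_m1_sq)
    then have "exp (2 * c0 * r) * (exp (- 2 * c0 * r) * (norm_m1 B (S r x))\<^sup>2) \<le> exp (2 * c0 * r) * (norm_m1 B x)\<^sup>2"
      by (rule mult_left_mono) simp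
    then have "(norm_m1 B (S r x))\<^sup>2 \<le> (exp (c0 * r) * norm_m1 B x)\<^sup>2"
      by (simp add: power_mult_distrib mult.assoc[symmetric] exp_double[symmetric] flip: exp_add)
    then show ?thesis by (rule power2_le_imp_le) simp
  qed
  obtain xs where xs: "\<And>n. xs n \<in> domA" "xs \<longlonglongrightarrow> x" using domA_approx by metis
  show ?thesis
  proof (rule LIMSEQ_le)
    show "(\<lambda>n. norm_m1 B (S r (xs n))) \<longlonglongrightarrow> norm_m1 B (S r x)"
      unfolding norm_m1_def by (intro tendsto_intros xs)
    show "(\<lambda>n. exp (c0 * r) * norm_m1 B (xs n)) \<longlonglongrightarrow> exp (c0 * r) * norm_m1 B x"
      unfolding norm_m1_def by (intro tendsto_intros xs)
  qed (use dom xs in auto)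
qed

text \<open>The mean value formula is applied with w = B (S(r)x - x), for which the pairing is the
  squared weak norm. The adjoint of \<open>A\<close> is bounded after \<open>B\<close>, so this
  square is at most 2 K r |x|^2, whence the exponent 1/2.\<close>

lemma norm_m1_S_diff_le:
  obtains K where "K \<ge> 0" "\<And>r x. 0 \<le> r \<Longrightarrow> norm_m1 B (S r x - x) \<le> K * sqrt r * norm x"
proof -
  obtain K where K: "K > 0" "\<And>x. norm (adj_op domA A (B x)) \<le> norm x * K"
    using bounded_linear.pos_bounded[OF AB_bounded] by auto
  show ?thesis
  proof (rule that[of "sqrt (2 * K)"])
    fix r :: real and x assume r: "0 \<le> r"
    obtain \<rho> where \<rho>: "\<rho> \<in> {0..r}" "(S r x - x) \<bullet> B (S r x - x) = - r * (S \<rho> x \<bullet> adj_op domA A (B (S r x - x)))"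
      using S_mean_value[of "B (S r x - x)" r x] B_adj r by auto
    have "norm (S r x - x) \<le> 2 * norm x" using norm_triangle_ineq4[of "S r x" x] norm_S_le[OF r, of x] by simp
    then have 1: "norm (adj_op domA A (B (S r x - x))) \<le> 2 * norm x * K"
      using K by (intro order_trans[OF K(2)] mult_right_mono) auto
    have "(norm_m1 B (S r x - x))\<^sup>2 = - r * (S \<rho> x \<bullet> adj_op domA A (B (S r x - x)))"
      using \<rho> by (simp add: norm_m1_sq inner_commute)
    also have "\<dots> = r * (- (S \<rho> x \<bullet> adj_op domA A (B (S r x - x))))" by simp
    also have "\<dots> \<le> r * (norm (S \<rho> x) * norm (adj_op domA A (B (S r x - x))))"
      using Cauchy_Schwarz_ineq2[of "S \<rho> x" "adj_op domA A (B (S r x - x))"]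
      by (intro mult_left_mono r) linarith
    also have "\<dots> \<le> r * (norm x * (2 * norm x * K))"
      using r \<rho> by (intro mult_left_mono mult_mono norm_S_le 1) auto
    also have "\<dots> = (sqrt (2 * K) * sqrt r * norm x)\<^sup>2"
      using K r by (simp add: power_mult_distrib power2_eq_square[of "norm x"])
    finally show "norm_m1 B (S r x - x) \<le> sqrt (2 * K) * sqrt r * norm x"
      by (rule power2_le_imp_le) (use K r in auto)
  qed (use K in auto)
qed

end

subsection \<open>The Hamiltonian and the running cost\<close>

lemma exp_remainder_nonneg: "0 \<le> exp a - 1 - (a :: real)"
  using exp_ge_add_one_self[of a] by linarith

lemma abs_exp_minus_one_le: "\<bar>exp a - 1\<bar> \<le> \<bar>a\<bar> * exp \<bar>a :: real\<bar>"
proof -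
  have 1: "exp a - 1 \<le> a * exp a"
    using mult_left_mono[OF exp_ge_add_one_self[of "- a"], of "exp a"] by (simp add: algebra_simps flip: exp_add)
  show ?thesis
  proof (cases "0 \<le> a")
    case True then show ?thesis using 1 by simp
  next
    case False
    then have "\<bar>a\<bar> * 1 \<le> \<bar>a\<bar> * exp \<bar>a\<bar>" by (intro mult_left_mono) auto
    then have "\<bar>a\<bar> \<le> \<bar>a\<bar> * exp \<bar>a\<bar>" by simp
    moreover have "\<bar>exp a - 1\<bar> \<le> \<bar>a\<bar>" using exp_ge_add_one_self[of a] exp_less_one_iff[of a] False by linarith
    ultimately show ?thesis by (rule order_trans[rotated])
  qed
qed

lemma exp_remainder_le: "exp a - 1 - a \<le> a\<^sup>2 * exp \<bar>a :: real\<bar>"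
proof -
  have "exp a - 1 \<le> a * exp a"
    using mult_left_mono[OF exp_ge_add_one_self[of "- a"], of "exp a"] by (simp add: algebra_simps flip: exp_add)
  then have "exp a - 1 - a \<le> a * (exp a - 1)" by (simp add: algebra_simps)
  also have "\<dots> \<le> \<bar>a\<bar> * \<bar>exp a - 1\<bar>" by (metis abs_ge_self abs_mult)
  also have "\<dots> \<le> \<bar>a\<bar> * (\<bar>a\<bar> * exp \<bar>a\<bar>)" by (intro mult_left_mono abs_exp_minus_one_le) auto
  finally show ?thesis by (simp add: power2_eq_square mult.assoc[symmetric])
qed

lemma e2ennreal_add_ereal:
  assumes "0 \<le> a" "0 \<le> c"
  shows "e2ennreal (a + ereal c) = e2ennreal a + ennreal c"
  using assms by (cases a) (auto simp: ennreal_plus)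

section \<open>The Hamiltonian \<open>H0\<close>\<close>

locale exponential_levy =
  fixes \<nu> :: "'a::{real_inner, banach, second_countable_topology} measure"
  assumes sets_\<nu>: "sets \<nu> = sets borel"
    and exp_moment: "\<forall>K>0. (\<integral>\<^sup>+z. ennreal ((norm z)\<^sup>2 * exp (K * norm z)) \<partial>\<nu>) < \<infinity>"
begin

lemma borel_measurable_\<nu>: "f \<in> borel_measurable borel \<Longrightarrow> f \<in> borel_measurable \<nu>"
  using measurable_cong_sets[OF sets_\<nu> refl] by blast

lemma integrable_weight: "K > 0 \<Longrightarrow> integrable \<nu> (\<lambda>z. (norm z)\<^sup>2 * exp (K * norm z))"
  using exp_moment by (intro integrableI_bounded borel_measurable_\<nu>) (auto simp: abs_mult)

text \<open>The common integrable majorant on a ball. The exponent \<open>R + 1\<close> stays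
  positive also for \<open>R = 0\<close>, and positive exponents are what the moment assumption
  covers.\<close>

lemma exp_remainder_inner_le:
  assumes "norm p \<le> R"
  shows "exp (p \<bullet> z) - 1 - p \<bullet> z \<le> R\<^sup>2 * ((norm z)\<^sup>2 * exp ((R + 1) * norm z))"
proof -
  have a: "\<bar>p \<bullet> z\<bar> \<le> R * norm z"
    by (rule order_trans[OF Cauchy_Schwarz_ineq2]) (intro mult_right_mono assms; simp)
  have "(p \<bullet> z)\<^sup>2 \<le> (R * norm z)\<^sup>2" using a by (metis abs_ge_zero power2_abs power_mono)
  moreover have "exp \<bar>p \<bullet> z\<bar> \<le> exp ((R + 1) * norm z)" using a norm_ge_zero[of z] by (simp add: distrib_right del: norm_ge_zero)
  ultimately have "(p \<bullet> z)\<^sup>2 * exp \<bar>p \<bullet> z\<bar> \<le> (R * norm z)\<^sup>2 * exp ((R + 1) * norm z)"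
    by (intro mult_mono) auto
  then show ?thesis using exp_remainder_le[of "p \<bullet> z"] by (simp add: power_mult_distrib mult_ac)
qed

lemma H0_integrable: "integrable \<nu> (\<lambda>z. exp (p \<bullet> z) - 1 - p \<bullet> z)"
proof (rule Bochner_Integration.integrable_bound)
  show "integrable \<nu> (\<lambda>z. (norm p)\<^sup>2 * ((norm z)\<^sup>2 * exp ((norm p + 1) * norm z)))"
    by (intro integrable_mult_right integrable_weight) (simp add: add_nonneg_pos)
  show "AE z in \<nu>. norm (exp (p \<bullet> z) - 1 - p \<bullet> z) \<le> norm ((norm p)\<^sup>2 * ((norm z)\<^sup>2 * exp ((norm p + 1) * norm z)))"
    using exp_remainder_nonneg exp_remainder_inner_le[of p "norm p"] by (intro AE_I2) (simp add: abs_mult)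
qed (intro borel_measurable_\<nu>, measurable)

lemma H0_nonneg: "0 \<le> H0 \<nu> p"
  unfolding H0_def using exp_remainder_nonneg by (intro integral_nonneg_AE AE_I2)

lemma H0_zero [simp]: "H0 \<nu> 0 = 0"
  by (simp add: H0_def)

definition Hmax :: "real \<Rightarrow> real" where
  "Hmax R = R\<^sup>2 * (\<integral>z. (norm z)\<^sup>2 * exp ((R + 1) * norm z) \<partial>\<nu>)"

lemma Hmax_nonneg: "0 \<le> Hmax R"
  unfolding Hmax_def by (intro mult_nonneg_nonneg integral_nonneg_AE AE_I2) auto

lemma H0_le_Hmax:
  assumes "norm p \<le> R"
  shows "H0 \<nu> p \<le> Hmax R"
proof -
  have "R + 1 > 0" using assms norm_ge_zero[of p] by linarith
  then have "integrable \<nu> (\<lambda>z. R\<^sup>2 * ((norm z)\<^sup>2 * exp ((R + 1) * norm z)))"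
    by (intro integrable_mult_right integrable_weight)
  then have "H0 \<nu> p \<le> (\<integral>z. R\<^sup>2 * ((norm z)\<^sup>2 * exp ((R + 1) * norm z)) \<partial>\<nu>)"
    unfolding H0_def by (intro integral_mono H0_integrable exp_remainder_inner_le assms)
  then show ?thesis by (simp add: Hmax_def)
qed

lemma H0_tendsto:
  assumes "ps \<longlonglongrightarrow> p"
  shows "(\<lambda>n. H0 \<nu> (ps n)) \<longlonglongrightarrow> H0 \<nu> p"
proof -
  obtain R where R: "\<And>n. norm (ps n) \<le> R"
    using convergent_imp_Bseq[OF convergentI[OF assms]] by (auto simp: Bseq_def)
  have "R + 1 > 0" using R[of 0] norm_ge_zero[of "ps 0"] by linarith
  show ?thesis
    unfolding H0_def
  proof (rule integral_dominated_convergence)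
    show "integrable \<nu> (\<lambda>z. R\<^sup>2 * ((norm z)\<^sup>2 * exp ((R + 1) * norm z)))"
      using \<open>R + 1 > 0\<close> by (intro integrable_mult_right integrable_weight)
    show "AE z in \<nu>. norm (exp (ps n \<bullet> z) - 1 - ps n \<bullet> z) \<le> R\<^sup>2 * ((norm z)\<^sup>2 * exp ((R + 1) * norm z))" for n
      using exp_remainder_nonneg exp_remainder_inner_le[OF R] by (intro AE_I2) simp
    show "AE z in \<nu>. (\<lambda>n. exp (ps n \<bullet> z) - 1 - ps n \<bullet> z) \<longlonglongrightarrow> exp (p \<bullet> z) - 1 - p \<bullet> z"
      by (intro AE_I2 tendsto_intros assms)
  qed (intro borel_measurable_\<nu>, measurable)+
qed

lemma continuous_H0: "isCont (H0 \<nu>) p"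
  by (simp add: continuous_at_sequentially comp_def H0_tendsto)

section \<open>The Legendre transform \<open>L0\<close>\<close>

lemma L0_ge: "ereal (z \<bullet> y - H0 \<nu> y) \<le> L0 \<nu> z"
  unfolding L0_def by (rule SUP_upper) simp

lemma L0_nonneg: "0 \<le> L0 \<nu> z"
  using L0_ge[of z 0] by (simp add: zero_ereal_def)

lemma L0_zero: "L0 \<nu> 0 = 0"
proof (rule antisym[OF _ L0_nonneg])
  show "L0 \<nu> 0 \<le> 0" unfolding L0_def by (rule SUP_least) (simp add: H0_nonneg)
qed

lemma inner_le_L0: "ereal (z \<bullet> y) \<le> L0 \<nu> z + ereal (H0 \<nu> y)"
  using L0_ge[of z y] by (cases "L0 \<nu> z") auto

text \<open>Superlinear growth of \<open>L0\<close>: the supremum is tested with the vector of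
  length R in the direction of z, and \<open>H0\<close> is bounded on the ball of radius R.\<close>

lemma norm_le_L0:
  assumes "0 \<le> R"
  shows "ereal (R * norm z) \<le> L0 \<nu> z + ereal (Hmax R)"
proof -
  have n: "norm (R *\<^sub>R sgn z) \<le> R" using assms by (simp add: norm_sgn)
  have "z \<bullet> (R *\<^sub>R sgn z) = R * norm z"
    by (cases "z = 0") (auto simp: sgn_div_norm dot_square_norm power2_eq_square)
  then have "ereal (R * norm z) \<le> L0 \<nu> z + ereal (H0 \<nu> (R *\<^sub>R sgn z))" using inner_le_L0[of z "R *\<^sub>R sgn z"] by (simp only:)
  also have "\<dots> \<le> L0 \<nu> z + ereal (Hmax R)" using H0_le_Hmax[OF n] by (intro add_left_mono) simp
  finally show ?thesis .
qed

text \<open>The supremum runs over an uncountable family, but its superlevel sets are unions of open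
  sets, so lower semicontinuity gives measurability.\<close>

lemma borel_measurable_L0 [measurable]: "L0 \<nu> \<in> borel_measurable borel"
proof (rule borel_measurableI_greater)
  fix c
  have "{z. c < L0 \<nu> z} = (\<Union>y. {z. c < ereal (z \<bullet> y - H0 \<nu> y)})"
    by (auto simp: L0_def less_SUP_iff)
  also have "open \<dots>" by (intro open_UN ballI open_Collect_less continuous_intros)
  finally show "{z \<in> space borel. c < L0 \<nu> z} \<in> sets borel" by simp
qed

text \<open>The gradient of \<open>H0\<close> at \<open>p\<close> is the control for which \<open>p\<close> is optimal in the Legendre transform.\<close>

lemma L0_gradient:
  obtains u where "L0 \<nu> u = ereal (u \<bullet> p - H0 \<nu> p)"
proof
  \<comment> \<open>This is the derivative of \<open>H0\<close> at \<open>p\<close>, taken under the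
    integral. No differentiability has to be proved: the tangent inequality of exp, integrated,
    shows that u is a subgradient.\<close>
  define u where "u = (\<integral>z. (exp (p \<bullet> z) - 1) *\<^sub>R z \<partial>\<nu>)"
  have int: "integrable \<nu> (\<lambda>z. (exp (p \<bullet> z) - 1) *\<^sub>R z)"
  proof (rule Bochner_Integration.integrable_bound)
    show "integrable \<nu> (\<lambda>z. norm p * ((norm z)\<^sup>2 * exp ((norm p + 1) * norm z)))"
      by (intro integrable_mult_right integrable_weight) (simp add: add_nonneg_pos)
    show "AE z in \<nu>. norm ((exp (p \<bullet> z) - 1) *\<^sub>R z) \<le> norm (norm p * ((norm z)\<^sup>2 * exp ((norm p + 1) * norm z)))"
    proof (rule AE_I2)
      fix z
      have a: "\<bar>p \<bullet> z\<bar> \<le> norm p * norm z" by (rule Cauchy_Schwarz_ineq2)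
      then have "\<bar>p \<bullet> z\<bar> \<le> (norm p + 1) * norm z" using norm_ge_zero[of z] by (simp add: distrib_right del: norm_ge_zero)
      then have "\<bar>exp (p \<bullet> z) - 1\<bar> \<le> norm p * norm z * exp ((norm p + 1) * norm z)"
        using a by (intro order_trans[OF abs_exp_minus_one_le] mult_mono) auto
      then have "\<bar>exp (p \<bullet> z) - 1\<bar> * norm z \<le> norm p * norm z * exp ((norm p + 1) * norm z) * norm z"
        by (rule mult_right_mono) simp
      then show "norm ((exp (p \<bullet> z) - 1) *\<^sub>R z) \<le> norm (norm p * ((norm z)\<^sup>2 * exp ((norm p + 1) * norm z)))"
        by (simp add: abs_mult power2_eq_square mult_ac)
    qed
  qed (intro borel_measurable_\<nu>, measurable)
  have "u \<bullet> y - H0 \<nu> y \<le> u \<bullet> p - H0 \<nu> p" for y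
  proof -
    have "u \<bullet> (y - p) = (\<integral>z. (exp (p \<bullet> z) - 1) * (z \<bullet> (y - p)) \<partial>\<nu>)"
      unfolding u_def using integral_inner_left[OF int, of "y - p"] by simp
    also have "\<dots> \<le> (\<integral>z. (exp (y \<bullet> z) - 1 - y \<bullet> z) - (exp (p \<bullet> z) - 1 - p \<bullet> z) \<partial>\<nu>)"
    proof (rule integral_mono)
      show "integrable \<nu> (\<lambda>z. (exp (p \<bullet> z) - 1) * (z \<bullet> (y - p)))"
        using integrable_inner_left[OF int, of "y - p"] by simp
      show "integrable \<nu> (\<lambda>z. (exp (y \<bullet> z) - 1 - y \<bullet> z) - (exp (p \<bullet> z) - 1 - p \<bullet> z))"
        by (intro Bochner_Integration.integrable_diff H0_integrable)
      fix z
      have "exp (p \<bullet> z) * (1 + (y \<bullet> z - p \<bullet> z)) \<le> exp (p \<bullet> z) * exp (y \<bullet> z - p \<bullet> z)"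
        by (intro mult_left_mono exp_ge_add_one_self) simp
      then show "(exp (p \<bullet> z) - 1) * (z \<bullet> (y - p)) \<le> exp (y \<bullet> z) - 1 - y \<bullet> z - (exp (p \<bullet> z) - 1 - p \<bullet> z)"
        by (simp add: inner_diff_right inner_commute[of z] algebra_simps flip: exp_add)
    qed
    also have "\<dots> = H0 \<nu> y - H0 \<nu> p"
      unfolding H0_def by (intro Bochner_Integration.integral_diff H0_integrable)
    finally show ?thesis by (simp add: inner_diff_right)
  qed
  then have "L0 \<nu> u \<le> ereal (u \<bullet> p - H0 \<nu> p)"
    unfolding L0_def by (intro SUP_least) simp
  then show "L0 \<nu> u = ereal (u \<bullet> p - H0 \<nu> p)" using L0_ge[of u p] by (rule antisym)
qed

section \<open>From pointwise Fenchel bounds to the running cost\<close>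

lemma borel_measurable_cost:
  assumes "u \<in> controls T t"
  shows "(\<lambda>s. e2ennreal (L0 \<nu> (u s)) * indicator {t..T} s) \<in> borel_measurable lebesgue"
proof -
  have "u \<in> borel_measurable (lebesgue_on {t..T})"
    using assms by (simp add: controls_def set_borel_measurable_iff_lebesgue_on)
  then have "(\<lambda>s. e2ennreal (L0 \<nu> (u s))) \<in> borel_measurable (lebesgue_on {t..T})" by measurable
  then show ?thesis by (subst (asm) borel_measurable_restrict_space_iff_ennreal) auto
qed

lemma controls_subinterval:
  assumes "u \<in> controls T t" "t \<le> a" "b \<le> T"
  shows "u \<in> controls b a"
  using assms by (auto simp: controls_def intro: set_borel_measurable_subset)

lemma running_cost_split:
  assumes u: "u \<in> controls T t" and r: "t \<le> r" "r \<le> T"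
  shows "running_cost \<nu> T t u = running_cost \<nu> r t u + running_cost \<nu> T r u"
proof -
  have "AE s in lebesgue. s \<noteq> r" by (rule AE_I'[of "{r}"]) auto
  then have "running_cost \<nu> T t u = (\<integral>\<^sup>+s. e2ennreal (L0 \<nu> (u s)) * indicator {t..r} s
      + e2ennreal (L0 \<nu> (u s)) * indicator {r..T} s \<partial>lebesgue)"
    unfolding running_cost_def
    by (intro nn_integral_cong_AE, elim eventually_mono) (use r in \<open>auto simp: indicator_def\<close>)
  also have "\<dots> = running_cost \<nu> r t u + running_cost \<nu> T r u"
    unfolding running_cost_def
    by (intro nn_integral_add borel_measurable_cost controls_subinterval[OF u]) (use r in auto)
  finally show ?thesis .
qed

text \<open>Here pointwise bounds in terms of \<open>L0\<close> become bounds by the cost.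
  \<open>f\<close> may change sign while the cost is an extended nonnegative integral; dropping the
  negative part of \<open>f\<close> is harmless for an upper bound.\<close>

lemma integral_le_running_cost:
  fixes f :: "real \<Rightarrow> real"
  assumes u: "u \<in> controls b a" and fin: "running_cost \<nu> b a u < \<infinity>" and ab: "a \<le> b" and c: "0 \<le> c"
    and f: "set_integrable lebesgue {a..b} f"
    and le: "\<And>s. s \<in> {a..b} \<Longrightarrow> ereal (f s) \<le> L0 \<nu> (u s) + ereal c"
  shows "(LINT s:{a..b}|lebesgue. f s) \<le> enn2real (running_cost \<nu> b a u) + c * (b - a)"
proof -
  have "(LINT s:{a..b}|lebesgue. f s) \<le> enn2real (\<integral>\<^sup>+s. ennreal (indicator {a..b} s *\<^sub>R f s) \<partial>lebesgue)"
    using f unfolding set_lebesgue_integral_def set_integrable_def by (simp add: real_lebesgue_integral_def)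
  also have "\<dots> \<le> enn2real (running_cost \<nu> b a u + ennreal (c * (b - a)))"
  proof (rule enn2real_mono)
    have "(\<integral>\<^sup>+s. ennreal (indicator {a..b} s *\<^sub>R f s) \<partial>lebesgue)
        \<le> (\<integral>\<^sup>+s. e2ennreal (L0 \<nu> (u s)) * indicator {a..b} s + ennreal c * indicator {a..b} s \<partial>lebesgue)"
    proof (rule nn_integral_mono)
      fix s
      show "ennreal (indicator {a..b} s *\<^sub>R f s) \<le> e2ennreal (L0 \<nu> (u s)) * indicator {a..b} s + ennreal c * indicator {a..b} s"
      proof (cases "s \<in> {a..b}")
        case True
        have "ennreal (f s) = e2ennreal (ereal (f s))" by simp
        also have "\<dots> \<le> e2ennreal (L0 \<nu> (u s) + ereal c)" by (intro e2ennreal_mono le True)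
        also have "\<dots> = e2ennreal (L0 \<nu> (u s)) + ennreal c"
          using L0_nonneg c by (simp add: e2ennreal_add_ereal)
        finally show ?thesis using True by simp
      qed simp
    qed
    also have "\<dots> = running_cost \<nu> b a u + (\<integral>\<^sup>+s. ennreal c * indicator {a..b} s \<partial>lebesgue)"
      unfolding running_cost_def by (intro nn_integral_add borel_measurable_cost u borel_measurable_times_ennreal borel_measurable_const borel_measurable_indicator) auto
    also have "(\<integral>\<^sup>+s. ennreal c * indicator {a..b} s \<partial>lebesgue) = ennreal (c * (b - a))"
      using ab c by (simp add: nn_integral_cmult_indicator ennreal_mult)
    finally show "(\<integral>\<^sup>+s. ennreal (indicator {a..b} s *\<^sub>R f s) \<partial>lebesgue) \<le> running_cost \<nu> b a u + ennreal (c * (b - a))" .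
    show "running_cost \<nu> b a u + ennreal (c * (b - a)) < top" using fin by (simp add: less_top)
  qed
  also have "\<dots> = enn2real (running_cost \<nu> b a u) + c * (b - a)"
    using fin ab c by (subst enn2real_plus) (auto simp: less_top)
  finally show ?thesis .
qed

lemma set_integrable_control:
  assumes u: "u \<in> controls b a" and fin: "running_cost \<nu> b a u < \<infinity>"
  shows "set_integrable lebesgue {a..b} u"
proof -
  have "(\<integral>\<^sup>+s. ennreal (norm (indicator {a..b} s *\<^sub>R u s)) \<partial>lebesgue)
      \<le> (\<integral>\<^sup>+s. e2ennreal (L0 \<nu> (u s)) * indicator {a..b} s + ennreal (Hmax 1) * indicator {a..b} s \<partial>lebesgue)"
  proof (rule nn_integral_mono)
    fix s
    have "ennreal (norm (u s)) = e2ennreal (ereal (norm (u s)))" by simp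
    also have "\<dots> \<le> e2ennreal (L0 \<nu> (u s) + ereal (Hmax 1))" using norm_le_L0[of 1 "u s"] by (intro e2ennreal_mono) simp
    also have "\<dots> = e2ennreal (L0 \<nu> (u s)) + ennreal (Hmax 1)"
      using L0_nonneg Hmax_nonneg by (simp add: e2ennreal_add_ereal)
    finally show "ennreal (norm (indicator {a..b} s *\<^sub>R u s)) \<le> e2ennreal (L0 \<nu> (u s)) * indicator {a..b} s + ennreal (Hmax 1) * indicator {a..b} s"
      by (simp add: indicator_def)
  qed
  also have "\<dots> = running_cost \<nu> b a u + (\<integral>\<^sup>+s. ennreal (Hmax 1) * indicator {a..b} s \<partial>lebesgue)"
    unfolding running_cost_def by (intro nn_integral_add borel_measurable_cost u borel_measurable_times_ennreal borel_measurable_const borel_measurable_indicator) auto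
  also have "\<dots> < \<infinity>" using fin by (simp add: nn_integral_cmult_indicator less_top ennreal_mult_less_top emeasure_lborel_Icc_eq)
  finally show ?thesis
    unfolding set_integrable_def using u
    by (intro integrableI_bounded) (auto simp: controls_def set_borel_measurable_def)
qed

text \<open>The factor R is free. R = 1 bounds the integral of |u| by the cost, and a large R makes
  it small on short intervals, uniformly for bounded cost.\<close>

lemma integral_norm_control_le:
  assumes "u \<in> controls b a" "running_cost \<nu> b a u < \<infinity>" "a \<le> b" "0 \<le> R"
  shows "R * (LINT s:{a..b}|lebesgue. norm (u s)) \<le> enn2real (running_cost \<nu> b a u) + Hmax R * (b - a)"
proof -
  have "set_integrable lebesgue {a..b} (\<lambda>s. R * norm (u s))"
    by (intro set_integrable_mult_right set_integrable_norm set_integrable_control assms)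
  from integral_le_running_cost[OF assms(1-3) Hmax_nonneg this norm_le_L0[OF assms(4)]]
  show ?thesis by simp
qed

end

subsection \<open>Mild solutions\<close>

locale control_system = weak_contraction domA A S B c0
  for domA :: "'a::{real_inner, banach, second_countable_topology} set"
    and A :: "'a \<Rightarrow> 'a" and S :: "real \<Rightarrow> 'a \<Rightarrow>\<^sub>L 'a" and B :: "'a \<Rightarrow>\<^sub>L 'a" and c0 :: real +
  fixes F :: "'a \<Rightarrow> 'a" and G :: "'a \<Rightarrow> 'a \<Rightarrow>\<^sub>L 'a" and M :: real
  assumes M: "M \<ge> 0"
    and F_0: "norm (F 0) \<le> M"
    and F_lip: "\<forall>x y. norm (F x - F y) \<le> M * norm_m1 B (x - y)"
    and G_lip: "\<forall>x y. norm (G x - G y) \<le> M * norm_m1 B (x - y)"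
    and G_bound: "\<forall>x. norm (G x) \<le> M"
begin

abbreviation "mild \<equiv> mild_solution S F G"

text \<open>The weak norm is at most the norm of B^(1/2) times the norm, so \<open>M\<close> becomes
  this Lipschitz constant in the ambient norm. The same product reappears when the ambient norm of a
  drift increment is passed to the weak norm.\<close>

definition Lip :: real where "Lip = M * norm (sqrt_op B)"

definition drift :: "'a \<Rightarrow> 'a \<Rightarrow> 'a" where "drift x u = F x + G x u"

lemma Lip_nonneg: "0 \<le> Lip"
  using M by (simp add: Lip_def)

lemma M_norm_m1_le: "M * norm_m1 B x \<le> Lip * norm x"
  unfolding Lip_def mult.assoc by (intro mult_left_mono norm_m1_le M)

lemma F_Lip: "norm (F x - F y) \<le> Lip * norm (x - y)"
  using F_lip M_norm_m1_le order_trans by blast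

lemma G_Lip: "norm (G x - G y) \<le> Lip * norm (x - y)"
  using G_lip M_norm_m1_le order_trans by blast

lemma F_growth: "norm (F x) \<le> M + Lip * norm x"
  using F_Lip[of x 0] F_0 norm_triangle_ineq[of "F x - F 0" "F 0"] by simp

lemma isCont_F: "isCont F x"
proof -
  have "Lip-lipschitz_on UNIV F" by (rule lipschitz_onI) (auto simp: dist_norm F_Lip Lip_nonneg)
  then show ?thesis using lipschitz_on_continuous_on continuous_on_eq_continuous_at open_UNIV by blast
qed

lemma isCont_G: "isCont G x"
proof -
  have "Lip-lipschitz_on UNIV G" by (rule lipschitz_onI) (auto simp: dist_norm G_Lip Lip_nonneg)
  then show ?thesis using lipschitz_on_continuous_on continuous_on_eq_continuous_at open_UNIV by blast
qed

lemma drift_growth: "norm (drift x u) \<le> M + Lip * norm x + M * norm u"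
proof -
  have "norm (G x u) \<le> M * norm u"
    using norm_blinfun[of "G x" u] mult_right_mono[of "norm (G x)" M "norm u"] G_bound order_trans by auto
  then show ?thesis unfolding drift_def using F_growth[of x] norm_triangle_ineq[of "F x" "G x u"] by linarith
qed

lemma drift_diff: "norm (drift x u - drift y u) \<le> M * (1 + norm u) * norm_m1 B (x - y)"
proof -
  have "norm ((G x - G y) u) \<le> M * norm_m1 B (x - y) * norm u"
    by (rule order_trans[OF norm_blinfun]) (intro mult_right_mono G_lip[rule_format]; simp)
  moreover have "drift x u - drift y u = (F x - F y) + (G x - G y) u"
    by (simp add: drift_def blinfun.diff_left)
  ultimately have "norm (drift x u - drift y u) \<le> M * norm_m1 B (x - y) + M * norm_m1 B (x - y) * norm u"
    using F_lip[rule_format, of x y] norm_triangle_ineq[of "F x - F y" "(G x - G y) u"] by (simp only:)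
  then show ?thesis by (simp add: algebra_simps)
qed

lemma drift_diff_norm: "norm (drift x u - drift y u) \<le> Lip * (1 + norm u) * norm (x - y)"
proof -
  have "M * (1 + norm u) * norm_m1 B (x - y) = (1 + norm u) * (M * norm_m1 B (x - y))" by simp
  also have "\<dots> \<le> (1 + norm u) * (Lip * norm (x - y))" by (intro mult_left_mono M_norm_m1_le) simp
  finally show ?thesis using drift_diff[of x u y] by (simp add: mult_ac)
qed

lemma continuous_drift: "continuous_on UNIV (\<lambda>p. drift (fst p) (snd p))"
proof -
  have "continuous_on UNIV F" "continuous_on UNIV G"
    using isCont_F isCont_G by (auto simp: continuous_at_imp_continuous_on)
  then have "continuous_on UNIV (\<lambda>p. F (fst p))" "continuous_on UNIV (\<lambda>p. G (fst p))"
    using continuous_on_compose2[OF _ continuous_on_fst[OF continuous_on_id]] by blast+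
  then show ?thesis unfolding drift_def by (intro continuous_intros) auto
qed

lemma growth_integrable:
  fixes t T :: real and u :: "real \<Rightarrow> 'a"
  assumes X: "continuous_on {t..T} X" and u: "set_integrable lebesgue {t..T} u"
  shows "set_integrable lebesgue {t..T} (\<lambda>\<tau>. M + Lip * norm (X \<tau>) + M * norm (u \<tau>))"
proof (rule set_integral_add(1))
  show "set_integrable lebesgue {t..T} (\<lambda>\<tau>. M + Lip * norm (X \<tau>))"
    by (intro set_integrable_continuous_interval continuous_intros X)
qed (intro set_integrable_mult_right set_integrable_norm u)

lemma set_integrable_drift:
  fixes t T :: real
  assumes X: "continuous_on {t..T} X" and u: "set_integrable lebesgue {t..T} u"
  shows "set_integrable lebesgue {t..T} (\<lambda>\<tau>. drift (X \<tau>) (u \<tau>))"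
proof (rule set_integrable_dominated[OF growth_integrable[OF assms]])
  show "set_borel_measurable lebesgue {t..T} (\<lambda>\<tau>. drift (X \<tau>) (u \<tau>))"
    unfolding set_borel_measurable_iff_lebesgue_on
    by (rule borel_measurable_continuous_Pair[OF _ _ continuous_drift])
       (use set_borel_measurable_continuous[OF X] set_borel_measurable_of_integrable[OF u]
         in \<open>auto simp: set_borel_measurable_iff_lebesgue_on\<close>)
qed (rule drift_growth)

lemma set_borel_measurable_S:
  assumes "set_integrable lebesgue {t..T} f"
  shows "set_borel_measurable lebesgue {t..T} (\<lambda>\<tau>. S (max 0 (s - \<tau>)) (f \<tau>))"
  using set_borel_measurable_of_integrable[OF assms] unfolding set_borel_measurable_iff_lebesgue_on
  by (rule borel_measurable_S[OF continuous_imp_measurable_on_sets_lebesgue, rotated 2]) (auto intro!: continuous_intros)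

lemma set_integrable_S:
  assumes "set_integrable lebesgue {t..T} f" "s \<le> T" "T \<le> r"
  shows "set_integrable lebesgue {t..s} (\<lambda>\<tau>. S (r - \<tau>) (f \<tau>))"
proof -
  have f: "set_integrable lebesgue {t..s} f" by (rule set_integrable_subinterval[OF assms(1)]) (use assms in auto)
  have "set_integrable lebesgue {t..s} (\<lambda>\<tau>. S (max 0 (r - \<tau>)) (f \<tau>))"
    by (rule set_integrable_dominated[OF set_integrable_norm[OF f] set_borel_measurable_S[OF f]])
       (simp add: norm_S_le)
  then show ?thesis by (subst set_integrable_cong[OF refl refl]) (use assms in \<open>auto simp: max_def\<close>)
qed

lemma set_integrable_S_self:
  assumes "set_integrable lebesgue {t..T} f" "s \<in> {t..T}"
  shows "set_integrable lebesgue {t..s} (\<lambda>\<tau>. S (s - \<tau>) (f \<tau>))"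
  by (rule set_integrable_S[OF set_integrable_subinterval[OF assms(1)], of t s]) (use assms in auto)

lemma continuous_on_convolution:
  assumes f: "set_integrable lebesgue {t..T} f"
  shows "continuous_on {t..T} (\<lambda>s. LINT \<tau>:{t..s}|lebesgue. S (s - \<tau>) (f \<tau>))"
proof -
  have "continuous_on {t..T} (\<lambda>s. LINT \<tau>:{t..s}|lebesgue. S (max 0 (s - \<tau>)) (f \<tau>))"
    by (rule continuous_on_set_integral_param[OF set_integrable_norm[OF f] set_borel_measurable_S[OF f]],
        simp add: norm_S_le, rule continuous_on_S) (auto intro!: continuous_intros)
  moreover have "(LINT \<tau>:{t..s}|lebesgue. S (max 0 (s - \<tau>)) (f \<tau>)) = (LINT \<tau>:{t..s}|lebesgue. S (s - \<tau>) (f \<tau>))" for s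
    by (rule set_lebesgue_integral_cong) (auto simp: max_def)
  ultimately show ?thesis by simp
qed

section \<open>Existence and uniqueness by Picard iteration\<close>

definition Picard :: "real \<Rightarrow> 'a \<Rightarrow> (real \<Rightarrow> 'a) \<Rightarrow> (real \<Rightarrow> 'a) \<Rightarrow> real \<Rightarrow> 'a" where
  "Picard t x u X s = S (s - t) x + (LINT \<tau>:{t..s}|lebesgue. S (s - \<tau>) (drift (X \<tau>) (u \<tau>)))"

text \<open>For continuous X and integrable u the integrability clause of
  \<open>mild_solution\<close> is automatic, which leaves a fixed point equation.\<close>

lemma mild_iff_Picard:
  assumes "set_integrable lebesgue {t..T} u"
  shows "mild T t x u X \<longleftrightarrow> continuous_on {t..T} X \<and> (\<forall>s\<in>{t..T}. X s = Picard t x u X s)"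
proof -
  have "set_integrable lebesgue {t..s} (\<lambda>\<tau>. S (s - \<tau>) (F (X \<tau>) + G (X \<tau>) (u \<tau>)))"
    if "continuous_on {t..T} X" "s \<in> {t..T}" for s
    using set_integrable_S_self[OF set_integrable_drift[OF that(1) assms] that(2)] by (simp add: drift_def)
  then show ?thesis unfolding mild_solution_def Picard_def drift_def by blast
qed

lemma continuous_on_Picard:
  assumes "continuous_on {t..T} X" "set_integrable lebesgue {t..T} u"
  shows "continuous_on {t..T} (Picard t x u X)"
  unfolding Picard_def
  by (rule continuous_on_add[OF continuous_on_S continuous_on_convolution[OF set_integrable_drift[OF assms]]])
     (auto intro!: continuous_intros)

lemma Picard_diff:
  assumes X: "continuous_on {t..T} X" and Y: "continuous_on {t..T} Y"
    and u: "set_integrable lebesgue {t..T} u" and s: "s \<in> {t..T}"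
  shows "set_integrable lebesgue {t..s} (\<lambda>\<tau>. S (s - \<tau>) (drift (X \<tau>) (u \<tau>) - drift (Y \<tau>) (u \<tau>)))"
    "Picard t x u X s - Picard t y u Y s =
      S (s - t) (x - y) + (LINT \<tau>:{t..s}|lebesgue. S (s - \<tau>) (drift (X \<tau>) (u \<tau>) - drift (Y \<tau>) (u \<tau>)))"
proof -
  note d = set_integral_diff[OF set_integrable_S_self[OF set_integrable_drift[OF X u] s]
      set_integrable_S_self[OF set_integrable_drift[OF Y u] s]]
  show "set_integrable lebesgue {t..s} (\<lambda>\<tau>. S (s - \<tau>) (drift (X \<tau>) (u \<tau>) - drift (Y \<tau>) (u \<tau>)))"
    unfolding blinfun.diff_right by (rule d(1))
  show "Picard t x u X s - Picard t y u Y s =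
      S (s - t) (x - y) + (LINT \<tau>:{t..s}|lebesgue. S (s - \<tau>) (drift (X \<tau>) (u \<tau>) - drift (Y \<tau>) (u \<tau>)))"
    unfolding Picard_def blinfun.diff_right d(2) by simp
qed

lemma norm_Picard_diff:
  assumes X: "continuous_on {t..T} X" and Y: "continuous_on {t..T} Y"
    and u: "set_integrable lebesgue {t..T} u" and s: "s \<in> {t..T}"
  shows "norm (Picard t x u X s - Picard t y u Y s) \<le>
    norm (x - y) + (LINT \<tau>:{t..s}|lebesgue. Lip * (1 + norm (u \<tau>)) * norm (X \<tau> - Y \<tau>))"
  unfolding Picard_diff(2)[OF assms]
proof (rule norm_triangle_mono[OF norm_S_le norm_set_integral_le[OF Picard_diff(1)[OF assms]]])
  have us: "set_integrable lebesgue {t..s} u" by (rule set_integrable_subinterval[OF u]) (use s in auto)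
  show "set_integrable lebesgue {t..s} (\<lambda>\<tau>. Lip * (1 + norm (u \<tau>)) * norm (X \<tau> - Y \<tau>))"
    by (intro set_integrable_mult_continuous set_integrable_mult_right set_integral_add set_integrable_norm us
        set_integrable_continuous_interval continuous_intros continuous_on_subset[OF X] continuous_on_subset[OF Y])
       (use s in auto)
  fix \<tau> assume "\<tau> \<in> {t..s}"
  then show "norm (S (s - \<tau>) (drift (X \<tau>) (u \<tau>) - drift (Y \<tau>) (u \<tau>))) \<le> Lip * (1 + norm (u \<tau>)) * norm (X \<tau> - Y \<tau>)"
    by (intro order_trans[OF norm_S_le drift_diff_norm]) auto
qed (use s in auto)

lemma kernel_integrable:
  fixes t T :: real and u :: "real \<Rightarrow> 'a"
  assumes "set_integrable lebesgue {t..T} u"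
  shows "set_integrable lebesgue {t..T} (\<lambda>\<tau>. c * (1 + norm (u \<tau>)))"
  by (rule set_integrable_mult_right, rule set_integral_add(1)[OF set_integrable_continuous_interval set_integrable_norm[OF assms]])
     (rule continuous_on_const)

lemma mild_unique:
  assumes u: "set_integrable lebesgue {t..T} u"
    and X: "mild T t x u X" and Y: "mild T t x u Y" and s: "s \<in> {t..T}"
  shows "X s = Y s"
proof -
  have Xc: "continuous_on {t..T} X" and Yc: "continuous_on {t..T} Y"
    and P: "\<And>s. s \<in> {t..T} \<Longrightarrow> X s = Picard t x u X s" "\<And>s. s \<in> {t..T} \<Longrightarrow> Y s = Picard t x u Y s"
    using X Y unfolding mild_iff_Picard[OF u] by auto
  have "norm (X s - Y s) \<le> 2 * 0 * exp (2 * (LINT \<tau>:{t..T}|lebesgue. Lip * (1 + norm (u \<tau>))))"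
  proof (rule Gronwall_integrable_kernel[OF kernel_integrable[OF u] _ _ _ _ s])
    show "continuous_on {t..T} (\<lambda>s. norm (X s - Y s))" by (intro continuous_intros Xc Yc)
    show "norm (X s - Y s) \<le> 0 + (LINT \<tau>:{t..s}|lebesgue. Lip * (1 + norm (u \<tau>)) * norm (X \<tau> - Y \<tau>))"
      if "s \<in> {t..T}" for s
      using norm_Picard_diff[OF Xc Yc u that, of x x] P[OF that] by simp
  qed (auto simp: Lip_nonneg)
  then show ?thesis by simp
qed

text \<open>The kernel is integrable but may be unbounded, so the iteration is run in the norm
  weighted by exp (2 K), in which each step halves the distance. Convergence is then geometric and
  uniform on the whole interval at once.\<close>

lemma mild_exists:
  assumes u: "set_integrable lebesgue {t..T} u" and tT: "t \<le> T"
  shows "\<exists>X. mild T t x u X"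
proof -
  define k where "k \<tau> = Lip * (1 + norm (u \<tau>))" for \<tau>
  have k: "set_integrable lebesgue {t..T} k" unfolding k_def by (rule kernel_integrable[OF u])
  have k0: "0 \<le> k \<tau>" for \<tau> by (simp add: k_def Lip_nonneg)
  define K where "K s = (LINT \<tau>:{t..s}|lebesgue. k \<tau>)" for s
  have Kc: "continuous_on {t..T} K" unfolding K_def by (rule continuous_on_indefinite_set_integral[OF k])
  have K0: "0 \<le> K s" for s
    unfolding K_def set_lebesgue_integral_def using k0 by (intro integral_nonneg_AE AE_I2) auto
  have KT: "K s \<le> K T" if "s \<in> {t..T}" for s
    unfolding K_def using that by (intro set_integral_nonneg_mono[OF k] k0) auto
  have kint: "(LINT \<tau>:{t..s}|lebesgue. k \<tau> * exp (2 * K \<tau>)) \<le> exp (2 * K s) / 2" if "s \<in> {t..T}" for s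
    unfolding K_def by (rule integral_kernel_exp_le[OF k k0 that])
  define X where "X n = (Picard t x u ^^ n) (\<lambda>s. S (s - t) x)" for n
  have XS: "X (Suc n) = Picard t x u (X n)" for n by (simp add: X_def)
  have Xc: "continuous_on {t..T} (X n)" for n
  proof (induction n)
    case 0
    have "continuous_on {t..T} (\<lambda>s. S (s - t) x)" by (rule continuous_on_S) (auto intro!: continuous_intros)
    then show ?case by (simp add: X_def)
  next
    case (Suc n)
    then show ?case unfolding XS by (rule continuous_on_Picard[OF _ u])
  qed
  have step: "norm (Picard t x u Y s - Picard t x u Z s) \<le> (LINT \<tau>:{t..s}|lebesgue. k \<tau> * norm (Y \<tau> - Z \<tau>))"
    if "continuous_on {t..T} Y" "continuous_on {t..T} Z" "s \<in> {t..T}" for Y Z s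
    using norm_Picard_diff[OF that(1,2) u that(3), of x x] by (simp add: k_def)
  have kf: "set_integrable lebesgue {t..s} (\<lambda>\<tau>. k \<tau> * f \<tau>)" if "continuous_on {t..T} f" "s \<in> {t..T}" for f s
    using that by (intro set_integrable_mult_continuous set_integrable_subinterval[OF k] continuous_on_subset[OF that(1)]) auto
  have "compact ((\<lambda>s. X 1 s - X 0 s) ` {t..T})"
    by (intro compact_continuous_image continuous_intros Xc compact_Icc)
  then obtain C where C: "\<And>s. s \<in> {t..T} \<Longrightarrow> norm (X 1 s - X 0 s) \<le> C"
    using compact_imp_bounded by (fastforce simp: bounded_iff)
  have C0: "0 \<le> C" using order_trans[OF norm_ge_zero C[of t]] tT by simp
  have diff: "norm (X (Suc n) s - X n s) \<le> C * (1/2) ^ n * exp (2 * K s)" if "s \<in> {t..T}" for n s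
    using that
  proof (induction n arbitrary: s)
    case 0
    have "C * 1 \<le> C * exp (2 * K s)" using C0 K0 by (intro mult_left_mono) auto
    then show ?case using C[OF 0] by simp
  next
    case (Suc n)
    have "norm (X (Suc (Suc n)) s - X (Suc n) s) \<le> (LINT \<tau>:{t..s}|lebesgue. k \<tau> * norm (X (Suc n) \<tau> - X n \<tau>))"
      using step[OF Xc[of "Suc n"] Xc[of n] Suc.prems] by (simp only: XS)
    also have "\<dots> \<le> (LINT \<tau>:{t..s}|lebesgue. k \<tau> * (C * (1/2) ^ n * exp (2 * K \<tau>)))"
      by (intro set_integral_mono kf mult_left_mono Suc.IH k0 continuous_intros Xc Kc Suc.prems)
         (use Suc.prems in auto)
    also have "\<dots> = C * (1/2) ^ n * (LINT \<tau>:{t..s}|lebesgue. k \<tau> * exp (2 * K \<tau>))"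
      by (subst set_integral_mult_right[symmetric]) (simp only: mult_ac)
    also have "\<dots> \<le> C * (1/2) ^ n * (exp (2 * K s) / 2)"
      using C0 by (intro mult_left_mono kint Suc.prems) auto
    finally show ?case by simp
  qed
  have unif: "uniform_limit {t..T} (\<lambda>n s. \<Sum>i<n. X (Suc i) s - X i s) (\<lambda>s. suminf (\<lambda>i. X (Suc i) s - X i s)) sequentially"
  proof (rule Weierstrass_m_test)
    show "norm (X (Suc n) s - X n s) \<le> (1/2) ^ n * (C * exp (2 * K T))" if "s \<in> {t..T}" for n s
    proof -
      have "C * (1/2) ^ n * exp (2 * K s) \<le> C * (1/2) ^ n * exp (2 * K T)"
        using KT[OF that] C0 by (intro mult_left_mono) auto
      then show ?thesis using diff[OF that, of n] by (simp add: mult_ac)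
    qed
    show "summable (\<lambda>n. (1/2) ^ n * (C * exp (2 * K T)))" by (intro summable_mult2 summable_geometric) simp
  qed
  define Y where "Y s = X 0 s + suminf (\<lambda>i. X (Suc i) s - X i s)" for s
  have "uniform_limit {t..T} (\<lambda>n s. X 0 s + (\<Sum>i<n. X (Suc i) s - X i s)) Y sequentially"
    unfolding Y_def by (intro uniform_limit_intros unif)
  then have lim: "uniform_limit {t..T} X Y sequentially"
    by (simp add: sum_lessThan_telescope[where f = "\<lambda>i. X i s" for s])
  have Yc: "continuous_on {t..T} Y"
    by (rule uniform_limit_theorem[OF always_eventually lim]) (auto intro: Xc)
  have "Y s = Picard t x u Y s" if s: "s \<in> {t..T}" for s
  proof (rule LIMSEQ_unique)
    show "(\<lambda>n. X (Suc n) s) \<longlonglongrightarrow> Y s" using tendsto_uniform_limitI[OF lim s] by (rule LIMSEQ_Suc)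
    show "(\<lambda>n. X (Suc n) s) \<longlonglongrightarrow> Picard t x u Y s"
    proof (rule metric_LIMSEQ_I)
      fix e :: real assume e: "e > 0"
      \<comment> \<open>\<open>K T\<close> is the Lipschitz constant of the Picard map for the
        uniform distance; the summand 1 avoids division by zero.\<close>
      define d where "d = e / (K T + 1)"
      have d: "d > 0" using e K0[of T] by (simp add: d_def add_nonneg_pos)
      obtain N where N: "\<And>n \<tau>. n \<ge> N \<Longrightarrow> \<tau> \<in> {t..T} \<Longrightarrow> dist (X n \<tau>) (Y \<tau>) < d"
        using uniform_limitD[OF lim d] unfolding eventually_sequentially by blast
      have "dist (X (Suc n) s) (Picard t x u Y s) < e" if "n \<ge> N" for n
      proof -
        have "norm (X (Suc n) s - Picard t x u Y s) \<le> (LINT \<tau>:{t..s}|lebesgue. k \<tau> * norm (X n \<tau> - Y \<tau>))"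
          using step[OF Xc[of n] Yc s] by (simp only: XS)
        also have "\<dots> \<le> (LINT \<tau>:{t..s}|lebesgue. k \<tau> * d)"
          using N[OF that] s by (intro set_integral_mono kf mult_left_mono k0 continuous_intros Xc Yc)
            (auto simp: dist_norm less_imp_le)
        also have "\<dots> = K s * d" by (simp add: K_def)
        also have "\<dots> \<le> K T * d" using KT[OF s] d by (intro mult_right_mono) auto
        also have "\<dots> < (K T + 1) * d" using d by simp
        also have "\<dots> = e" using K0[of T] by (simp add: d_def add_nonneg_pos)
        finally show ?thesis by (simp add: dist_norm)
      qed
      then show "\<exists>no. \<forall>n\<ge>no. dist (X (Suc n) s) (Picard t x u Y s) < e" by blast
    qed
  qed
  then show ?thesis using Yc mild_iff_Picard[OF u] by blast
qed

lemma mild_cong: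
  assumes "\<And>s. s \<in> {t..T} \<Longrightarrow> X s = Y s" "\<And>s. s \<in> {t..T} \<Longrightarrow> u s = w s"
  shows "mild T t x u X \<longleftrightarrow> mild T t x w Y"
proof -
  have "set_integrable lebesgue {t..s} (\<lambda>\<tau>. S (s - \<tau>) (F (X \<tau>) + G (X \<tau>) (u \<tau>)))
      \<longleftrightarrow> set_integrable lebesgue {t..s} (\<lambda>\<tau>. S (s - \<tau>) (F (Y \<tau>) + G (Y \<tau>) (w \<tau>)))"
    "(LINT \<tau>:{t..s}|lebesgue. S (s - \<tau>) (F (X \<tau>) + G (X \<tau>) (u \<tau>)))
      = (LINT \<tau>:{t..s}|lebesgue. S (s - \<tau>) (F (Y \<tau>) + G (Y \<tau>) (w \<tau>)))" if "s \<in> {t..T}" for s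
    using that assms by (intro set_integrable_cong set_lebesgue_integral_cong; auto)+
  moreover have "continuous_on {t..T} X \<longleftrightarrow> continuous_on {t..T} Y" by (rule continuous_on_cong[OF refl assms(1)])
  ultimately show ?thesis
    unfolding mild_solution_def using assms(1) by (intro conj_cong ball_cong) simp_all
qed

text \<open>Uniqueness holds on \<open>{t..T}\<close> only; the extensional representative makes it
  uniqueness of functions, as the definite description requires.\<close>

lemma the_mild_solution_mild:
  assumes u: "set_integrable lebesgue {t..T} u" and tT: "t \<le> T"
  shows "mild T t x u (the_mild_solution S F G T t x u)"
proof -
  obtain X where X: "mild T t x u X" using mild_exists[OF assms] by blast
  have "mild T t x u (restrict X {t..T})"
    using X by (subst (asm) mild_cong[of t T X "restrict X {t..T}" u u]) auto
  then have "restrict X {t..T} \<in> extensional {t..T} \<and> mild T t x u (restrict X {t..T})" by simp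
  moreover have "Y = restrict X {t..T}" if "Y \<in> extensional {t..T} \<and> mild T t x u Y" for Y
    using that X mild_unique[OF u] by (auto simp: extensional_def restrict_def fun_eq_iff)
  ultimately have "the_mild_solution S F G T t x u \<in> extensional {t..T} \<and> mild T t x u (the_mild_solution S F G T t x u)"
    unfolding the_mild_solution_def by (rule theI)
  then show ?thesis by simp
qed

lemma mild_initial:
  assumes "mild T t x u X" "t \<le> T"
  shows "X t = x"
proof -
  have "X t = S (t - t) x + (LINT \<tau>:{t..t}|lebesgue. S (t - \<tau>) (F (X \<tau>) + G (X \<tau>) (u \<tau>)))"
  proof -
    have "t \<in> {t..T}" using assms(2) by simp
    then show ?thesis using assms(1) unfolding mild_solution_def by blast
  qed
  then show ?thesis by simp
qed

lemma mild_restrict_left: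
  assumes "mild T t x u X" "r \<le> T"
  shows "mild r t x u X"
proof -
  have "{t..r} \<subseteq> {t..T}" using assms(2) by auto
  then show ?thesis using assms(1) continuous_on_subset unfolding mild_solution_def by blast
qed

section \<open>The flow property and a priori estimates\<close>

text \<open>The semigroup is a bounded operator, so it passes under the integral up to time r and
  merges with the semigroup there.\<close>

lemma mild_restrict_right:
  assumes X: "mild T t x u X" and r: "r \<in> {t..T}" and u: "set_integrable lebesgue {t..T} u"
  shows "mild T r (X r) u X"
proof -
  have ur: "set_integrable lebesgue {r..T} u" by (rule set_integrable_subinterval[OF u]) (use r in auto)
  have Xc: "continuous_on {t..T} X" using X by (simp add: mild_solution_def)
  let ?f = "\<lambda>\<tau>. drift (X \<tau>) (u \<tau>)"
  have f: "set_integrable lebesgue {t..T} ?f" by (rule set_integrable_drift[OF Xc u])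
  have XP: "X s = Picard t x u X s" if "s \<in> {t..T}" for s using X that unfolding mild_iff_Picard[OF u] by blast
  have "X s = Picard r (X r) u X s" if s: "s \<in> {r..T}" for s
  proof -
    have st: "s \<in> {t..T}" using s r by auto
    have i: "set_integrable lebesgue {t..s} (\<lambda>\<tau>. S (s - \<tau>) (?f \<tau>))" by (rule set_integrable_S_self[OF f st])
    have ir: "set_integrable lebesgue {t..r} (\<lambda>\<tau>. S (r - \<tau>) (?f \<tau>))" by (rule set_integrable_S_self[OF f r])
    have "S (s - r) (LINT \<tau>:{t..r}|lebesgue. S (r - \<tau>) (?f \<tau>)) = (LINT \<tau>:{t..r}|lebesgue. S (s - r) (S (r - \<tau>) (?f \<tau>)))"
      using integral_bounded_linear[OF blinfun.bounded_linear_right ir[unfolded set_integrable_def], of "S (s - r)"]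
      by (simp add: set_lebesgue_integral_def blinfun.scaleR_right)
    also have "\<dots> = (LINT \<tau>:{t..r}|lebesgue. S (s - \<tau>) (?f \<tau>))"
      by (rule set_lebesgue_integral_cong) (use s in \<open>auto simp flip: S_add\<close>)
    finally have "S (s - r) (X r) = S (s - t) x + (LINT \<tau>:{t..r}|lebesgue. S (s - \<tau>) (?f \<tau>))"
      using s r S_add[of "s - r" "r - t" x] by (subst XP[OF r]) (auto simp: Picard_def blinfun.add_right)
    then show ?thesis
      using set_integral_interval_split[OF i, of r] s r by (subst XP[OF st]) (auto simp: Picard_def)
  qed
  moreover have "continuous_on {r..T} X" by (rule continuous_on_subset[OF Xc]) (use r in auto)
  ultimately show ?thesis unfolding mild_iff_Picard[OF ur] by blast
qed

text \<open>The drift increment is measured in the ambient norm but is controlled by the weak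
  distance of the states, so the inequality closes in the weak norm. The control enters the constant
  only through the integral of |u|.\<close>

lemma mild_weak_dependence:
  assumes u: "set_integrable lebesgue {t..T} u" and tT: "t \<le> T"
    and X: "mild T t x u X" and Y: "mild T t y u Y" and s: "s \<in> {t..T}"
  shows "norm_m1 B (X s - Y s) \<le> 2 * (exp (c0 * (T - t)) * norm_m1 B (x - y))
    * exp (2 * (exp (c0 * (T - t)) * Lip * ((T - t) + (LINT \<tau>:{t..T}|lebesgue. norm (u \<tau>)))))"
proof -
  have Xc: "continuous_on {t..T} X" and Yc: "continuous_on {t..T} Y"
    and P: "\<And>s. s \<in> {t..T} \<Longrightarrow> X s = Picard t x u X s" "\<And>s. s \<in> {t..T} \<Longrightarrow> Y s = Picard t y u Y s"
    using X Y unfolding mild_iff_Picard[OF u] by auto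
  define E where "E = exp (c0 * (T - t))"
  have E: "norm_m1 B (S r z) \<le> E * norm_m1 B z" if "0 \<le> r" "r \<le> T - t" for r z
    unfolding E_def using c0 that
    by (intro order_trans[OF norm_m1_S_le] mult_right_mono) (auto intro: mult_left_mono)
  have E0: "0 \<le> E" by (simp add: E_def)
  have nc: "continuous_on {t..T} (\<lambda>s. norm_m1 B (X s - Y s))"
    unfolding norm_m1_def by (intro continuous_intros Xc Yc)
  have "norm_m1 B (X s - Y s) \<le> 2 * (E * norm_m1 B (x - y)) * exp (2 * (LINT \<tau>:{t..T}|lebesgue. E * Lip * (1 + norm (u \<tau>))))"
  proof (rule Gronwall_integrable_kernel[OF kernel_integrable[OF u] _ nc _ _ s])
    fix s assume s: "s \<in> {t..T}"
    let ?h = "\<lambda>\<tau>. S (s - \<tau>) (drift (X \<tau>) (u \<tau>) - drift (Y \<tau>) (u \<tau>))"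
    have us: "set_integrable lebesgue {t..s} u" by (rule set_integrable_subinterval[OF u]) (use s in auto)
    have h: "set_integrable lebesgue {t..s} ?h" by (rule Picard_diff(1)[OF Xc Yc u s])
    have "norm_m1 B (LINT \<tau>:{t..s}|lebesgue. ?h \<tau>) = norm (LINT \<tau>:{t..s}|lebesgue. sqrt_op B (?h \<tau>))"
      using integral_bounded_linear[OF blinfun.bounded_linear_right h[unfolded set_integrable_def], of "sqrt_op B"]
      by (simp add: set_lebesgue_integral_def blinfun.scaleR_right norm_m1_def)
    also have "\<dots> \<le> (LINT \<tau>:{t..s}|lebesgue. E * Lip * (1 + norm (u \<tau>)) * norm_m1 B (X \<tau> - Y \<tau>))"
    proof (rule norm_set_integral_le)
      show "set_integrable lebesgue {t..s} (\<lambda>\<tau>. sqrt_op B (?h \<tau>))"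
        using integrable_bounded_linear[OF blinfun.bounded_linear_right h[unfolded set_integrable_def], of "sqrt_op B"]
        by (simp add: set_integrable_def blinfun.scaleR_right)
      show "set_integrable lebesgue {t..s} (\<lambda>\<tau>. E * Lip * (1 + norm (u \<tau>)) * norm_m1 B (X \<tau> - Y \<tau>))"
        by (intro set_integrable_mult_continuous kernel_integrable us continuous_on_subset[OF nc]) (use s in auto)
      fix \<tau> assume \<tau>: "\<tau> \<in> {t..s}"
      let ?d = "drift (X \<tau>) (u \<tau>) - drift (Y \<tau>) (u \<tau>)"
      have "norm_m1 B (?h \<tau>) \<le> E * norm_m1 B ?d" using \<tau> s by (intro E) auto
      also have "\<dots> \<le> E * (norm (sqrt_op B) * (M * (1 + norm (u \<tau>)) * norm_m1 B (X \<tau> - Y \<tau>)))"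
        by (intro mult_left_mono order_trans[OF norm_m1_le] drift_diff E0) auto
      finally show "norm (sqrt_op B (?h \<tau>)) \<le> E * Lip * (1 + norm (u \<tau>)) * norm_m1 B (X \<tau> - Y \<tau>)"
        by (simp add: norm_m1_def Lip_def mult_ac)
    qed
    moreover have "norm_m1 B (S (s - t) (x - y)) \<le> E * norm_m1 B (x - y)" using s by (intro E) auto
    ultimately show "norm_m1 B (X s - Y s) \<le> E * norm_m1 B (x - y)
        + (LINT \<tau>:{t..s}|lebesgue. E * Lip * (1 + norm (u \<tau>)) * norm_m1 B (X \<tau> - Y \<tau>))"
      using Picard_diff(2)[OF Xc Yc u s, of x y] P[OF s]
        norm_m1_triangle[of B "S (s - t) (x - y)" "LINT \<tau>:{t..s}|lebesgue. ?h \<tau>"] by simp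
  qed (auto simp: E0 Lip_nonneg)
  moreover have "(LINT \<tau>:{t..T}|lebesgue. 1 + norm (u \<tau>)) = (T - t) + (LINT \<tau>:{t..T}|lebesgue. norm (u \<tau>))"
    using tT u by (simp add: set_integral_add set_integrable_norm set_integrable_continuous_interval
        set_integral_interval_const)
  ultimately show ?thesis by (simp add: E_def)
qed

text \<open>The displacement is measured from S(s - t)x and not from x: for x outside the domain of
  \<open>A\<close>, the difference of these two need not be of first order in s - t.\<close>

lemma mild_growth:
  assumes u: "set_integrable lebesgue {t..T} u" and tT: "t \<le> T"
    and X: "mild T t x u X" and s: "s \<in> {t..T}"
  shows "norm (X s) \<le> 2 * (norm x + M * (T - t) + M * (LINT \<tau>:{t..T}|lebesgue. norm (u \<tau>))) * exp (2 * (Lip * (T - t)))"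
    and "norm (X s - S (s - t) x) \<le> (LINT \<tau>:{t..s}|lebesgue. M + Lip * norm (X \<tau>) + M * norm (u \<tau>))"
proof -
  have Xc: "continuous_on {t..T} X" and P: "\<And>s. s \<in> {t..T} \<Longrightarrow> X s = Picard t x u X s"
    using X unfolding mild_iff_Picard[OF u] by auto
  have us: "set_integrable lebesgue {t..s} u" "set_integrable lebesgue {t..s} (\<lambda>\<tau>. norm (X \<tau>))" if "s \<in> {t..T}" for s
    using set_integrable_subinterval[OF u, of t s]
      set_integrable_subinterval[OF set_integrable_continuous_interval[OF continuous_on_norm[OF Xc]], of t s] that by auto
  have d: "norm (X s - S (s - t) x) \<le> (LINT \<tau>:{t..s}|lebesgue. M + Lip * norm (X \<tau>) + M * norm (u \<tau>))"
    if s: "s \<in> {t..T}" for s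
  proof -
    have "X s - S (s - t) x = (LINT \<tau>:{t..s}|lebesgue. S (s - \<tau>) (drift (X \<tau>) (u \<tau>)))"
      by (subst P[OF s]) (simp add: Picard_def)
    also have "norm \<dots> \<le> (LINT \<tau>:{t..s}|lebesgue. M + Lip * norm (X \<tau>) + M * norm (u \<tau>))"
      using s by (intro norm_set_integral_le set_integrable_S_self[OF set_integrable_drift[OF Xc u] s]
          order_trans[OF norm_S_le drift_growth] growth_integrable us(1) continuous_on_subset[OF Xc]) auto
    finally show ?thesis .
  qed
  show "norm (X s - S (s - t) x) \<le> (LINT \<tau>:{t..s}|lebesgue. M + Lip * norm (X \<tau>) + M * norm (u \<tau>))" by (rule d[OF s])
  let ?U = "LINT \<tau>:{t..T}|lebesgue. norm (u \<tau>)"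
  have U0: "0 \<le> ?U" unfolding set_lebesgue_integral_def by (intro integral_nonneg_AE AE_I2) auto
  have "norm (X s) \<le> 2 * (norm x + M * (T - t) + M * ?U) * exp (2 * (LINT \<tau>:{t..T}|lebesgue. Lip))"
  proof (rule Gronwall_integrable_kernel[OF _ _ _ _ _ s])
    fix s assume s: "s \<in> {t..T}"
    have "(LINT \<tau>:{t..s}|lebesgue. M + Lip * norm (X \<tau>) + M * norm (u \<tau>))
        = M * (s - t) + (LINT \<tau>:{t..s}|lebesgue. Lip * norm (X \<tau>)) + M * (LINT \<tau>:{t..s}|lebesgue. norm (u \<tau>))"
      using us[OF s] s by (simp add: set_integral_add set_integrable_norm set_integrable_continuous_interval
          set_integral_interval_const)
    also have "\<dots> \<le> M * (T - t) + (LINT \<tau>:{t..s}|lebesgue. Lip * norm (X \<tau>)) + M * ?U"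
      using s M u by (intro add_mono mult_left_mono order_refl set_integral_nonneg_mono set_integrable_norm) auto
    finally show "norm (X s) \<le> norm x + M * (T - t) + M * ?U + (LINT \<tau>:{t..s}|lebesgue. Lip * norm (X \<tau>))"
      using d[OF s] norm_triangle_sub[of "X s" "S (s - t) x"] norm_S_le[of "s - t" x] s by simp
  qed (use tT M U0 Lip_nonneg Xc in \<open>auto intro!: continuous_intros set_integrable_continuous_interval\<close>)
  then show "norm (X s) \<le> 2 * (norm x + M * (T - t) + M * ?U) * exp (2 * (Lip * (T - t)))"
    using tT by (simp add: set_integral_interval_const mult.commute)
qed

end

subsection \<open>The value function\<close>

text \<open>The modulus is the infimum of the affine bounds for d = 1/(n + 1). As an infimum of
  affine functions it is concave, hence continuous on the open half-line; at 0 the bounds themselves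
  give continuity.\<close>

lemma modulus_of_affine_bounds:
  fixes E :: "(real \<times> real) set"
  assumes lag: "\<And>a b. (a, b) \<in> E \<Longrightarrow> 0 \<le> b"
    and bound: "\<And>d. d > 0 \<Longrightarrow> \<exists>C\<ge>0. \<forall>(a, b)\<in>E. a \<le> d + C * b"
  shows "\<exists>\<omega>. is_modulus \<omega> \<and> (\<forall>(a, b)\<in>E. a \<le> \<omega> b)"
proof -
  have "\<forall>n. \<exists>C\<ge>0. \<forall>(a, b)\<in>E. a \<le> 1 / real (Suc n) + C * b" by (intro allI bound) simp
  from choice[OF this] obtain C where "\<forall>n. 0 \<le> C n \<and> (\<forall>(a, b)\<in>E. a \<le> 1 / real (Suc n) + C n * b)" by blast
  then have C: "\<And>n. C n \<ge> 0" "\<And>n a b. (a, b) \<in> E \<Longrightarrow> a \<le> 1 / real (Suc n) + C n * b" by blast+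
  define \<omega> where "\<omega> r = (INF n. 1 / real (Suc n) + C n * r)" for r
  have bdd: "bdd_below (range (\<lambda>n. 1 / real (Suc n) + C n * r))" if "0 \<le> r" for r
    using C(1) that by (intro bdd_belowI[of _ 0]) auto
  have le: "\<omega> r \<le> 1 / real (Suc n) + C n * r" if "0 \<le> r" for r n
    unfolding \<omega>_def by (rule cINF_lower[OF bdd[OF that]]) simp
  have ge: "c \<le> \<omega> r" if "\<And>n. c \<le> 1 / real (Suc n) + C n * r" for c r
    unfolding \<omega>_def using that by (intro cINF_greatest) auto
  have nonneg: "0 \<le> \<omega> r" if "0 \<le> r" for r using C(1) that by (intro ge) simp
  have mono: "\<omega> r \<le> \<omega> s" if "0 \<le> r" "r \<le> s" for r s
  proof (rule ge)
    fix n
    have "C n * r \<le> C n * s" by (intro mult_left_mono that C)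
    then show "\<omega> r \<le> 1 / real (Suc n) + C n * s" using le[OF that(1), of n] by linarith
  qed
  have zero: "\<omega> 0 = 0"
  proof (rule antisym[OF _ nonneg])
    have "(\<lambda>n. 1 / real (Suc n)) \<longlonglongrightarrow> 0" by (rule lim_1_over_n[THEN LIMSEQ_Suc])
    then show "\<omega> 0 \<le> 0" using le[of 0] by (intro LIMSEQ_le_const) auto
  qed simp
  have "isCont \<omega> r" if "r > 0" for r
  proof -
    have "convex_on {0<..} (\<lambda>r. - \<omega> r)"
    proof (rule convex_onI)
      fix t x y :: real assume t: "0 < t" "t < 1" and xy: "x \<in> {0<..}" "y \<in> {0<..}"
      have "(1 - t) * \<omega> x + t * \<omega> y \<le> \<omega> ((1 - t) * x + t * y)"
      proof (rule ge)
        fix n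
        have "(1 - t) * \<omega> x + t * \<omega> y \<le> (1 - t) * (1 / real (Suc n) + C n * x) + t * (1 / real (Suc n) + C n * y)"
          using t xy by (intro add_mono mult_left_mono le) auto
        also have "\<dots> = ((1 - t) + t) * (1 / real (Suc n)) + C n * ((1 - t) * x + t * y)"
          by (simp only: distrib_left distrib_right mult_ac add_ac)
        also have "\<dots> = 1 / real (Suc n) + C n * ((1 - t) * x + t * y)" by simp
        finally show "(1 - t) * \<omega> x + t * \<omega> y \<le> 1 / real (Suc n) + C n * ((1 - t) * x + t * y)" .
      qed
      then show "- \<omega> ((1 - t) *\<^sub>R x + t *\<^sub>R y) \<le> (1 - t) * - \<omega> x + t * - \<omega> y" by simp
    qed simp
    then have "continuous_on {0<..} (\<lambda>r. - \<omega> r)" by (intro convex_on_continuous) auto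
    then have "continuous_on {0<..} (\<lambda>r. - (- \<omega> r))" by (rule continuous_on_minus)
    then show ?thesis using that by (simp add: continuous_on_eq_continuous_at)
  qed
  moreover have "continuous (at 0 within {0..}) \<omega>"
    unfolding continuous_within_eps_delta
  proof (intro allI impI)
    fix e :: real assume e: "e > 0"
    then obtain n where n: "1 / real (Suc n) < e / 2" using reals_Archimedean[of "e/2"] by (auto simp: inverse_eq_divide)
    define d where "d = e / (2 * (C n + 1))"
    have "d > 0" using e C(1)[of n] by (simp add: d_def)
    moreover have "dist (\<omega> x) (\<omega> 0) < e" if x: "x \<in> {0..}" "dist x 0 < d" for x
    proof -
      have "C n * x \<le> (C n + 1) * d" using x C(1)[of n] \<open>d > 0\<close> by (intro mult_mono) (auto simp: dist_real_def)
      also have "\<dots> = e / 2" using C(1)[of n] by (simp add: d_def field_simps)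
      finally have "\<omega> x < e" using le[of x n] x n by simp
      then show ?thesis using nonneg[of x] x by (simp add: zero dist_real_def)
    qed
    ultimately show "\<exists>d>0. \<forall>x\<in>{0..}. dist x 0 < d \<longrightarrow> dist (\<omega> x) (\<omega> 0) < e" by blast
  qed
  ultimately have "continuous_on {0..} \<omega>"
    unfolding continuous_on_eq_continuous_within
    by (metis atLeast_iff continuous_at_imp_continuous_within less_eq_real_def)
  then have "is_modulus \<omega>" using mono nonneg zero by (auto simp: is_modulus_def mono_on_def)
  moreover have "a \<le> \<omega> b" if "(a, b) \<in> E" for a b using C(2)[OF that] by (rule ge)
  ultimately show ?thesis by blast
qed

text \<open>\<open>\<gamma>\<close> stands for the terminal payoff composed with the embedding into
  the completion, so that everything takes place in H and only its bound and its Lipschitz constant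
  for the weak norm remain.\<close>

locale control_problem = control_system domA A S B c0 F G M + exponential_levy \<nu>
  for domA :: "'a::{real_inner, banach, second_countable_topology} set"
    and A :: "'a \<Rightarrow> 'a" and S :: "real \<Rightarrow> 'a \<Rightarrow>\<^sub>L 'a" and B :: "'a \<Rightarrow>\<^sub>L 'a" and c0 :: real
    and F :: "'a \<Rightarrow> 'a" and G :: "'a \<Rightarrow> 'a \<Rightarrow>\<^sub>L 'a" and M :: real and \<nu> :: "'a measure" +
  fixes \<gamma> :: "'a \<Rightarrow> real" and C\<gamma> L\<gamma> T :: real
  assumes \<gamma>_bound: "\<And>x. \<bar>\<gamma> x\<bar> \<le> C\<gamma>"
    and \<gamma>_lip: "\<And>x y. \<bar>\<gamma> x - \<gamma> y\<bar> \<le> L\<gamma> * norm_m1 B (x - y)"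
    and L\<gamma>: "0 \<le> L\<gamma>"
    and T: "T > 0"
begin

definition v :: "real \<times> 'a \<Rightarrow> real" where
  "v = (\<lambda>(t, x). real_of_ereal (value_function \<nu> S F G \<gamma> T t x))"

abbreviation cost :: "real \<Rightarrow> real \<Rightarrow> (real \<Rightarrow> 'a) \<Rightarrow> real" where
  "cost r t u \<equiv> enn2real (running_cost \<nu> r t u)"

definition admissible :: "real \<Rightarrow> real \<Rightarrow> (real \<Rightarrow> 'a) \<Rightarrow> bool" where
  "admissible r t u \<longleftrightarrow> u \<in> controls r t \<and> running_cost \<nu> r t u < \<infinity>"

lemma admissible_integrable: "admissible r t u \<Longrightarrow> set_integrable lebesgue {t..r} u"
  using set_integrable_control by (simp add: admissible_def)

lemma C\<gamma>_nonneg: "0 \<le> C\<gamma>"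
  using \<gamma>_bound[of 0] by simp

lemma running_cost_const:
  assumes "L0 \<nu> u = ereal c" "t \<le> r"
  shows "admissible r t (\<lambda>_. u)" "cost r t (\<lambda>_. u) = c * (r - t)"
proof -
  have c: "0 \<le> c" using L0_nonneg[of u] assms by simp
  have eq: "running_cost \<nu> r t (\<lambda>_. u) = ennreal (c * (r - t))"
    unfolding running_cost_def using assms c by (simp add: nn_integral_cmult_indicator ennreal_mult)
  then show "admissible r t (\<lambda>_. u)" by (simp add: admissible_def controls_def set_borel_measurable_continuous)
  show "cost r t (\<lambda>_. u) = c * (r - t)" unfolding eq using c assms by (intro enn2real_ennreal) simp
qed

lemma admissible_split:
  assumes "admissible b t u" "t \<le> r" "r \<le> b"
  shows "admissible r t u" "admissible b r u" "cost b t u = cost r t u + cost b r u"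
proof -
  have u: "u \<in> controls b t" and fin: "running_cost \<nu> b t u < \<infinity>" using assms by (auto simp: admissible_def)
  note s = running_cost_split[OF u assms(2,3)]
  have fin': "running_cost \<nu> r t u < \<infinity>" "running_cost \<nu> b r u < \<infinity>"
    using fin unfolding s by auto
  then show "admissible r t u" "admissible b r u"
    using controls_subinterval[OF u] assms by (auto simp: admissible_def)
  show "cost b t u = cost r t u + cost b r u"
    unfolding s using fin' by (intro enn2real_plus) auto
qed

text \<open>Concatenated controls take the value of the first piece at the switching time, so the
  second piece is changed at that one point; the integrals do not see it.\<close>

lemma mild_drop_point:
  assumes u: "set_integrable lebesgue {t..r} u" and w: "set_integrable lebesgue {t..r} w"
    and eq: "\<And>s. s \<in> {t..r} \<Longrightarrow> s \<noteq> c \<Longrightarrow> u s = w s" and X: "mild r t x u X"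
  shows "mild r t x w X"
proof -
  have Xc: "continuous_on {t..r} X" and P: "\<forall>s\<in>{t..r}. X s = Picard t x u X s"
    using X unfolding mild_iff_Picard[OF u] by auto
  have "Picard t x u X s = Picard t x w X s" if s: "s \<in> {t..r}" for s
  proof -
    have "AE \<tau> in lebesgue. \<tau> \<noteq> c" by (rule AE_I'[of "{c}"]) auto
    then have ae: "AE \<tau> in lebesgue. indicat_real {t..s} \<tau> *\<^sub>R S (s - \<tau>) (drift (X \<tau>) (u \<tau>))
        = indicat_real {t..s} \<tau> *\<^sub>R S (s - \<tau>) (drift (X \<tau>) (w \<tau>))"
      by eventually_elim (use eq s in \<open>auto simp: indicator_def\<close>)
    show ?thesis
      unfolding Picard_def set_lebesgue_integral_def
      using integral_cong_AE[OF _ _ ae] set_integrable_S_self[OF set_integrable_drift[OF Xc u] s]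
        set_integrable_S_self[OF set_integrable_drift[OF Xc w] s]
      by (simp add: set_integrable_def borel_measurable_integrable)
  qed
  then show ?thesis unfolding mild_iff_Picard[OF w] using Xc P by simp
qed

lemma payoff_admissible:
  assumes "admissible T t u" "mild T t x u X" "t \<le> T"
  shows "payoff \<nu> S F G \<gamma> T t x u = ereal (- cost T t u + \<gamma> (X T))"
proof -
  have "the_mild_solution S F G T t x u T = X T"
    by (rule mild_unique[OF admissible_integrable[OF assms(1)] the_mild_solution_mild[OF admissible_integrable[OF assms(1)] assms(3)] assms(2)])
       (use assms in auto)
  then show ?thesis using assms(1) by (auto simp: payoff_def admissible_def)
qed

lemma value_function_bounds:
  assumes "t \<le> T"
  shows "ereal (- C\<gamma>) \<le> value_function \<nu> S F G \<gamma> T t x" "value_function \<nu> S F G \<gamma> T t x \<le> ereal C\<gamma>"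
proof -
  note z = running_cost_const[OF L0_zero[unfolded zero_ereal_def] assms]
  obtain X where X: "mild T t x (\<lambda>_. 0) X" using mild_exists[OF admissible_integrable[OF z(1)] assms] by blast
  have "ereal (- C\<gamma>) \<le> payoff \<nu> S F G \<gamma> T t x (\<lambda>_. 0)"
    unfolding payoff_admissible[OF z(1) X assms] z(2) using \<gamma>_bound[of "X T"] by simp
  also have "\<dots> \<le> value_function \<nu> S F G \<gamma> T t x"
    unfolding value_function_def using z(1) by (intro SUP_upper) (simp add: admissible_def)
  finally show "ereal (- C\<gamma>) \<le> value_function \<nu> S F G \<gamma> T t x" .
  show "value_function \<nu> S F G \<gamma> T t x \<le> ereal C\<gamma>"
    unfolding value_function_def
  proof (rule SUP_least)
    fix u
    have "- enn2real (running_cost \<nu> T t u) + \<gamma> y \<le> C\<gamma>" for y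
      using \<gamma>_bound[of y] enn2real_nonneg[of "running_cost \<nu> T t u"] by linarith
    then show "payoff \<nu> S F G \<gamma> T t x u \<le> ereal C\<gamma>" by (simp add: payoff_def)
  qed
qed

lemma ereal_v:
  assumes "t \<le> T"
  shows "ereal (v (t, x)) = value_function \<nu> S F G \<gamma> T t x"
  using value_function_bounds[OF assms, of x] by (cases "value_function \<nu> S F G \<gamma> T t x") (auto simp: v_def)

lemma v_bounded:
  assumes "t \<le> T"
  shows "\<bar>v (t, x)\<bar> \<le> C\<gamma>"
  using value_function_bounds[OF assms, of x] unfolding ereal_v[OF assms, symmetric] by simp

lemma v_ge:
  assumes "admissible T t u" "mild T t x u X" "t \<le> T"
  shows "- cost T t u + \<gamma> (X T) \<le> v (t, x)"
proof -
  have "payoff \<nu> S F G \<gamma> T t x u \<le> value_function \<nu> S F G \<gamma> T t x"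
    unfolding value_function_def using assms(1) by (intro SUP_upper) (simp add: admissible_def)
  then show ?thesis unfolding payoff_admissible[OF assms] ereal_v[OF assms(3), symmetric] by simp
qed

text \<open>The bound on the cost is free: the value is at least -\<open>C\<gamma>\<close> and the
  terminal payoff at most \<open>C\<gamma>\<close>, so an e-optimal control cannot spend more. It
  does not depend on the initial state.\<close>

lemma v_approx:
  assumes "t \<le> T" "e > 0"
  obtains u X where "admissible T t u" "mild T t x u X" "v (t, x) \<le> - cost T t u + \<gamma> (X T) + e"
    "cost T t u \<le> 2 * C\<gamma> + e"
proof -
  have "ereal (v (t, x) - e) < value_function \<nu> S F G \<gamma> T t x"
    unfolding ereal_v[OF assms(1), symmetric] using assms by simp
  then obtain u where u: "u \<in> controls T t" "ereal (v (t, x) - e) < payoff \<nu> S F G \<gamma> T t x u"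
    unfolding value_function_def less_SUP_iff by blast
  then have adm: "admissible T t u" by (auto simp: admissible_def payoff_def less_top split: if_splits)
  obtain X where X: "mild T t x u X" using mild_exists[OF admissible_integrable[OF adm] assms(1)] by blast
  have "v (t, x) - e < - cost T t u + \<gamma> (X T)" using u(2) unfolding payoff_admissible[OF adm X assms(1)] by simp
  then show ?thesis using that[OF adm X] v_bounded[OF assms(1), of x] \<gamma>_bound[of "X T"] by linarith
qed

lemma v_terminal: "v (T, x) = \<gamma> x"
proof (rule antisym)
  have Xx: "X T = x" if "mild T T x u X" for u X using mild_initial[OF that] by simp
  show "v (T, x) \<le> \<gamma> x"
  proof (rule field_le_epsilon)
    fix e :: real assume "e > 0"
    then obtain u X where X: "mild T T x u X" and "v (T, x) \<le> - cost T T u + \<gamma> (X T) + e"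
      using v_approx[OF order_refl \<open>e > 0\<close>] by blast
    then show "v (T, x) \<le> \<gamma> x + e" using Xx[OF X] enn2real_nonneg[of "running_cost \<nu> T T u"] by (simp del: enn2real_nonneg)
  qed
  note z = running_cost_const[OF L0_zero[unfolded zero_ereal_def] order_refl[of T]]
  obtain X where X: "mild T T x (\<lambda>_. 0) X" using mild_exists[OF admissible_integrable[OF z(1)]] by blast
  show "\<gamma> x \<le> v (T, x)" using v_ge[OF z(1) X] z(2) Xx[OF X] by simp
qed

definition Umax :: real where "Umax = 2 * C\<gamma> + 1 + Hmax 1 * T"

lemma integral_control_le_Umax:
  assumes "admissible r t u" "cost r t u \<le> 2 * C\<gamma> + 1" "0 \<le> t" "t \<le> r" "r \<le> T"
  shows "(LINT s:{t..r}|lebesgue. norm (u s)) \<le> Umax"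
proof -
  have "1 * (LINT s:{t..r}|lebesgue. norm (u s)) \<le> cost r t u + Hmax 1 * (r - t)"
    using assms by (intro integral_norm_control_le) (auto simp: admissible_def)
  also have "\<dots> \<le> Umax" unfolding Umax_def using assms Hmax_nonneg[of 1] by (intro add_mono mult_left_mono) auto
  finally show ?thesis by simp
qed

lemma Umax_nonneg: "0 \<le> Umax"
  using C\<gamma>_nonneg Hmax_nonneg[of 1] T by (simp add: Umax_def)

definition D1 :: real where
  "D1 = L\<gamma> * (2 * exp (c0 * T) * exp (2 * (exp (c0 * T) * Lip * (T + Umax))))"

lemma D1_nonneg: "0 \<le> D1"
  using L\<gamma> by (simp add: D1_def)

text \<open>A control that is nearly optimal from x is used from y as well. The costs agree, and the
  terminal states are compared in the weak norm with a constant that involves the control only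
  through \<open>Umax\<close>.\<close>

lemma v_lipschitz:
  assumes t: "t \<in> {0..T}"
  shows "v (t, x) \<le> v (t, y) + D1 * norm_m1 B (x - y)"
proof (rule field_le_epsilon)
  fix e :: real assume "e > 0"
  have tT: "t \<le> T" using t by simp
  \<comment> \<open>Precision at most 1 keeps the cost below 2 \<open>C\<gamma>\<close> + 1, the
    level for which \<open>Umax\<close> is defined.\<close>
  have "min e 1 > 0" using \<open>e > 0\<close> by simp
  then obtain u X where u: "admissible T t u" and X: "mild T t x u X"
    and ap: "v (t, x) \<le> - cost T t u + \<gamma> (X T) + min e 1" "cost T t u \<le> 2 * C\<gamma> + min e 1"
    using v_approx[OF tT] by blast
  note ui = admissible_integrable[OF u]
  obtain Y where Y: "mild T t y u Y" using mild_exists[OF ui tT] by blast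
  let ?U = "LINT s:{t..T}|lebesgue. norm (u s)"
  have U: "?U \<le> Umax" using integral_control_le_Umax[OF u] ap(2) t by simp
  have U0: "0 \<le> ?U" unfolding set_lebesgue_integral_def by (intro integral_nonneg_AE AE_I2) auto
  have E: "exp (c0 * (T - t)) \<le> exp (c0 * T)" using c0 t by (simp add: mult_left_mono)
  have "norm_m1 B (X T - Y T) \<le> 2 * (exp (c0 * (T - t)) * norm_m1 B (x - y))
      * exp (2 * (exp (c0 * (T - t)) * Lip * ((T - t) + ?U)))"
    using tT by (intro mild_weak_dependence[OF ui tT X Y]) auto
  also have "\<dots> \<le> 2 * (exp (c0 * T) * norm_m1 B (x - y)) * exp (2 * (exp (c0 * T) * Lip * (T + Umax)))"
    by (intro mult_mono exp_le_cancel_iff[THEN iffD2] E add_mono U mult_nonneg_nonneg order_refl Lip_nonneg add_nonneg_nonneg)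
       (use t U0 in auto)
  finally have "L\<gamma> * norm_m1 B (X T - Y T) \<le> L\<gamma> * (2 * (exp (c0 * T) * norm_m1 B (x - y)) * exp (2 * (exp (c0 * T) * Lip * (T + Umax))))"
    by (intro mult_left_mono L\<gamma>)
  also have "\<dots> = D1 * norm_m1 B (x - y)" by (simp add: D1_def)
  finally have "\<gamma> (X T) \<le> \<gamma> (Y T) + D1 * norm_m1 B (x - y)" using \<gamma>_lip[of "X T" "Y T"] by linarith
  then show "v (t, x) \<le> v (t, y) + D1 * norm_m1 B (x - y) + e"
    using ap(1) v_ge[OF u Y tT] by simp
qed

section \<open>Dynamic programming\<close>

text \<open>The tail of a nearly optimal control competes at (r, X r), and its initial piece
  inherits the bound on the cost.\<close>

lemma v_dpp_le:
  assumes "t \<le> r" "r \<le> T" "0 < e" "e \<le> 1"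
  obtains u X where "admissible r t u" "mild r t x u X" "cost r t u \<le> 2 * C\<gamma> + 1"
    "v (t, x) \<le> - cost r t u + v (r, X r) + e"
proof -
  have "t \<le> T" using assms by simp
  from v_approx[OF this assms(3)] obtain u X where u: "admissible T t u" and X: "mild T t x u X"
    and ap: "v (t, x) \<le> - cost T t u + \<gamma> (X T) + e" "cost T t u \<le> 2 * C\<gamma> + e" by blast
  note s = admissible_split[OF u assms(1,2)]
  have "mild T r (X r) u X"
    by (rule mild_restrict_right[OF X _ admissible_integrable[OF u]]) (use assms in auto)
  from v_ge[OF s(2) this assms(2)] have "v (t, x) \<le> - cost r t u + v (r, X r) + e" using ap s(3) by simp
  moreover have "cost r t u \<le> 2 * C\<gamma> + 1" using ap(2) s(3) assms(4) enn2real_nonneg[of "running_cost \<nu> T r u"] by linarith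
  ultimately show ?thesis using that s(1) mild_restrict_left[OF X assms(2)] by blast
qed

text \<open>A given control up to r is followed by a nearly optimal one from X r; uniqueness of mild
  solutions identifies the concatenated trajectory with the two pieces.\<close>

lemma v_dpp_ge:
  assumes r: "t \<le> r" "r \<le> T" and u: "admissible r t u" and X: "mild r t x u X"
  shows "- cost r t u + v (r, X r) \<le> v (t, x)"
proof (rule field_le_epsilon)
  fix e :: real assume "e > 0"
  obtain w Z where w: "admissible T r w" and Z: "mild T r (X r) w Z"
    and ap: "v (r, X r) \<le> - cost T r w + \<gamma> (Z T) + e" using v_approx[OF r(2) \<open>e > 0\<close>] by blast
  define c where "c s = (if s \<le> r then u s else w s)" for s
  have cu: "c s = u s" if "s \<in> {t..r}" for s using that by (simp add: c_def)
  have cw: "w s = c s" if "s \<in> {r..T}" "s \<noteq> r" for s using that by (auto simp: c_def)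
  have "set_borel_measurable lebesgue {t..T} c"
  proof -
    have "(\<lambda>s. indicat_real {t..T} s *\<^sub>R c s) = (\<lambda>s. indicat_real {t..r} s *\<^sub>R u s + indicat_real {r<..T} s *\<^sub>R w s)"
      using r by (auto simp: c_def indicator_def fun_eq_iff)
    moreover have "set_borel_measurable lebesgue {r<..T} w"
      by (rule set_borel_measurable_subset[of _ "{r..T}"]) (use w in \<open>auto simp: admissible_def controls_def\<close>)
    ultimately show ?thesis
      using u by (auto simp: set_borel_measurable_def admissible_def controls_def intro!: borel_measurable_add)
  qed
  then have cc: "c \<in> controls T t" by (simp add: controls_def)
  have rc1: "running_cost \<nu> r t c = running_cost \<nu> r t u"
    unfolding running_cost_def using cu by (intro nn_integral_cong) (simp add: indicator_def)
  have "AE s in lebesgue. s \<noteq> r" by (rule AE_I'[of "{r}"]) auto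
  then have rc2: "running_cost \<nu> T r c = running_cost \<nu> T r w"
    unfolding running_cost_def using cw
    by (intro nn_integral_cong_AE, elim eventually_mono) (auto simp: indicator_def)
  have cadm: "admissible T t c"
    using cc running_cost_split[OF cc r] rc1 rc2 u w by (simp add: admissible_def)
  note s = admissible_split[OF cadm r]
  have tT: "t \<le> T" using r by simp
  obtain Y where Y: "mild T t x c Y" using mild_exists[OF admissible_integrable[OF cadm] tT] by blast
  have "mild r t x c X" using X cu by (subst mild_cong[of t r X X c u]) auto
  then have Yr: "Y r = X r"
    using mild_unique[OF admissible_integrable[OF s(1)] mild_restrict_left[OF Y r(2)]] r by simp
  have Y2: "mild T r (X r) c Y"
    using mild_restrict_right[OF Y _ admissible_integrable[OF cadm], of r] r Yr by simp
  have "mild T r (X r) c Z"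
    by (rule mild_drop_point[OF admissible_integrable[OF w] admissible_integrable[OF s(2)] cw Z])
  then have "Y T = Z T" using mild_unique[OF admissible_integrable[OF s(2)] Y2] r by simp
  then show "- cost r t u + v (r, X r) \<le> v (t, x) + e"
    using v_ge[OF cadm Y tT] ap s(3) rc1 rc2 by simp
qed

section \<open>Regularity in time\<close>

lemma displacement:
  fixes R :: real
  obtains N where "N \<ge> 0" "\<And>t r x u X. 0 \<le> t \<Longrightarrow> t \<le> r \<Longrightarrow> r \<le> T \<Longrightarrow> norm x \<le> R \<Longrightarrow> admissible r t u \<Longrightarrow>
    cost r t u \<le> 2 * C\<gamma> + 1 \<Longrightarrow> mild r t x u X \<Longrightarrow>
    norm (X r - S (r - t) x) \<le> N * ((r - t) + (LINT s:{t..r}|lebesgue. norm (u s)))"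
\<comment> \<open>For negative \<open>R\<close> no state satisfies the bound; the case is split off
  so that \<open>Q\<close> below is nonnegative.\<close>
proof (cases "0 \<le> R")
  case False
  then have "\<not> norm x \<le> R" for x :: 'a using norm_ge_zero[of x] by linarith
  then show ?thesis using that[of 0] by blast
next
  case R: True
  define Q where "Q = 2 * (R + M * T + M * Umax) * exp (2 * (Lip * T))"
  have Q0: "0 \<le> Q" using R M T Umax_nonneg by (simp add: Q_def)
  show ?thesis
  proof (rule that[of "M + Lip * Q"])
    fix t r x u X
    assume t: "0 \<le> t" "t \<le> r" "r \<le> T" and x: "norm x \<le> R" and u: "admissible r t u"
      and cost: "cost r t u \<le> 2 * C\<gamma> + 1" and X: "mild r t x u X"
    note ui = admissible_integrable[OF u]
    let ?U = "LINT s:{t..r}|lebesgue. norm (u s)"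
    have U: "?U \<le> Umax" by (rule integral_control_le_Umax[OF u cost t])
    have U0: "0 \<le> ?U" unfolding set_lebesgue_integral_def by (intro integral_nonneg_AE AE_I2) auto
    have Xc: "continuous_on {t..r} X" using X by (simp add: mild_solution_def)
    have XQ: "norm (X s) \<le> Q" if "s \<in> {t..r}" for s
    proof (rule order_trans[OF mild_growth(1)[OF ui t(2) X that]])
      show "2 * (norm x + M * (r - t) + M * ?U) * exp (2 * (Lip * (r - t))) \<le> Q"
        unfolding Q_def using t x U U0 M Lip_nonneg R
        by (intro mult_mono add_mono exp_le_cancel_iff[THEN iffD2] mult_nonneg_nonneg add_nonneg_nonneg) auto
    qed
    have "norm (X r - S (r - t) x) \<le> (LINT s:{t..r}|lebesgue. M + Lip * norm (X s) + M * norm (u s))"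
      using t by (intro mild_growth(2)[OF ui t(2) X]) auto
    also have "\<dots> \<le> (LINT s:{t..r}|lebesgue. (M + Lip * Q) * (1 + norm (u s)))"
    proof (intro set_integral_mono growth_integrable Xc ui kernel_integrable)
      fix s assume "s \<in> {t..r}"
      then have "Lip * norm (X s) \<le> Lip * Q" by (intro mult_left_mono XQ Lip_nonneg)
      moreover have "0 \<le> Lip * Q * norm (u s)" using Lip_nonneg Q0 by simp
      ultimately show "M + Lip * norm (X s) + M * norm (u s) \<le> (M + Lip * Q) * (1 + norm (u s))"
        by (simp add: algebra_simps)
    qed
    also have "\<dots> = (M + Lip * Q) * ((r - t) + ?U)"
      using t ui by (simp add: set_integral_add set_integrable_norm set_integrable_continuous_interval set_integral_interval_const)
    finally show "norm (X r - S (r - t) x) \<le> (M + Lip * Q) * ((r - t) + ?U)" .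
  qed (use M Lip_nonneg Q0 in auto)
qed

text \<open>Uniform integrability in the form used later. The multiplier \<open>P\<close> is chosen
  so that the maximal cost divided by \<open>P\<close> is exactly d.\<close>

lemma integral_control_affine_bound:
  fixes d :: real
  assumes d: "d > 0"
  obtains C where "C \<ge> 0" "\<And>t r u. t \<le> r \<Longrightarrow> admissible r t u \<Longrightarrow> cost r t u \<le> 2 * C\<gamma> + 1 \<Longrightarrow>
    (LINT s:{t..r}|lebesgue. norm (u s)) \<le> d + C * (r - t)"
proof -
  define P where "P = (2 * C\<gamma> + 1) / d"
  have P: "P > 0" using d C\<gamma>_nonneg by (simp add: P_def)
  show ?thesis
  proof (rule that[of "Hmax P / P"])
    fix t r u assume t: "t \<le> r" and u: "admissible r t u" "cost r t u \<le> 2 * C\<gamma> + 1"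
    let ?U = "LINT s:{t..r}|lebesgue. norm (u s)"
    have "P * ?U \<le> cost r t u + Hmax P * (r - t)"
      using u P t by (intro integral_norm_control_le) (auto simp: admissible_def)
    then have "P * ?U \<le> (2 * C\<gamma> + 1) + Hmax P * (r - t)" using u by simp
    then have "?U \<le> ((2 * C\<gamma> + 1) + Hmax P * (r - t)) / P" using P by (simp add: pos_le_divide_eq mult.commute)
    also have "\<dots> = (2 * C\<gamma> + 1) / P + Hmax P / P * (r - t)" by (simp add: add_divide_distrib)
    also have "(2 * C\<gamma> + 1) / P = d" using d C\<gamma>_nonneg by (simp add: P_def)
    finally show "?U \<le> d + Hmax P / P * (r - t)" .
  qed (use P Hmax_nonneg in auto)
qed

text \<open>The displacement splits into X r - S(r - t)x, controlled by the integral of |u|, and S(r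
  - t)x - x, of order 1/2 in the weak norm. Neither is linear in r - t, but each is affine with a
  constant term as small as desired.\<close>

lemma v_time_affine_bound:
  fixes R d :: real
  assumes d: "d > 0"
  shows "\<exists>C\<ge>0. \<forall>t r x. 0 \<le> t \<longrightarrow> t \<le> r \<longrightarrow> r \<le> T \<longrightarrow> norm x \<le> R \<longrightarrow> \<bar>v (t, x) - v (r, x)\<bar> \<le> d + C * (r - t)"
proof -
  obtain N where N: "N \<ge> 0" and disp: "\<And>t r x u X. 0 \<le> t \<Longrightarrow> t \<le> r \<Longrightarrow> r \<le> T \<Longrightarrow> norm x \<le> R \<Longrightarrow> admissible r t u \<Longrightarrow>
    cost r t u \<le> 2 * C\<gamma> + 1 \<Longrightarrow> mild r t x u X \<Longrightarrow>
    norm (X r - S (r - t) x) \<le> N * ((r - t) + (LINT s:{t..r}|lebesgue. norm (u s)))"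
    using displacement[of R] by blast
  obtain K where K: "K \<ge> 0" "\<And>r x. 0 \<le> r \<Longrightarrow> norm_m1 B (S r x - x) \<le> K * sqrt r * norm x"
    using norm_m1_S_diff_le by blast
  define k where "k = D1 * K * \<bar>R\<bar>"
  have k: "k \<ge> 0" using D1_nonneg K by (simp add: k_def)
  define n where "n = D1 * norm (sqrt_op B) * N"
  have n: "n \<ge> 0" using D1_nonneg N by (simp add: n_def)
  \<comment> \<open>\<open>a\<close> and \<open>b\<close> give each of the two parts the constant
    term d/2; the summand 1 guards against a zero coefficient.\<close>
  define a where "a = d / (2 * (k + 1))"
  have a: "a > 0" using d k by (simp add: a_def)
  define b where "b = d / (2 * (n + 1))"
  have b: "b > 0" using d n by (simp add: b_def)
  obtain Cu where Cu: "Cu \<ge> 0" "\<And>t r u. t \<le> r \<Longrightarrow> admissible r t u \<Longrightarrow> cost r t u \<le> 2 * C\<gamma> + 1 \<Longrightarrow>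
    (LINT s:{t..r}|lebesgue. norm (u s)) \<le> b + Cu * (r - t)"
    using integral_control_affine_bound[OF b] by blast
  define C where "C = k / a + n * (1 + Cu)"
  have C0: "C \<ge> 0" using k n a Cu by (simp add: C_def)
  have est: "D1 * norm_m1 B (X r - x) \<le> d + C * (r - t)"
    if t: "0 \<le> t" "t \<le> r" "r \<le> T" and x: "norm x \<le> R" and u: "admissible r t u" "cost r t u \<le> 2 * C\<gamma> + 1"
      and X: "mild r t x u X" for t r x u X
  proof -
    let ?U = "LINT s:{t..r}|lebesgue. norm (u s)"
    \<comment> \<open>Young's inequality replaces the square root by an affine function whose
      constant term is \<open>a\<close>.\<close>
    have "0 \<le> (sqrt (r - t) - a)\<^sup>2" by simp
    then have "2 * (a * sqrt (r - t)) \<le> a\<^sup>2 + (r - t)" using t by (simp add: power2_diff mult.commute mult.left_commute add.commute)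
    moreover have "0 \<le> a * sqrt (r - t)" using a t by simp
    moreover have "a * (a + (r - t) / a) = a\<^sup>2 + (r - t)" using a by (simp add: power2_eq_square distrib_left)
    ultimately have "a * sqrt (r - t) \<le> a * (a + (r - t) / a)" by linarith
    then have sq: "sqrt (r - t) \<le> a + (r - t) / a" using a by simp
    have "norm_m1 B (S (r - t) x - x) \<le> K * sqrt (r - t) * norm x" using t by (intro K) simp
    also have "\<dots> \<le> K * sqrt (r - t) * \<bar>R\<bar>" using x K(1) t by (intro mult_left_mono) auto
    finally have "D1 * norm_m1 B (S (r - t) x - x) \<le> D1 * (K * sqrt (r - t) * \<bar>R\<bar>)" by (intro mult_left_mono D1_nonneg)
    also have "\<dots> = k * sqrt (r - t)" by (simp add: k_def)
    also have "\<dots> \<le> k * (a + (r - t) / a)" by (intro mult_left_mono sq k)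
    also have "\<dots> \<le> d / 2 + k / a * (r - t)"
    proof -
      have "k * a \<le> (k + 1) * a" using a by simp
      also have "\<dots> = d / 2" using k by (simp add: a_def field_simps)
      finally show ?thesis by (simp add: distrib_left)
    qed
    finally have 1: "D1 * norm_m1 B (S (r - t) x - x) \<le> d / 2 + k / a * (r - t)" .
    have "norm (X r - S (r - t) x) \<le> N * ((r - t) + ?U)" by (rule disp[OF t x u X])
    also have "\<dots> \<le> N * ((r - t) + (b + Cu * (r - t)))" using Cu(2)[OF t(2) u] by (intro mult_left_mono add_left_mono N)
    finally have "norm_m1 B (X r - S (r - t) x) \<le> norm (sqrt_op B) * (N * ((r - t) + (b + Cu * (r - t))))"
      by (intro order_trans[OF norm_m1_le] mult_left_mono) auto
    then have "D1 * norm_m1 B (X r - S (r - t) x) \<le> D1 * (norm (sqrt_op B) * (N * ((r - t) + (b + Cu * (r - t)))))"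
      by (intro mult_left_mono D1_nonneg)
    also have "\<dots> = n * b + n * (1 + Cu) * (r - t)" by (simp add: n_def algebra_simps)
    also have "\<dots> \<le> d / 2 + n * (1 + Cu) * (r - t)"
    proof -
      have "n * b \<le> (n + 1) * b" using b by simp
      also have "\<dots> = d / 2" using n by (simp add: b_def field_simps)
      finally show ?thesis by simp
    qed
    finally have 2: "D1 * norm_m1 B (X r - S (r - t) x) \<le> d / 2 + n * (1 + Cu) * (r - t)" .
    have "norm_m1 B (X r - x) \<le> norm_m1 B (X r - S (r - t) x) + norm_m1 B (S (r - t) x - x)"
      using norm_m1_triangle[of B "X r - S (r - t) x" "S (r - t) x - x"] by simp
    then have "D1 * norm_m1 B (X r - x) \<le> D1 * norm_m1 B (X r - S (r - t) x) + D1 * norm_m1 B (S (r - t) x - x)"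
      using mult_left_mono[OF _ D1_nonneg] by (simp flip: distrib_left)
    then show ?thesis using 1 2 unfolding C_def distrib_right by linarith
  qed
  have "\<bar>v (t, x) - v (r, x)\<bar> \<le> d + C * (r - t)"
    if t: "0 \<le> t" "t \<le> r" "r \<le> T" and x: "norm x \<le> R" for t r x
  proof -
    have "v (t, x) \<le> v (r, x) + (d + C * (r - t))"
    proof (rule field_le_epsilon)
      fix e :: real assume "e > 0"
      then obtain u X where u: "admissible r t u" "mild r t x u X" "cost r t u \<le> 2 * C\<gamma> + 1"
        "v (t, x) \<le> - cost r t u + v (r, X r) + min e 1"
        using v_dpp_le[of t r "min e 1" x] t by auto
      have "v (r, X r) \<le> v (r, x) + D1 * norm_m1 B (X r - x)" using t by (intro v_lipschitz) auto
      then show "v (t, x) \<le> v (r, x) + (d + C * (r - t)) + e"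
        using u(4) est[OF t x u(1,3,2)] enn2real_nonneg[of "running_cost \<nu> r t u"] by linarith
    qed
    moreover have "v (r, x) \<le> v (t, x) + (d + C * (r - t))"
    proof -
      \<comment> \<open>The lower bound on v(t, x) uses the zero control, which has zero
        cost.\<close>
      note z = running_cost_const[OF L0_zero[unfolded zero_ereal_def] t(2)]
      obtain X where X: "mild r t x (\<lambda>_. 0) X" using mild_exists[OF admissible_integrable[OF z(1)] t(2)] by blast
      have "v (r, X r) \<le> v (t, x)" using v_dpp_ge[OF t(2,3) z(1) X] z(2) by simp
      moreover have "v (r, x) \<le> v (r, X r) + D1 * norm_m1 B (x - X r)" using t by (intro v_lipschitz) auto
      moreover have "norm_m1 B (x - X r) = norm_m1 B (X r - x)"
        unfolding norm_m1_def by (simp add: blinfun.diff_right norm_minus_commute)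
      ultimately show ?thesis using est[OF t x z(1) _ X] z(2) C\<gamma>_nonneg by simp
    qed
    ultimately show ?thesis by simp
  qed
  then show ?thesis using C0 by blast
qed

lemma v_modulus:
  shows "\<exists>\<omega>. is_modulus \<omega> \<and> (\<forall>x y. norm x \<le> R \<longrightarrow> norm y \<le> R \<longrightarrow> (\<forall>t\<in>{0..T}. \<forall>s\<in>{0..T}.
    \<bar>v (t, x) - v (s, y)\<bar> \<le> D1 * norm_m1 B (x - y) + \<omega> \<bar>t - s\<bar>))"
proof -
  define E where "E = {(\<bar>v (t, x) - v (s, x)\<bar>, \<bar>t - s\<bar>) |t s x. t \<in> {0..T} \<and> s \<in> {0..T} \<and> norm x \<le> R}"
  have "\<exists>\<omega>. is_modulus \<omega> \<and> (\<forall>(a, b)\<in>E. a \<le> \<omega> b)"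
  proof (rule modulus_of_affine_bounds)
    fix d :: real assume "d > 0"
    then obtain C where C: "C \<ge> 0" "\<And>t r x. 0 \<le> t \<Longrightarrow> t \<le> r \<Longrightarrow> r \<le> T \<Longrightarrow> norm x \<le> R \<Longrightarrow> \<bar>v (t, x) - v (r, x)\<bar> \<le> d + C * (r - t)"
      using v_time_affine_bound by blast
    have "\<bar>v (t, x) - v (s, x)\<bar> \<le> d + C * \<bar>t - s\<bar>" if "t \<in> {0..T}" "s \<in> {0..T}" "norm x \<le> R" for t s x
      using C(2)[of t s x] C(2)[of s t x] that by (cases "t \<le> s") (auto simp: abs_minus_commute)
    then show "\<exists>C\<ge>0. \<forall>(a, b)\<in>E. a \<le> d + C * b" using C(1) by (intro exI[of _ C]) (auto simp: E_def)
  qed (auto simp: E_def)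
  then obtain \<omega> where \<omega>: "is_modulus \<omega>" "\<And>a b. (a, b) \<in> E \<Longrightarrow> a \<le> \<omega> b" by blast
  have "\<bar>v (t, x) - v (s, y)\<bar> \<le> D1 * norm_m1 B (x - y) + \<omega> \<bar>t - s\<bar>"
    if "norm x \<le> R" "norm y \<le> R" "t \<in> {0..T}" "s \<in> {0..T}" for t s x y
  proof -
    have "\<bar>v (t, y) - v (s, y)\<bar> \<le> \<omega> \<bar>t - s\<bar>" using that by (intro \<omega>(2)) (auto simp: E_def)
    moreover have "norm_m1 B (y - x) = norm_m1 B (x - y)"
      unfolding norm_m1_def by (simp add: blinfun.diff_right norm_minus_commute)
    ultimately show ?thesis using v_lipschitz[OF that(3), of x y] v_lipschitz[OF that(3), of y x] by simp
  qed
  then show ?thesis using \<omega>(1) by blast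
qed

end

subsection \<open>Test functions\<close>

lemma GDERIV_unique:
  assumes "GDERIV f x :> p" "GDERIV f x :> q"
  shows "p = q"
proof (rule eq_of_inner_eq)
  fix y
  have "(\<lambda>h. h \<bullet> p) = (\<lambda>h. h \<bullet> q)" using assms unfolding gderiv_def by (rule has_derivative_unique)
  then show "y \<bullet> p = y \<bullet> q" by (rule fun_cong)
qed

lemma space_grad_eqI: "GDERIV (\<lambda>y. \<phi> (t, y)) x :> p \<Longrightarrow> space_grad \<phi> (t, x) = p"
  unfolding space_grad_def by (auto intro: the_equality GDERIV_unique)

lemma isContD_norm:
  fixes f :: "'a::metric_space \<Rightarrow> 'b::real_normed_vector"
  assumes "isCont f z" "e > 0"
  shows "\<exists>d>0. \<forall>w. dist w z < d \<longrightarrow> norm (f w - f z) < e"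
  using assms unfolding continuous_at_eps_delta dist_norm[of "f _"] by blast

text \<open>The gradient exists as a vector by Riesz representation of the partial derivative, so
  the description in \<open>space_grad\<close> denotes it.\<close>

lemma differentiable_partials:
  fixes \<phi> :: "real \<times> 'a::{real_inner, banach} \<Rightarrow> real"
  assumes "\<phi> differentiable (at (t, x))"
  shows "GDERIV (\<lambda>y. \<phi> (t, y)) x :> space_grad \<phi> (t, x)"
    "((\<lambda>s. \<phi> (s, x)) has_real_derivative time_deriv \<phi> (t, x)) (at t)"
proof -
  obtain \<phi>' where \<phi>': "(\<phi> has_derivative \<phi>') (at (t, x))" using assms by (auto simp: differentiable_def)
  have sp: "((\<lambda>y. \<phi> (t, y)) has_derivative (\<lambda>h. \<phi>' (0, h))) (at x)"
    by (rule has_derivative_compose[of "\<lambda>y. (t, y)" "\<lambda>h. (0, h)", OF _ \<phi>']) (auto intro!: derivative_eq_intros)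
  then obtain p where "\<forall>h. \<phi>' (0, h) = h \<bullet> p" using Riesz_representation[OF has_derivative_bounded_linear] by blast
  then have "GDERIV (\<lambda>y. \<phi> (t, y)) x :> p" using sp by (simp add: gderiv_def)
  then show "GDERIV (\<lambda>y. \<phi> (t, y)) x :> space_grad \<phi> (t, x)" using space_grad_eqI by metis
  have tm: "((\<lambda>s. \<phi> (s, x)) has_derivative (\<lambda>h. \<phi>' (h, 0))) (at t)"
    by (rule has_derivative_compose[of "\<lambda>s. (s, x)" "\<lambda>h. (h, 0)", OF _ \<phi>']) (auto intro!: derivative_eq_intros)
  then have "(\<lambda>s. \<phi> (s, x)) differentiable (at t)" by (auto simp: differentiable_def)
  then have "DERIV (\<lambda>s. \<phi> (s, x)) t :> deriv (\<lambda>s. \<phi> (s, x)) t" by (simp add: DERIV_deriv_iff_real_differentiable)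
  then show "((\<lambda>s. \<phi> (s, x)) has_real_derivative time_deriv \<phi> (t, x)) (at t)" by (simp add: time_deriv_def)
qed

text \<open>The norm is not differentiable at the origin, but h'(0) = 0 makes the composition flat
  there, and \<open>sgn 0 = 0\<close> lets one formula cover both cases.\<close>

lemma GDERIV_radial:
  fixes x :: "'a::real_inner"
  assumes h: "\<And>r. r \<ge> 0 \<Longrightarrow> (h has_real_derivative h' r) (at r within {0..})" and h0: "h' 0 = 0"
  shows "GDERIV (\<lambda>y. h (norm y)) x :> h' (norm x) *\<^sub>R sgn x"
proof (cases "x = 0")
  case False
  then have "at (norm x) within {0..} = at (norm x)" by (intro at_within_interior) simp
  then have "DERIV h (norm x) :> h' (norm x)" using h[of "norm x"] by simp
  then show ?thesis using GDERIV_DERIV_compose[OF GDERIV_norm[OF False]] by blast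
next
  case True
  have "(h has_derivative (*) 0) (at 0 within {0..})" using h[of 0] h0 by (simp add: has_field_derivative_def)
  then have d: "\<forall>e>0. \<exists>d>0. \<forall>y\<in>{0..}. norm (y - 0) < d \<longrightarrow> norm (h y - h 0 - 0 * (y - 0)) \<le> e * norm (y - 0)"
    unfolding has_derivative_within_alt by blast
  have "((\<lambda>y. h (norm y)) has_derivative (\<lambda>k. 0)) (at x)"
    unfolding has_derivative_within_alt
  proof (intro conjI allI impI bounded_linear_zero)
    fix e :: real assume "e > 0"
    with d obtain \<delta> where \<delta>: "\<delta> > 0"
      "\<forall>y\<in>{0..}. norm (y - 0) < \<delta> \<longrightarrow> norm (h y - h 0 - 0 * (y - 0)) \<le> e * norm (y - 0)" by blast
    have "\<bar>h r - h 0\<bar> \<le> e * r" if "r \<ge> 0" "r < \<delta>" for r using bspec[OF \<delta>(2), of r] that by simp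
    with \<delta>(1) show "\<exists>d>0. \<forall>y\<in>UNIV. norm (y - x) < d \<longrightarrow> norm (h (norm y) - h (norm x) - 0) \<le> e * norm (y - x)"
      using True by (intro exI[of _ \<delta>]) auto
  qed
  then show ?thesis using True by (simp add: gderiv_def)
qed

text \<open>The slope is taken at a radius \<xi> and the direction at a point y because the mean
  value theorem in the radial variable supplies \<xi> independently of y. At the origin
  \<open>sgn\<close> jumps, but the slope tends to 0.\<close>

lemma radial_gradient_continuous:
  fixes x :: "'a::real_inner"
  assumes cont: "continuous_on {0..} h'" and h0: "h' 0 = 0" and e: "e > 0"
  shows "\<exists>d>0. \<forall>\<xi> y. 0 \<le> \<xi> \<longrightarrow> \<bar>\<xi> - norm x\<bar> < d \<longrightarrow> norm (y - x) < d \<longrightarrow>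
    norm (h' \<xi> *\<^sub>R sgn y - h' (norm x) *\<^sub>R sgn x) < e"
proof -
  have "continuous (at (norm x) within {0..}) h'"
    using cont by (auto simp: continuous_on_eq_continuous_within)
  then have hc: "\<exists>d>0. \<forall>\<xi>. 0 \<le> \<xi> \<longrightarrow> \<bar>\<xi> - norm x\<bar> < d \<longrightarrow> \<bar>h' \<xi> - h' (norm x)\<bar> < c" if "c > 0" for c
  proof -
    obtain d where "d > 0" "\<forall>\<xi>\<in>{0..}. dist \<xi> (norm x) < d \<longrightarrow> dist (h' \<xi>) (h' (norm x)) < c"
      using \<open>continuous _ h'\<close> \<open>c > 0\<close> unfolding continuous_within_eps_delta by blast
    then show ?thesis by (intro exI[of _ d]) (simp add: dist_real_def)
  qed
  have ns: "norm (sgn y) \<le> 1" for y :: 'a by (simp add: norm_sgn)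
  show ?thesis
  proof (cases "x = 0")
    case True
    obtain d where d: "d > 0" "\<And>\<xi>. 0 \<le> \<xi> \<Longrightarrow> \<bar>\<xi> - norm x\<bar> < d \<Longrightarrow> \<bar>h' \<xi> - h' (norm x)\<bar> < e" using hc[OF e] by blast
    have "norm (h' \<xi> *\<^sub>R sgn y) < e" if "0 \<le> \<xi>" "\<bar>\<xi> - norm x\<bar> < d" for \<xi> and y :: 'a
    proof -
      have "norm (h' \<xi> *\<^sub>R sgn y) \<le> \<bar>h' \<xi>\<bar> * 1" unfolding norm_scaleR by (intro mult_left_mono ns) simp
      then show ?thesis using d(2)[OF that] True h0 by simp
    qed
    then show ?thesis using d(1) True by (intro exI[of _ d]) auto
  next
    case False
    define c where "c = e / (2 * (\<bar>h' (norm x)\<bar> + 1))"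
    have c: "c > 0" using e by (simp add: c_def)
    have "isCont sgn x" by (rule isCont_sgn) (use False in auto)
    from isContD_norm[OF this c] obtain d1 where d1: "d1 > 0" "\<And>y. norm (y - x) < d1 \<Longrightarrow> norm (sgn y - sgn x) < c"
      unfolding dist_norm by blast
    obtain d2 where d2: "d2 > 0" "\<And>\<xi>. 0 \<le> \<xi> \<Longrightarrow> \<bar>\<xi> - norm x\<bar> < d2 \<Longrightarrow> \<bar>h' \<xi> - h' (norm x)\<bar> < e / 2"
      using hc[of "e / 2"] e by auto
    have "norm (h' \<xi> *\<^sub>R sgn y - h' (norm x) *\<^sub>R sgn x) < e"
      if \<xi>: "0 \<le> \<xi>" "\<bar>\<xi> - norm x\<bar> < min d1 d2" and y: "norm (y - x) < min d1 d2" for \<xi> y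
    proof -
      have "h' \<xi> *\<^sub>R sgn y - h' (norm x) *\<^sub>R sgn x = (h' \<xi> - h' (norm x)) *\<^sub>R sgn y + h' (norm x) *\<^sub>R (sgn y - sgn x)"
        by (simp add: algebra_simps)
      also have "norm \<dots> \<le> \<bar>h' \<xi> - h' (norm x)\<bar> * 1 + \<bar>h' (norm x)\<bar> * c"
        unfolding norm_scaleR[symmetric] using d1(2)[of y] y
        by (intro norm_triangle_mono) (auto intro!: mult_left_mono mult_left_le ns)
      also have "\<bar>h' (norm x)\<bar> * c \<le> (\<bar>h' (norm x)\<bar> + 1) * c" using c by simp
      also have "(\<bar>h' (norm x)\<bar> + 1) * c = e / 2" by (simp add: c_def field_simps)
      finally show ?thesis using d2(2)[of \<xi>] \<xi> by simp
    qed
    then show ?thesis using d1(1) d2(1) by (intro exI[of _ "min d1 d2"]) auto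
  qed
qed

lemma radial_mean_value:
  assumes h: "\<And>r. r \<ge> 0 \<Longrightarrow> (h has_real_derivative h' r) (at r within {0..})"
    and ab: "0 \<le> a" "0 \<le> b"
  shows "\<exists>\<xi>\<in>{min a b..max a b}. h a - h b = h' \<xi> * (a - b)"
proof -
  have *: "\<exists>\<xi>\<in>{a..b}. h b - h a = h' \<xi> * (b - a)" if "0 \<le> a" "a \<le> b" for a b
  proof (rule mvt_very_simple[OF that(2), of h "\<lambda>r k. h' r * k"])
    fix r assume "a \<le> r" "r \<le> b"
    then have "(h has_real_derivative h' r) (at r within {a..b})"
      using that by (intro DERIV_subset[OF h]) auto
    then show "(h has_derivative (\<lambda>k. h' r * k)) (at r within {a..b})" unfolding has_field_derivative_def .
  qed
  show ?thesis
  proof (cases "a \<le> b")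
    case True
    obtain \<xi> where "\<xi> \<in> {a..b}" "h b - h a = h' \<xi> * (b - a)" using *[OF ab(1) True] by blast
    moreover from this have "h a - h b = h' \<xi> * (a - b)" by (simp add: algebra_simps)
    ultimately show ?thesis using True by (intro bexI[of _ \<xi>]) auto
  next
    case False
    then show ?thesis using *[OF ab(2), of a] by (auto simp: min_def max_def)
  qed
qed

context generated_contraction
begin

text \<open>Only one mean value step in space is needed: the gradient at the intermediate point lies in the domain
  of the adjoint, so that the semigroup part of the increment is of first order in \<open>\<epsilon>\<close> although
  \<open>x\<close> need not lie in the domain of \<open>A\<close>.\<close>

lemma test_function_expansion:
  fixes x :: 'a
  assumes \<phi>: "test_phi domA A B T \<phi>" and t: "t \<in> {0<..<T}"
    and h: "\<And>r. r \<ge> 0 \<Longrightarrow> (h has_real_derivative h' r) (at r within {0..})"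
    and h': "continuous_on {0..} h'" "h' 0 = 0" "\<And>r. r \<ge> 0 \<Longrightarrow> 0 \<le> h' r"
    and \<eta>: "\<eta> > 0"
  defines "p \<equiv> space_grad \<phi> (t, x)"
  defines "P \<equiv> p + h' (norm x) *\<^sub>R sgn x"
  shows "\<exists>\<delta>>0. \<forall>\<epsilon> y. 0 < \<epsilon> \<longrightarrow> \<epsilon> < \<delta> \<longrightarrow> norm (y - x) < \<delta> \<longrightarrow> t + \<epsilon> < T \<and> (\<exists>\<pi>. norm (\<pi> - P) < \<eta> \<and>
    \<phi> (t + \<epsilon>, y) - \<phi> (t, x) + (h (norm y) - h (norm x))
      \<le> \<epsilon> * (time_deriv \<phi> (t, x) - x \<bullet> adj_op domA A p + \<eta>) + \<pi> \<bullet> (y - S \<epsilon> x))"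
proof -
  let ?\<Omega> = "{0<..<T} \<times> (UNIV :: 'a set)"
  have op: "open ?\<Omega>" by (intro open_Times) auto
  have tx: "(t, x) \<in> ?\<Omega>" using t by simp
  have diff: "\<phi> differentiable (at z)" if "z \<in> ?\<Omega>" for z using \<phi> that by (auto simp: test_phi_def C1_on_cylinder_def)
  have adm: "space_grad \<phi> z \<in> adj_domain domA A" if "z \<in> ?\<Omega>" for z using \<phi> that by (auto simp: test_phi_def)
  have c1: "isCont (time_deriv \<phi>) (t, x)" "isCont (space_grad \<phi>) (t, x)"
    using \<phi> tx op by (auto simp: test_phi_def C1_on_cylinder_def continuous_on_eq_continuous_at)
  \<comment> \<open>Test functions are regular on slabs away from the time boundary; this slab has t
    in its interior, so the adjoint of \<open>A\<close> applied to the gradient is continuous at (t,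
    x).\<close>
  define \<theta> where "\<theta> = min t (T - t) / 2"
  have \<theta>: "\<theta> > 0" "\<theta> < t" "t < T - \<theta>" using t by (auto simp: \<theta>_def min_def field_simps)
  have "continuous_on ({\<theta>..T - \<theta>} \<times> UNIV) (\<lambda>z. adj_op domA A (space_grad \<phi> z))"
    using \<phi> \<theta> by (auto simp: test_phi_def intro: uniformly_continuous_imp_continuous)
  then have "continuous_on ({\<theta><..<T - \<theta>} \<times> UNIV) (\<lambda>z. adj_op domA A (space_grad \<phi> z))"
    by (rule continuous_on_subset) auto
  moreover have "open ({\<theta><..<T - \<theta>} \<times> (UNIV :: 'a set))" by (intro open_Times) auto
  ultimately have c2: "isCont (\<lambda>z. adj_op domA A (space_grad \<phi> z)) (t, x)"
    using \<theta> by (auto simp: continuous_on_eq_continuous_at)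
  define a where "a = adj_op domA A p"
  \<comment> \<open>The two errors in T2 are at most \<open>\<kappa>\<close> (norm a + 1) and
    \<open>\<kappa>\<close> norm x, and must add up to \<eta>/2; the cap 1 gives the bound norm a +
    1 for the adjoint at the nearby gradient.\<close>
  define \<kappa> where "\<kappa> = min 1 (\<eta> / (2 * (norm a + 1 + norm x)))"
  have den: "norm a + 1 + norm x > 0" using norm_ge_zero[of a] norm_ge_zero[of x] by linarith
  have \<kappa>: "\<kappa> > 0" "\<kappa> \<le> 1" using den \<eta> by (auto simp: \<kappa>_def)
  have \<kappa>\<eta>: "\<kappa> * (norm a + 1 + norm x) \<le> \<eta> / 2"
  proof -
    have "\<kappa> * (norm a + 1 + norm x) \<le> \<eta> / (2 * (norm a + 1 + norm x)) * (norm a + 1 + norm x)"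
      using den by (intro mult_right_mono) (auto simp: \<kappa>_def)
    also have "\<dots> = \<eta> / 2" using den by (simp add: field_simps)
    finally show ?thesis .
  qed
  obtain d1 where d1: "d1 > 0" "\<And>z. dist z (t, x) < d1 \<Longrightarrow> \<bar>time_deriv \<phi> z - time_deriv \<phi> (t, x)\<bar> < \<eta> / 2"
    using isContD_norm[OF c1(1), of "\<eta> / 2"] \<eta> by auto
  obtain d2 where d2: "d2 > 0" "\<And>z. dist z (t, x) < d2 \<Longrightarrow> norm (space_grad \<phi> z - p) < \<eta> / 2"
    using isContD_norm[OF c1(2), of "\<eta> / 2"] \<eta> unfolding p_def by auto
  obtain d3 where d3: "d3 > 0" "\<And>z. dist z (t, x) < d3 \<Longrightarrow> norm (adj_op domA A (space_grad \<phi> z) - a) < \<kappa>"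
    using isContD_norm[OF c2 \<kappa>(1)] unfolding a_def p_def by blast
  obtain d4 where d4: "d4 > 0" "\<And>r. 0 \<le> r \<Longrightarrow> r < d4 \<Longrightarrow> norm (S r x - x) < \<kappa>"
    using S_near_id[OF \<kappa>(1)] by blast
  obtain d5 where d5: "d5 > 0" "\<And>\<xi> y. 0 \<le> \<xi> \<Longrightarrow> \<bar>\<xi> - norm x\<bar> < d5 \<Longrightarrow> norm (y - x) < d5 \<Longrightarrow>
    norm (h' \<xi> *\<^sub>R sgn y - h' (norm x) *\<^sub>R sgn x) < \<eta> / 2"
    using radial_gradient_continuous[OF h'(1,2), of "\<eta> / 2" x] \<eta> by auto
  obtain d6 where d6: "d6 > 0" "\<And>r. 0 \<le> r \<Longrightarrow> r < d6 \<Longrightarrow> norm (S r x - x) < d5"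
    using S_near_id[OF d5(1)] by blast
  \<comment> \<open>Time and space each move by less than \<delta>, so the distance in the product
    is below 2 \<delta>; hence the halved radii.\<close>
  define \<delta> where "\<delta> = min (min (min d1 d2 / 2) (min d3 d4 / 2)) (min (min d5 d6) (T - t))"
  have \<delta>: "\<delta> > 0" "2 * \<delta> \<le> d1" "2 * \<delta> \<le> d2" "2 * \<delta> \<le> d3" "\<delta> \<le> d4" "\<delta> \<le> d5" "\<delta> \<le> d6" "\<delta> \<le> T - t"
    using d1(1) d2(1) d3(1) d4(1) d5(1) d6(1) t by (auto simp: \<delta>_def min_def)
  have "t + \<epsilon> < T \<and> (\<exists>\<pi>. norm (\<pi> - P) < \<eta> \<and>
    \<phi> (t + \<epsilon>, y) - \<phi> (t, x) + (h (norm y) - h (norm x))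
      \<le> \<epsilon> * (time_deriv \<phi> (t, x) - x \<bullet> a + \<eta>) + \<pi> \<bullet> (y - S \<epsilon> x))"
    if \<epsilon>: "0 < \<epsilon>" "\<epsilon> < \<delta>" and y: "norm (y - x) < \<delta>" for \<epsilon> y
  proof -
    have te: "t + \<epsilon> < T" using \<epsilon> \<delta> by simp
    have near: "dist (s, z) (t, x) < 2 * \<delta>" if "\<bar>s - t\<bar> < \<delta>" "norm (z - x) < \<delta>" for s z
    proof -
      have "dist (s, z) (t, x) \<le> dist s t + dist z x"
        unfolding dist_Pair_Pair by (rule order_trans[OF sqrt_sum_squares_le_sum]) auto
      then show ?thesis using that by (simp add: dist_norm)
    qed
    obtain s where s: "t < s" "s < t + \<epsilon>" "\<phi> (t + \<epsilon>, x) - \<phi> (t, x) = (t + \<epsilon> - t) * time_deriv \<phi> (s, x)"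
      using MVT2[of t "t + \<epsilon>" "\<lambda>s. \<phi> (s, x)" "\<lambda>s. time_deriv \<phi> (s, x)"] \<epsilon> te t
        differentiable_partials(2)[OF diff] by auto
    have "dist (s, x) (t, x) < d1" using near[of s x] s \<epsilon> \<delta> by auto
    from d1(2)[OF this] have "time_deriv \<phi> (s, x) \<le> time_deriv \<phi> (t, x) + \<eta> / 2" by linarith
    then have T1: "\<phi> (t + \<epsilon>, x) - \<phi> (t, x) \<le> \<epsilon> * (time_deriv \<phi> (t, x) + \<eta> / 2)"
      using s(3) \<epsilon> by (simp add: mult_left_mono)
    define z where "z \<sigma> = x + \<sigma> *\<^sub>R (y - x)" for \<sigma> :: real
    have der: "((\<lambda>\<sigma>. \<phi> (t + \<epsilon>, z \<sigma>)) has_derivative (\<lambda>k. k * ((y - x) \<bullet> space_grad \<phi> (t + \<epsilon>, z \<sigma>)))) (at \<sigma> within {0..1})" for \<sigma>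
    proof -
      have "GDERIV (\<lambda>y. \<phi> (t + \<epsilon>, y)) (z \<sigma>) :> space_grad \<phi> (t + \<epsilon>, z \<sigma>)"
        by (rule differentiable_partials(1)[OF diff]) (use t te \<epsilon> in auto)
      then have g: "((\<lambda>y. \<phi> (t + \<epsilon>, y)) has_derivative (\<lambda>h. h \<bullet> space_grad \<phi> (t + \<epsilon>, z \<sigma>))) (at (z \<sigma>))"
        by (simp add: gderiv_def)
      have "(z has_derivative (\<lambda>k. k *\<^sub>R (y - x))) (at \<sigma> within {0..1})"
        unfolding z_def by (auto intro!: derivative_eq_intros)
      from has_derivative_compose[OF this g] show ?thesis by (simp only: inner_scaleR_left)
    qed
    obtain \<sigma> where \<sigma>: "\<sigma> \<in> {0..1}" "\<phi> (t + \<epsilon>, z 1) - \<phi> (t + \<epsilon>, z 0) = (1 - 0) * ((y - x) \<bullet> space_grad \<phi> (t + \<epsilon>, z \<sigma>))"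
      using mvt_very_simple[of 0 1 "\<lambda>\<sigma>. \<phi> (t + \<epsilon>, z \<sigma>)" "\<lambda>\<sigma> k. k * ((y - x) \<bullet> space_grad \<phi> (t + \<epsilon>, z \<sigma>))"] der by auto
    define q where "q = space_grad \<phi> (t + \<epsilon>, z \<sigma>)"
    have "norm (z \<sigma> - x) \<le> 1 * norm (y - x)" unfolding z_def using \<sigma>(1) by (auto intro!: mult_left_le_one_le)
    then have nz: "dist (t + \<epsilon>, z \<sigma>) (t, x) < 2 * \<delta>" using near[of "t + \<epsilon>" "z \<sigma>"] \<epsilon> y by simp
    have qp: "norm (q - p) < \<eta> / 2" unfolding q_def using d2(2) nz \<delta> by simp
    have qa: "norm (adj_op domA A q - a) < \<kappa>" unfolding q_def using d3(2) nz \<delta> by simp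
    have "q \<in> adj_domain domA A" unfolding q_def using t te \<epsilon> by (intro adm) auto
    then obtain \<rho> where \<rho>: "\<rho> \<in> {0..\<epsilon>}" "(S \<epsilon> x - x) \<bullet> q = - \<epsilon> * (S \<rho> x \<bullet> adj_op domA A q)"
      using S_mean_value[of q \<epsilon> x] \<epsilon> by auto
    have T2: "(S \<epsilon> x - x) \<bullet> q \<le> \<epsilon> * (- (x \<bullet> a) + \<eta> / 2)"
    proof -
      have "x \<bullet> a - S \<rho> x \<bullet> adj_op domA A q = (x - S \<rho> x) \<bullet> adj_op domA A q + x \<bullet> (a - adj_op domA A q)"
        by (simp add: inner_diff_left inner_diff_right)
      also have "\<dots> \<le> norm (x - S \<rho> x) * norm (adj_op domA A q) + norm x * norm (a - adj_op domA A q)"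
        by (intro add_mono norm_cauchy_schwarz)
      also have "\<dots> \<le> \<kappa> * (norm a + 1) + norm x * \<kappa>"
      proof (intro add_mono mult_mono)
        show "norm (x - S \<rho> x) \<le> \<kappa>" using d4(2)[of \<rho>] \<rho>(1) \<epsilon> \<delta> by (simp add: norm_minus_commute)
        show "norm (adj_op domA A q) \<le> norm a + 1" using qa \<kappa> norm_triangle_sub[of "adj_op domA A q" a] by simp
        show "norm (a - adj_op domA A q) \<le> \<kappa>" using qa by (simp add: norm_minus_commute)
      qed (use \<kappa> in auto)
      also have "\<dots> \<le> \<eta> / 2" using \<kappa>\<eta> by (simp add: algebra_simps)
      finally have "- (S \<rho> x \<bullet> adj_op domA A q) \<le> - (x \<bullet> a) + \<eta> / 2" by simp
      then have "\<epsilon> * (- (S \<rho> x \<bullet> adj_op domA A q)) \<le> \<epsilon> * (- (x \<bullet> a) + \<eta> / 2)" using \<epsilon> by (intro mult_left_mono) auto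
      then show ?thesis using \<rho>(2) by simp
    qed
    have h1: "h (norm (S \<epsilon> x)) \<le> h (norm x)"
    proof -
      have le: "norm (S \<epsilon> x) \<le> norm x" using \<epsilon> by (intro norm_S_le) simp
      obtain \<zeta> where \<zeta>: "\<zeta> \<in> {min (norm x) (norm (S \<epsilon> x))..max (norm x) (norm (S \<epsilon> x))}"
        "h (norm x) - h (norm (S \<epsilon> x)) = h' \<zeta> * (norm x - norm (S \<epsilon> x))"
        using radial_mean_value[OF h norm_ge_zero norm_ge_zero] by blast
      have "0 \<le> \<zeta>" by (rule order_trans[of _ "min (norm x) (norm (S \<epsilon> x))"]) (use \<zeta>(1) in auto)
      then have "0 \<le> h' \<zeta> * (norm x - norm (S \<epsilon> x))" using le h'(3) by simp
      then show ?thesis using \<zeta>(2) by simp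
    qed
    obtain \<xi> where \<xi>: "\<xi> \<in> {min (norm y) (norm (S \<epsilon> x))..max (norm y) (norm (S \<epsilon> x))}"
      "h (norm y) - h (norm (S \<epsilon> x)) = h' \<xi> * (norm y - norm (S \<epsilon> x))"
      using radial_mean_value[OF h norm_ge_zero norm_ge_zero] by blast
    have \<xi>0: "0 \<le> \<xi>" by (rule order_trans[of _ "min (norm y) (norm (S \<epsilon> x))"]) (use \<xi>(1) in auto)
    have "\<bar>norm y - norm x\<bar> < d5" using norm_triangle_ineq3[of y x] y \<delta> by simp
    moreover have "\<bar>norm (S \<epsilon> x) - norm x\<bar> < d5" using norm_triangle_ineq3[of "S \<epsilon> x" x] d6(2)[of \<epsilon>] \<epsilon> \<delta> by simp
    ultimately have "\<bar>\<xi> - norm x\<bar> < d5" using \<xi>(1) by (auto simp: min_def max_def split: if_splits)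
    then have hq: "norm (h' \<xi> *\<^sub>R sgn y - h' (norm x) *\<^sub>R sgn x) < \<eta> / 2"
      using d5(2)[of \<xi> y] \<xi>0 y \<delta> by simp
    \<comment> \<open>The subgradient inequality of the norm at y; it also holds for y = 0, where
      \<open>sgn\<close> vanishes.\<close>
    have "norm y - norm (S \<epsilon> x) \<le> sgn y \<bullet> (y - S \<epsilon> x)"
    proof -
      have "sgn y \<bullet> y = norm y" by (cases "y = 0") (auto simp: sgn_div_norm dot_square_norm power2_eq_square)
      moreover have "sgn y \<bullet> S \<epsilon> x \<le> norm (S \<epsilon> x)"
        using norm_cauchy_schwarz[of "sgn y" "S \<epsilon> x"] by (cases "y = 0") (auto simp: norm_sgn)
      ultimately show ?thesis by (simp add: inner_diff_right)
    qed
    then have "h (norm y) - h (norm x) \<le> h' \<xi> * (sgn y \<bullet> (y - S \<epsilon> x))"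
      using \<xi>(2) h1 mult_left_mono[of "norm y - norm (S \<epsilon> x)" "sgn y \<bullet> (y - S \<epsilon> x)", OF _ h'(3)[OF \<xi>0]] by linarith
    then have T3: "h (norm y) - h (norm x) \<le> (h' \<xi> *\<^sub>R sgn y) \<bullet> (y - S \<epsilon> x)" by simp
    define \<pi> where "\<pi> = q + h' \<xi> *\<^sub>R sgn y"
    have "\<pi> - P = (q - p) + (h' \<xi> *\<^sub>R sgn y - h' (norm x) *\<^sub>R sgn x)" by (simp add: \<pi>_def P_def)
    then have "norm (\<pi> - P) < \<eta>" using qp hq norm_triangle_ineq[of "q - p" "h' \<xi> *\<^sub>R sgn y - h' (norm x) *\<^sub>R sgn x"] by simp
    moreover have "\<phi> (t + \<epsilon>, y) - \<phi> (t + \<epsilon>, x) = (y - S \<epsilon> x) \<bullet> q + (S \<epsilon> x - x) \<bullet> q"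
      using \<sigma>(2) by (simp add: z_def q_def flip: inner_add_left)
    then have "\<phi> (t + \<epsilon>, y) - \<phi> (t, x) + (h (norm y) - h (norm x))
      \<le> \<epsilon> * (time_deriv \<phi> (t, x) - x \<bullet> a + \<eta>) + \<pi> \<bullet> (y - S \<epsilon> x)"
      using T1 T2 T3 by (simp add: \<pi>_def inner_add_left inner_commute[of q] algebra_simps)
    ultimately show ?thesis using te by blast
  qed
  then show ?thesis using \<delta>(1) unfolding a_def by blast
qed

end

subsection \<open>The viscosity property\<close>

lemma nonneg_of_small_perturbation:
  fixes c k :: real
  assumes "\<And>\<kappa>. 0 < \<kappa> \<Longrightarrow> \<kappa> \<le> 1 \<Longrightarrow> 0 \<le> c + \<kappa> * k"
  shows "0 \<le> c"
proof -
  have "(\<lambda>n. c + 1 / real (Suc n) * k) \<longlonglongrightarrow> c + 0 * k"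
    by (intro tendsto_intros lim_1_over_n[THEN LIMSEQ_Suc])
  moreover have "0 \<le> c + 1 / real (Suc n) * k" for n by (rule assms) auto
  ultimately have "0 \<le> c + 0 * k" by (intro LIMSEQ_le_const) auto
  then show ?thesis by simp
qed

context control_problem
begin

section \<open>B-continuity and short-time estimates\<close>

text \<open>The squared weak norm of x_k - x is B(x_k - x) \<bullet> (x_k - x): the first factor
  tends to 0 in norm, and the second is bounded because the sequence converges weakly. The modulus
  for that bound then applies.\<close>

lemma v_B_tendsto:
  assumes ts: "\<And>k. ts k \<in> {0..T}" "t \<in> {0..T}" "ts \<longlonglongrightarrow> t"
    and w: "weakly_converges xs x" and Bx: "(\<lambda>k. B (xs k)) \<longlonglongrightarrow> B x"
  shows "(\<lambda>k. v (ts k, xs k)) \<longlonglongrightarrow> v (t, x)"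
proof -
  obtain C where C: "\<And>k. norm (xs k) \<le> C" using weakly_converges_bounded[OF w] by blast
  define R where "R = max C (norm x)"
  have R: "norm (xs k) \<le> R" "norm x \<le> R" for k using C[of k] by (auto simp: R_def)
  obtain \<omega> where \<omega>: "is_modulus \<omega>" and est: "\<And>x y t s. norm x \<le> R \<Longrightarrow> norm y \<le> R \<Longrightarrow> t \<in> {0..T} \<Longrightarrow> s \<in> {0..T} \<Longrightarrow>
    \<bar>v (t, x) - v (s, y)\<bar> \<le> D1 * norm_m1 B (x - y) + \<omega> \<bar>t - s\<bar>"
    using v_modulus[of R] by blast
  have "(\<lambda>k. (norm_m1 B (xs k - x))\<^sup>2) \<longlonglongrightarrow> 0"
  proof (rule Lim_null_comparison[of _ "\<lambda>k. norm (B (xs k) - B x) * (2 * R)"])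
    have "norm ((norm_m1 B (xs k - x))\<^sup>2) \<le> norm (B (xs k) - B x) * (2 * R)" for k
    proof -
      have "(norm_m1 B (xs k - x))\<^sup>2 = B (xs k - x) \<bullet> (xs k - x)" by (rule norm_m1_sq)
      also have "\<dots> \<le> norm (B (xs k - x)) * norm (xs k - x)" by (rule norm_cauchy_schwarz)
      also have "\<dots> \<le> norm (B (xs k) - B x) * (2 * R)"
        using norm_triangle_ineq4[of "xs k" x] R(1)[of k] R(2) by (intro mult_mono) (auto simp: blinfun.diff_right)
      finally show ?thesis by simp
    qed
    then show "\<forall>\<^sub>F k in sequentially. norm ((norm_m1 B (xs k - x))\<^sup>2) \<le> norm (B (xs k) - B x) * (2 * R)" by simp
    have "(\<lambda>k. norm (B (xs k) - B x) * (2 * R)) \<longlonglongrightarrow> norm (B x - B x) * (2 * R)" by (intro tendsto_intros Bx)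
    then show "(\<lambda>k. norm (B (xs k) - B x) * (2 * R)) \<longlonglongrightarrow> 0" by simp
  qed
  then have "(\<lambda>k. sqrt ((norm_m1 B (xs k - x))\<^sup>2)) \<longlonglongrightarrow> sqrt 0" by (rule tendsto_real_sqrt)
  then have n: "(\<lambda>k. norm_m1 B (xs k - x)) \<longlonglongrightarrow> 0" by simp
  have "(\<lambda>k. \<bar>ts k - t\<bar>) \<longlonglongrightarrow> \<bar>t - t\<bar>" by (intro tendsto_intros ts)
  then have "(\<lambda>k. \<omega> \<bar>ts k - t\<bar>) \<longlonglongrightarrow> \<omega> 0"
    using \<omega> unfolding is_modulus_def by (intro continuous_on_tendsto_compose[of "{0..}" \<omega>]) auto
  then have "(\<lambda>k. D1 * norm_m1 B (xs k - x) + \<omega> \<bar>ts k - t\<bar>) \<longlonglongrightarrow> D1 * 0 + \<omega> 0" by (intro tendsto_intros n)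
  then have lim: "(\<lambda>k. D1 * norm_m1 B (xs k - x) + \<omega> \<bar>ts k - t\<bar>) \<longlonglongrightarrow> 0" using \<omega> by (simp add: is_modulus_def)
  have "(\<lambda>k. v (ts k, xs k) - v (t, x)) \<longlonglongrightarrow> 0"
    by (rule Lim_null_comparison[OF _ lim]) (use est[OF R ts(1,2)] in simp)
  then show ?thesis by (rule LIM_zero_cancel)
qed

lemma v_semicontinuous:
  "B_usc B ({0<..<T} \<times> UNIV) v" "B_lsc B ({0<..<T} \<times> UNIV) v"
proof -
  have lim: "(\<lambda>k. ereal (v (ts k, xs k))) \<longlonglongrightarrow> ereal (v (t, x))"
    if "\<forall>k. (ts k, xs k) \<in> {0<..<T} \<times> UNIV" "(t, x) \<in> {0<..<T} \<times> UNIV" "ts \<longlonglongrightarrow> t"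
      "weakly_converges xs x" "(\<lambda>k. B (xs k)) \<longlonglongrightarrow> B x" for ts xs t x
    by (rule tendsto_ereal, rule v_B_tendsto[OF _ _ that(3-5)]) (use that(1,2) in \<open>auto simp: less_imp_le\<close>)
  show "B_usc B ({0<..<T} \<times> UNIV) v"
    unfolding B_usc_def
    by (intro allI impI, rule order_eq_refl, rule lim_imp_Limsup[OF trivial_limit_sequentially], rule lim)
  show "B_lsc B ({0<..<T} \<times> UNIV) v"
    unfolding B_lsc_def
    by (intro allI impI, rule order_eq_refl, rule lim_imp_Liminf[OF trivial_limit_sequentially, symmetric], rule lim)
qed

lemma v_locally_bounded: "locally_bounded_on ({0<..<T} \<times> UNIV) v"
  unfolding locally_bounded_on_def
proof (intro ballI exI[of _ UNIV] conjI)
  fix z :: "real \<times> 'a"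
  show "bounded (v ` (UNIV \<inter> {0<..<T} \<times> UNIV))"
    using v_bounded by (intro boundedI[of _ C\<gamma>]) auto
qed auto

text \<open>\<delta> is uniform over all controls of bounded cost. This is needed because the nearly
  optimal control is selected only after the time step \<epsilon> has been fixed.\<close>

lemma mild_uniformly_near:
  assumes t: "t \<in> {0..<T}" and d: "d > 0"
  shows "\<exists>\<delta>>0. \<forall>\<epsilon> u X. 0 < \<epsilon> \<longrightarrow> \<epsilon> < \<delta> \<longrightarrow> t + \<epsilon> \<le> T \<longrightarrow> admissible (t + \<epsilon>) t u \<longrightarrow>
    cost (t + \<epsilon>) t u \<le> 2 * C\<gamma> + 1 \<longrightarrow> mild (t + \<epsilon>) t x u X \<longrightarrow> (\<forall>s\<in>{t..t + \<epsilon>}. norm (X s - x) < d)"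
proof -
  obtain N where N: "N \<ge> 0" and disp: "\<And>t r u X. 0 \<le> t \<Longrightarrow> t \<le> r \<Longrightarrow> r \<le> T \<Longrightarrow> admissible r t u \<Longrightarrow>
    cost r t u \<le> 2 * C\<gamma> + 1 \<Longrightarrow> mild r t x u X \<Longrightarrow>
    norm (X r - S (r - t) x) \<le> N * ((r - t) + (LINT s:{t..r}|lebesgue. norm (u s)))"
    using displacement[of "norm x"] by (metis order_refl)
  define b where "b = d / (4 * (N + 1))"
  have b: "b > 0" using d N by (simp add: b_def)
  have Nb: "N * b \<le> d / 4"
  proof -
    have "N * b \<le> (N + 1) * b" using b by simp
    also have "\<dots> = d / 4" using N by (simp add: b_def field_simps)
    finally show ?thesis .
  qed
  obtain C where C: "C \<ge> 0" "\<And>t r u. t \<le> r \<Longrightarrow> admissible r t u \<Longrightarrow> cost r t u \<le> 2 * C\<gamma> + 1 \<Longrightarrow>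
    (LINT s:{t..r}|lebesgue. norm (u s)) \<le> b + C * (r - t)"
    using integral_control_affine_bound[OF b] by blast
  obtain d1 where d1: "d1 > 0" "\<And>r. 0 \<le> r \<Longrightarrow> r < d1 \<Longrightarrow> norm (S r x - x) < d / 2"
    using S_near_id[of "d / 2" x] d by auto
  define d2 where "d2 = d / (4 * (N * (1 + C) + 1))"
  have den: "N * (1 + C) + 1 > 0" using N C by (simp add: add_nonneg_pos)
  have d2: "d2 > 0" using d den by (simp add: d2_def)
  have "norm (X s - x) < d"
    if \<epsilon>: "0 < \<epsilon>" "\<epsilon> < min d1 d2" "t + \<epsilon> \<le> T" and u: "admissible (t + \<epsilon>) t u" "cost (t + \<epsilon>) t u \<le> 2 * C\<gamma> + 1"
      and X: "mild (t + \<epsilon>) t x u X" and s: "s \<in> {t..t + \<epsilon>}" for \<epsilon> u X s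
  proof -
    have ts: "t \<le> s" "s \<le> t + \<epsilon>" using s by auto
    note sp = admissible_split[OF u(1) ts]
    have cs: "cost s t u \<le> 2 * C\<gamma> + 1" using u(2) sp(3) enn2real_nonneg[of "running_cost \<nu> (t + \<epsilon>) s u"] by linarith
    have "norm (X s - S (s - t) x) \<le> N * ((s - t) + (LINT \<tau>:{t..s}|lebesgue. norm (u \<tau>)))"
      using t ts \<epsilon> by (intro disp sp(1) cs mild_restrict_left[OF X]) auto
    also have "\<dots> \<le> N * ((s - t) + (b + C * (s - t)))" using C(2)[OF ts(1) sp(1) cs] by (intro mult_left_mono add_left_mono N)
    also have "\<dots> = N * b + N * (1 + C) * (s - t)" by (simp add: algebra_simps)
    also have "N * (1 + C) * (s - t) \<le> (N * (1 + C) + 1) * d2"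
      using N C ts \<epsilon> by (intro mult_mono) auto
    also have "(N * (1 + C) + 1) * d2 = d / 4"
    proof -
      have "c * (d / (4 * c)) = d / 4" if "c > 0" for c :: real using that by simp
      from this[OF den] show ?thesis unfolding d2_def .
    qed
    finally have "norm (X s - S (s - t) x) \<le> d / 2" using Nb by simp
    moreover have "norm (S (s - t) x - x) < d / 2" using d1(2)[of "s - t"] ts \<epsilon> by simp
    ultimately show ?thesis using norm_triangle_ineq[of "X s - S (s - t) x" "S (s - t) x - x"] by simp
  qed
  then show ?thesis using d1(1) d2 by (intro exI[of _ "min d1 d2"]) auto
qed

lemma inner_displacement:
  assumes u: "set_integrable lebesgue {t..r} u" and X: "mild r t x u X" and tr: "t \<le> r"
  shows "set_integrable lebesgue {t..r} (\<lambda>\<tau>. \<pi> \<bullet> S (r - \<tau>) (drift (X \<tau>) (u \<tau>)))"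
    "\<pi> \<bullet> (X r - S (r - t) x) = (LINT \<tau>:{t..r}|lebesgue. \<pi> \<bullet> S (r - \<tau>) (drift (X \<tau>) (u \<tau>)))"
proof -
  have Xc: "continuous_on {t..r} X" and P: "\<And>s. s \<in> {t..r} \<Longrightarrow> X s = Picard t x u X s"
    using X unfolding mild_iff_Picard[OF u] by auto
  have i: "integrable lebesgue (\<lambda>\<tau>. indicat_real {t..r} \<tau> *\<^sub>R S (r - \<tau>) (drift (X \<tau>) (u \<tau>)))"
    using set_integrable_S_self[OF set_integrable_drift[OF Xc u], of r] tr by (simp add: set_integrable_def)
  show "set_integrable lebesgue {t..r} (\<lambda>\<tau>. \<pi> \<bullet> S (r - \<tau>) (drift (X \<tau>) (u \<tau>)))"
    using integrable_inner_right[OF i, of \<pi>] by (simp add: set_integrable_def)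
  have "X r - S (r - t) x = (LINT \<tau>:{t..r}|lebesgue. S (r - \<tau>) (drift (X \<tau>) (u \<tau>)))"
    using tr by (subst P) (auto simp: Picard_def)
  then show "\<pi> \<bullet> (X r - S (r - t) x) = (LINT \<tau>:{t..r}|lebesgue. \<pi> \<bullet> S (r - \<tau>) (drift (X \<tau>) (u \<tau>)))"
    using integral_inner_right[OF i, of \<pi>] by (simp add: set_lebesgue_integral_def)
qed

text \<open>The error is linear in \<open>\<kappa>\<close> with a constant built from a and P only.
  The supersolution argument applies it to the full drift under a constant control, the subsolution
  argument to F alone.\<close>

lemma drift_perturbation:
  assumes "norm (\<pi> - P) \<le> \<kappa>" "norm (f - a) \<le> \<kappa>" "norm (S r a - a) \<le> \<kappa>" "0 \<le> r" "\<kappa> \<le> 1"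
  shows "\<pi> \<bullet> S r f \<le> P \<bullet> a + \<kappa> * (norm a + 1 + 2 * norm P)"
proof -
  have k0: "0 \<le> \<kappa>" using assms(1) norm_ge_zero order_trans by blast
  have f: "norm (S r f) \<le> norm a + 1"
    using norm_S_le[OF assms(4), of f] norm_triangle_sub[of f a] assms(2,5) by linarith
  have g: "norm (S r f - a) \<le> 2 * \<kappa>"
    using norm_S_diff_le[OF assms(4), of f a] assms(2,3) norm_triangle_ineq[of "S r f - S r a" "S r a - a"] by simp
  have "\<pi> \<bullet> S r f - P \<bullet> a = (\<pi> - P) \<bullet> S r f + P \<bullet> (S r f - a)"
    by (simp add: inner_diff_left inner_diff_right)
  also have "\<dots> \<le> norm (\<pi> - P) * norm (S r f) + norm P * norm (S r f - a)" by (intro add_mono norm_cauchy_schwarz)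
  also have "\<dots> \<le> \<kappa> * (norm a + 1) + norm P * (2 * \<kappa>)" using f g assms(1) k0 by (intro add_mono mult_mono) auto
  finally show ?thesis by (simp add: algebra_simps)
qed

section \<open>The two viscosity inequalities\<close>

lemma v_supersolution: "viscosity_supersolution domA A B \<nu> F G T v"
  unfolding viscosity_supersolution_def
proof (intro conjI v_locally_bounded v_semicontinuous allI impI)
  fix \<phi> h t x
  assume \<phi>: "test_phi domA A B T \<phi>" and th: "test_h h" and t: "t \<in> {0<..<T}"
    and min: "\<forall>s\<in>{0<..<T}. \<forall>y. v (t, x) + \<phi> (t, x) + h (norm x) \<le> v (s, y) + \<phi> (s, y) + h (norm y)"
  from th obtain h' where h: "\<And>r. r \<ge> 0 \<Longrightarrow> (h has_real_derivative h' r) (at r within {0..})"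
    and h': "continuous_on {0..} h'" "h' 0 = 0" "\<And>r. r > 0 \<Longrightarrow> 0 \<le> h' r" unfolding test_h_def by blast
  have h'0: "0 \<le> h' r" if "r \<ge> 0" for r using h'(2,3) that by (cases "r = 0") auto
  have diff: "\<phi> differentiable (at (t, x))" using \<phi> t by (auto simp: test_phi_def C1_on_cylinder_def)
  define p where "p = space_grad \<phi> (t, x)"
  define P where "P = p + h' (norm x) *\<^sub>R sgn x"
  let ?\<psi> = "\<lambda>(s, y). - \<phi> (s, y) - h (norm y)"
  have "GDERIV (\<lambda>y. - \<phi> (t, y) - h (norm y)) x :> - p - h' (norm x) *\<^sub>R sgn x"
    unfolding p_def by (intro GDERIV_diff GDERIV_minus differentiable_partials(1)[OF diff] GDERIV_radial h h'(2))
  then have sg: "space_grad ?\<psi> (t, x) = - P" by (intro space_grad_eqI) (simp add: P_def)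
  have "((\<lambda>s. - \<phi> (s, x) - h (norm x)) has_real_derivative - time_deriv \<phi> (t, x)) (at t)"
    using differentiable_partials(2)[OF diff] by (auto intro!: derivative_eq_intros)
  then have td: "time_deriv ?\<psi> (t, x) = - time_deriv \<phi> (t, x)" by (simp add: time_deriv_def DERIV_imp_deriv)
  \<comment> \<open>The test function is -\<open>\<phi>\<close> - h, so its gradient is
    -\<open>P\<close>; this control turns Fenchel's inequality into an equality there.\<close>
  obtain u where u: "L0 \<nu> u = ereal (u \<bullet> adjoint (blinfun_apply (G x)) (- P) - H0 \<nu> (adjoint (blinfun_apply (G x)) (- P)))"
    using L0_gradient by blast
  define l where "l = u \<bullet> adjoint (blinfun_apply (G x)) (- P) - H0 \<nu> (adjoint (blinfun_apply (G x)) (- P))"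
  define a where "a = drift x u"
  have tT: "t \<le> T" using t by simp
  obtain X where X: "mild T t x (\<lambda>_. u) X"
    using mild_exists[OF admissible_integrable[OF running_cost_const(1)[OF u tT]] tT] by blast
  have X0: "X t = x" by (rule mild_initial[OF X tT])
  have "0 \<le> l + time_deriv \<phi> (t, x) - x \<bullet> adj_op domA A p + P \<bullet> a"
  proof (rule nonneg_of_small_perturbation)
    fix \<kappa> :: real assume \<kappa>: "0 < \<kappa>" "\<kappa> \<le> 1"
    obtain d1 where d1: "d1 > 0" and expand: "\<And>\<epsilon> y. 0 < \<epsilon> \<Longrightarrow> \<epsilon> < d1 \<Longrightarrow> norm (y - x) < d1 \<Longrightarrow> t + \<epsilon> < T \<and> (\<exists>\<pi>. norm (\<pi> - P) < \<kappa> \<and>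
      \<phi> (t + \<epsilon>, y) - \<phi> (t, x) + (h (norm y) - h (norm x))
      \<le> \<epsilon> * (time_deriv \<phi> (t, x) - x \<bullet> adj_op domA A p + \<kappa>) + \<pi> \<bullet> (y - S \<epsilon> x))"
      using test_function_expansion[OF \<phi> t h h'(1,2) h'0 \<kappa>(1), of x] unfolding P_def p_def by blast
    obtain d2 where d2: "d2 > 0" "\<And>r. 0 \<le> r \<Longrightarrow> r < d2 \<Longrightarrow> norm (S r a - a) < \<kappa>" using S_near_id[OF \<kappa>(1)] by blast
    \<comment> \<open>The first radius admits the expansion of the test function; the second keeps
      the drift within \<open>\<kappa>\<close> of its value at x.\<close>
    define q where "q = min d1 (\<kappa> / (Lip * (1 + norm u) + 1))"
    have den: "Lip * (1 + norm u) + 1 > 0" using Lip_nonneg by (simp add: add_nonneg_pos)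
    have q: "q > 0" using d1 \<kappa> den by (simp add: q_def)
    have "continuous_on {t..T} X" using X by (simp add: mild_solution_def)
    then obtain d3 where d3: "d3 > 0" "\<And>s. s \<in> {t..T} \<Longrightarrow> dist s t < d3 \<Longrightarrow> dist (X s) (X t) < q"
      using tT q unfolding continuous_on_iff by (metis atLeastAtMost_iff order_refl)
    define \<epsilon> where "\<epsilon> = min (min d1 d2) (min d3 (T - t)) / 2"
    have \<epsilon>: "0 < \<epsilon>" "\<epsilon> < d1" "\<epsilon> < d2" "\<epsilon> < d3" "t + \<epsilon> < T" using d1 d2(1) d3(1) t by (auto simp: \<epsilon>_def min_def field_simps)
    let ?r = "t + \<epsilon>"
    have Xq: "norm (X s - x) < q" if "s \<in> {t..?r}" for s
      using d3(2)[of s] that \<epsilon> X0 by (auto simp: dist_norm)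
    note rc = running_cost_const[OF u, of t ?r, folded l_def]
    have adm: "admissible ?r t (\<lambda>_. u)" and co: "cost ?r t (\<lambda>_. u) = l * \<epsilon>" using rc \<epsilon> by auto
    have Xr: "mild ?r t x (\<lambda>_. u) X" using mild_restrict_left[OF X] \<epsilon> by simp
    have "norm (X ?r - x) < d1" using Xq[of ?r] \<epsilon> by (simp add: q_def)
    from expand[OF \<epsilon>(1,2) this] obtain \<pi> where \<pi>: "norm (\<pi> - P) < \<kappa>"
      and ex: "\<phi> (?r, X ?r) - \<phi> (t, x) + (h (norm (X ?r)) - h (norm x))
        \<le> \<epsilon> * (time_deriv \<phi> (t, x) - x \<bullet> adj_op domA A p + \<kappa>) + \<pi> \<bullet> (X ?r - S \<epsilon> x)" by blast
    have ui: "set_integrable lebesgue {t..?r} (\<lambda>_. u)" by (rule admissible_integrable[OF adm])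
    have tr: "t \<le> ?r" using \<epsilon> by simp
    note id = inner_displacement[OF ui Xr tr, of \<pi>]
    have "\<pi> \<bullet> (X ?r - S \<epsilon> x) \<le> (LINT \<tau>:{t..?r}|lebesgue. P \<bullet> a + \<kappa> * (norm a + 1 + 2 * norm P))"
      using id(2) unfolding add_diff_cancel_left' 
    proof (simp only:, intro set_integral_mono id(1) set_integrable_continuous_interval continuous_on_const)
      fix \<tau> assume \<tau>: "\<tau> \<in> {t..?r}"
      show "\<pi> \<bullet> S (?r - \<tau>) (drift (X \<tau>) u) \<le> P \<bullet> a + \<kappa> * (norm a + 1 + 2 * norm P)"
      proof (rule drift_perturbation)
        show "norm (\<pi> - P) \<le> \<kappa>" using \<pi> by simp
        have "norm (drift (X \<tau>) u - a) \<le> Lip * (1 + norm u) * norm (X \<tau> - x)" unfolding a_def by (rule drift_diff_norm)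
        also have "\<dots> \<le> (Lip * (1 + norm u) + 1) * (\<kappa> / (Lip * (1 + norm u) + 1))"
          using Xq[OF \<tau>] Lip_nonneg by (intro mult_mono) (auto simp: q_def)
        also have "\<dots> = \<kappa>" using den by simp
        finally show "norm (drift (X \<tau>) u - a) \<le> \<kappa>" .
        show "norm (S (?r - \<tau>) a - a) \<le> \<kappa>" using d2(2)[of "?r - \<tau>"] \<tau> \<epsilon> by simp
      qed (use \<tau> \<kappa> in auto)
    qed
    also have "\<dots> = \<epsilon> * (P \<bullet> a + \<kappa> * (norm a + 1 + 2 * norm P))" using \<epsilon> by (simp add: set_integral_interval_const)
    finally have dis: "\<pi> \<bullet> (X ?r - S \<epsilon> x) \<le> \<epsilon> * (P \<bullet> a + \<kappa> * (norm a + 1 + 2 * norm P))" .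
    have "- (l * \<epsilon>) + v (?r, X ?r) \<le> v (t, x)" using v_dpp_ge[OF tr _ adm Xr] co \<epsilon> by simp
    moreover have "v (t, x) + \<phi> (t, x) + h (norm x) \<le> v (?r, X ?r) + \<phi> (?r, X ?r) + h (norm (X ?r))"
      using min \<epsilon> t by simp
    ultimately have "0 \<le> l * \<epsilon> + \<epsilon> * (time_deriv \<phi> (t, x) - x \<bullet> adj_op domA A p + \<kappa>) + \<epsilon> * (P \<bullet> a + \<kappa> * (norm a + 1 + 2 * norm P))"
      using ex dis by linarith
    also have "\<dots> = \<epsilon> * (l + time_deriv \<phi> (t, x) - x \<bullet> adj_op domA A p + P \<bullet> a + \<kappa> * (norm a + 2 + 2 * norm P))"
      by (simp add: algebra_simps)
    finally show "0 \<le> l + time_deriv \<phi> (t, x) - x \<bullet> adj_op domA A p + P \<bullet> a + \<kappa> * (norm a + 2 + 2 * norm P)"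
      using \<epsilon>(1) by (simp add: zero_le_mult_iff)
  qed
  \<comment> \<open>The control term in \<open>l\<close> cancels the one in P \<bullet> a, so only
    -\<open>H0\<close> and the terms without control remain.\<close>
  moreover have "u \<bullet> adjoint (blinfun_apply (G x)) (- P) = - (G x u \<bullet> P)" by (simp add: inner_adjoint_blinfun)
  ultimately show "let \<psi> = ?\<psi> in time_deriv \<psi> (t, x) + x \<bullet> adj_op domA A (space_grad \<phi> (t, x))
      + F x \<bullet> space_grad \<psi> (t, x) + H0 \<nu> (adjoint (blinfun_apply (G x)) (space_grad \<psi> (t, x))) \<le> 0"
    unfolding Let_def sg td
    by (simp add: l_def a_def drift_def p_def inner_add_right inner_commute[of P])
qed

lemma v_subsolution: "viscosity_subsolution domA A B \<nu> F G T v"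
  unfolding viscosity_subsolution_def
proof (intro conjI v_locally_bounded v_semicontinuous allI impI)
  fix \<phi> h t x
  assume \<phi>: "test_phi domA A B T \<phi>" and th: "test_h h" and t: "t \<in> {0<..<T}"
    and max: "\<forall>s\<in>{0<..<T}. \<forall>y. v (s, y) - \<phi> (s, y) - h (norm y) \<le> v (t, x) - \<phi> (t, x) - h (norm x)"
  from th obtain h' where h: "\<And>r. r \<ge> 0 \<Longrightarrow> (h has_real_derivative h' r) (at r within {0..})"
    and h': "continuous_on {0..} h'" "h' 0 = 0" "\<And>r. r > 0 \<Longrightarrow> 0 \<le> h' r" unfolding test_h_def by blast
  have h'0: "0 \<le> h' r" if "r \<ge> 0" for r using h'(2,3) that by (cases "r = 0") auto
  have diff: "\<phi> differentiable (at (t, x))" using \<phi> t by (auto simp: test_phi_def C1_on_cylinder_def)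
  define p where "p = space_grad \<phi> (t, x)"
  define P where "P = p + h' (norm x) *\<^sub>R sgn x"
  let ?\<psi> = "\<lambda>(s, y). \<phi> (s, y) + h (norm y)"
  have "GDERIV (\<lambda>y. \<phi> (t, y) + h (norm y)) x :> p + h' (norm x) *\<^sub>R sgn x"
    unfolding p_def by (intro GDERIV_add differentiable_partials(1)[OF diff] GDERIV_radial h h'(2))
  then have sg: "space_grad ?\<psi> (t, x) = P" by (intro space_grad_eqI) (simp add: P_def)
  have "((\<lambda>s. \<phi> (s, x) + h (norm x)) has_real_derivative time_deriv \<phi> (t, x)) (at t)"
    using differentiable_partials(2)[OF diff] by (auto intro!: derivative_eq_intros)
  then have td: "time_deriv ?\<psi> (t, x) = time_deriv \<phi> (t, x)" by (simp add: time_deriv_def DERIV_imp_deriv)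
  define a where "a = F x"
  define Q where "Q = adjoint (blinfun_apply (G x)) P"
  have "0 \<le> time_deriv \<phi> (t, x) - x \<bullet> adj_op domA A p + P \<bullet> a + H0 \<nu> Q"
  proof (rule nonneg_of_small_perturbation)
    fix \<kappa> :: real assume \<kappa>: "0 < \<kappa>" "\<kappa> \<le> 1"
    obtain dH where dH: "dH > 0" "\<And>w. dist w Q < dH \<Longrightarrow> norm (H0 \<nu> w - H0 \<nu> Q) < \<kappa>"
      using isContD_norm[OF continuous_H0 \<kappa>(1)] by blast
    \<comment> \<open>One tolerance meets three demands: the errors without control stay within
      \<open>\<kappa>\<close>, the increment of F stays within \<open>\<kappa>\<close>, and the dual
      variable stays within \<open>dH\<close> of \<open>Q\<close>.\<close>
    define \<mu> where "\<mu> = min \<kappa> (min (\<kappa> / (Lip + 1)) (dH / (2 * M + Lip * norm P + 1)))"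
    have denL: "Lip + 1 > 0" using Lip_nonneg by simp
    have denH: "2 * M + Lip * norm P + 1 > 0" using M Lip_nonneg by (simp add: add_nonneg_pos)
    have \<mu>: "\<mu> > 0" "\<mu> \<le> \<kappa>" using \<kappa> denL denH dH(1) by (auto simp: \<mu>_def)
    have \<mu>L: "Lip * \<mu> \<le> \<kappa>"
    proof -
      have "Lip * \<mu> \<le> (Lip + 1) * (\<kappa> / (Lip + 1))" using Lip_nonneg \<mu>(1) by (intro mult_mono) (auto simp: \<mu>_def)
      then show ?thesis using denL by simp
    qed
    have \<mu>H: "(2 * M + Lip * norm P) * \<mu> < dH"
    proof -
      have "(2 * M + Lip * norm P) * \<mu> < (2 * M + Lip * norm P + 1) * \<mu>" using \<mu>(1) by simp
      also have "\<dots> \<le> (2 * M + Lip * norm P + 1) * (dH / (2 * M + Lip * norm P + 1))"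
        using denH by (intro mult_left_mono) (auto simp: \<mu>_def)
      finally show ?thesis using denH by simp
    qed
    obtain d1 where d1: "d1 > 0" and expand: "\<And>\<epsilon> y. 0 < \<epsilon> \<Longrightarrow> \<epsilon> < d1 \<Longrightarrow> norm (y - x) < d1 \<Longrightarrow> t + \<epsilon> < T \<and> (\<exists>\<pi>. norm (\<pi> - P) < \<mu> \<and>
      \<phi> (t + \<epsilon>, y) - \<phi> (t, x) + (h (norm y) - h (norm x))
      \<le> \<epsilon> * (time_deriv \<phi> (t, x) - x \<bullet> adj_op domA A p + \<mu>) + \<pi> \<bullet> (y - S \<epsilon> x))"
      using test_function_expansion[OF \<phi> t h h'(1,2) h'0 \<mu>(1), of x] unfolding P_def p_def by blast
    obtain d2 where d2: "d2 > 0" "\<And>r. 0 \<le> r \<Longrightarrow> r < d2 \<Longrightarrow> norm (S r a - a) < \<kappa>" using S_near_id[OF \<kappa>(1)] by blast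
    \<comment> \<open>The tolerance is quadratic because the estimate for the adjoint semigroup
      bounds a square.\<close>
    have "\<mu>\<^sup>2 / (2 * norm P + 1) > 0" using \<mu>(1) by (simp add: add_nonneg_pos)
    from S_near_id[OF this] obtain d3 where d3: "d3 > 0"
      "\<And>r. 0 \<le> r \<Longrightarrow> r < d3 \<Longrightarrow> norm (S r P - P) < \<mu>\<^sup>2 / (2 * norm P + 1)" by blast
    have adjS: "norm (adjoint (blinfun_apply (S r)) P - P) \<le> \<mu>" if "0 \<le> r" "r < d3" for r
    proof (rule power2_le_imp_le)
      have den: "2 * norm P + 1 > 0" by (simp add: add_nonneg_pos)
      have "(norm (adjoint (blinfun_apply (S r)) P - P))\<^sup>2 \<le> 2 * norm P * norm (S r P - P)"
        by (rule norm_adjoint_S_diff[OF that(1)])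
      also have "\<dots> \<le> (2 * norm P + 1) * (\<mu>\<^sup>2 / (2 * norm P + 1))"
        using d3(2)[OF that] by (intro mult_mono) auto
      also have "\<dots> = \<mu>\<^sup>2" using den by simp
      finally show "(norm (adjoint (blinfun_apply (S r)) P - P))\<^sup>2 \<le> \<mu>\<^sup>2" .
    qed (use \<mu> in simp)
    have "t \<in> {0..<T}" "min d1 \<mu> > 0" using t d1 \<mu> by auto
    from mild_uniformly_near[OF this, of x] obtain d4 where d4: "d4 > 0" and
      near: "\<And>\<epsilon> u X s. 0 < \<epsilon> \<Longrightarrow> \<epsilon> < d4 \<Longrightarrow> t + \<epsilon> \<le> T \<Longrightarrow> admissible (t + \<epsilon>) t u \<Longrightarrow>
        cost (t + \<epsilon>) t u \<le> 2 * C\<gamma> + 1 \<Longrightarrow> mild (t + \<epsilon>) t x u X \<Longrightarrow> s \<in> {t..t + \<epsilon>} \<Longrightarrow> norm (X s - x) < min d1 \<mu>"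
      by blast
    define \<epsilon> where "\<epsilon> = min (min (min d1 d2) (min d3 d4)) (min 1 (T - t)) / 2"
    have \<epsilon>: "0 < \<epsilon>" "\<epsilon> < d1" "\<epsilon> < d2" "\<epsilon> < d3" "\<epsilon> < d4" "\<epsilon> \<le> 1" "t + \<epsilon> < T"
      using d1 d2(1) d3(1) d4 t by (auto simp: \<epsilon>_def min_def field_simps)
    let ?r = "t + \<epsilon>"
    have tr: "t \<le> ?r" "?r \<le> T" using \<epsilon> by auto
    \<comment> \<open>The optimality gap carries a factor \<epsilon> so that it survives division by
      \<epsilon> as \<open>\<kappa>\<close>; the control therefore depends on \<epsilon>.\<close>
    have "0 < \<epsilon> * \<kappa>" "\<epsilon> * \<kappa> \<le> 1" using \<epsilon> \<kappa> by (auto intro: mult_le_one)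
    from v_dpp_le[OF tr this, of x] obtain u X where adm: "admissible ?r t u" and X: "mild ?r t x u X"
      and co: "cost ?r t u \<le> 2 * C\<gamma> + 1" and dpp: "v (t, x) \<le> - cost ?r t u + v (?r, X ?r) + \<epsilon> * \<kappa>" by blast
    have nX: "norm (X s - x) < min d1 \<mu>" if "s \<in> {t..?r}" for s
      by (rule near[OF \<epsilon>(1,5) tr(2) adm co X that])
    have "norm (X ?r - x) < d1" using nX[of ?r] tr by simp
    from expand[OF \<epsilon>(1,2) this] obtain \<pi> where \<pi>: "norm (\<pi> - P) < \<mu>"
      and ex: "\<phi> (?r, X ?r) - \<phi> (t, x) + (h (norm (X ?r)) - h (norm x))
        \<le> \<epsilon> * (time_deriv \<phi> (t, x) - x \<bullet> adj_op domA A p + \<mu>) + \<pi> \<bullet> (X ?r - S \<epsilon> x)" by blast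
    note ui = admissible_integrable[OF adm]
    note id = inner_displacement[OF ui X tr(1), of \<pi>]
    \<comment> \<open>\<open>k\<close> bounds the integrand without control; subtracting it leaves a
      quantity dominated by an expression linear in u, to which Fenchel's inequality
      applies.\<close>
    define k where "k = P \<bullet> a + \<kappa> * (norm a + 1 + 2 * norm P)"
    have "(LINT \<tau>:{t..?r}|lebesgue. \<pi> \<bullet> S (?r - \<tau>) (drift (X \<tau>) (u \<tau>)) - k) \<le> cost ?r t u + (H0 \<nu> Q + \<kappa>) * (?r - t)"
    proof (rule integral_le_running_cost)
      show "u \<in> controls ?r t" "running_cost \<nu> ?r t u < \<infinity>" using adm by (auto simp: admissible_def)
      show "0 \<le> H0 \<nu> Q + \<kappa>" using H0_nonneg[of Q] \<kappa> by simp
      show "set_integrable lebesgue {t..?r} (\<lambda>\<tau>. \<pi> \<bullet> S (?r - \<tau>) (drift (X \<tau>) (u \<tau>)) - k)"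
        by (intro set_integral_diff(1) id(1) set_integrable_continuous_interval continuous_on_const)
      fix \<tau> assume \<tau>: "\<tau> \<in> {t..?r}"
      define r where "r = ?r - \<tau>"
      have r: "0 \<le> r" "r < d2" "r < d3" using \<tau> \<epsilon> by (auto simp: r_def)
      have x\<tau>: "norm (X \<tau> - x) \<le> \<mu>" using nX[OF \<tau>] by simp
      have "\<pi> \<bullet> S r (F (X \<tau>)) \<le> k"
        unfolding k_def
      proof (rule drift_perturbation)
        show "norm (\<pi> - P) \<le> \<kappa>" using \<pi> \<mu> by simp
        have "norm (F (X \<tau>) - a) \<le> Lip * norm (X \<tau> - x)" unfolding a_def by (rule F_Lip)
        also have "\<dots> \<le> Lip * \<mu>" by (intro mult_left_mono x\<tau> Lip_nonneg)
        finally show "norm (F (X \<tau>) - a) \<le> \<kappa>" using \<mu>L by simp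
        show "norm (S r a - a) \<le> \<kappa>" using d2(2) r by (simp add: less_imp_le)
      qed (use r \<kappa> in auto)
      \<comment> \<open>Both operators act on the dual side, so no error gets multiplied by the
        unbounded |u|.\<close>
      moreover define w where "w = adjoint (blinfun_apply (G (X \<tau>))) (adjoint (blinfun_apply (S r)) \<pi>)"
      have "\<pi> \<bullet> S r (G (X \<tau>) (u \<tau>)) = u \<tau> \<bullet> w"
        unfolding w_def inner_adjoint_blinfun by (rule inner_commute)
      moreover have "H0 \<nu> w \<le> H0 \<nu> Q + \<kappa>"
      proof -
        have nS: "norm (adjoint (blinfun_apply (S r)) (\<pi> - P)) \<le> 1 * norm (\<pi> - P)"
          using semigroup r by (intro order_trans[OF norm_adjoint_blinfun_le] mult_right_mono)
            (auto simp: contraction_C0_semigroup_def)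
        have "adjoint (blinfun_apply (S r)) \<pi> - P = adjoint (blinfun_apply (S r)) (\<pi> - P) + (adjoint (blinfun_apply (S r)) P - P)"
          by (simp add: adjoint_blinfun_diff)
        also have "norm \<dots> \<le> norm (\<pi> - P) + \<mu>"
          using nS by (intro norm_triangle_mono adjS[OF r(1,3)]) simp
        finally have "norm (adjoint (blinfun_apply (S r)) \<pi> - P) \<le> norm (\<pi> - P) + \<mu>" .
        then have s1: "norm (adjoint (blinfun_apply (S r)) \<pi> - P) \<le> 2 * \<mu>" using \<pi> by simp
        \<comment> \<open>One term moves the covector under the fixed operator G(X \<tau>), the
          other moves the operator at the fixed covector P; their bounds add up to the coefficient 2
          M + Lip norm P in the choice of \<open>\<mu>\<close>.\<close>
        have "w - Q = adjoint (blinfun_apply (G (X \<tau>))) (adjoint (blinfun_apply (S r)) \<pi> - P) + adjoint (blinfun_apply (G (X \<tau>) - G x)) P"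
          unfolding w_def Q_def adjoint_blinfun_diff adjoint_blinfun_diff_left[symmetric] by simp
        also have "norm \<dots> \<le> M * (2 * \<mu>) + (Lip * \<mu>) * norm P"
        proof (intro norm_triangle_mono order_trans[OF norm_adjoint_blinfun_le] mult_mono)
          show "norm (G (X \<tau>)) \<le> M" using G_bound by simp
          show "norm (G (X \<tau>) - G x) \<le> Lip * \<mu>"
            by (rule order_trans[OF G_Lip]) (intro mult_left_mono x\<tau> Lip_nonneg)
        qed (use s1 M Lip_nonneg \<mu> in auto)
        also have "\<dots> = (2 * M + Lip * norm P) * \<mu>" by (simp add: algebra_simps)
        finally have "dist w Q < dH" using \<mu>H by (simp add: dist_norm)
        from dH(2)[OF this] show ?thesis by simp
      qed
      ultimately have le: "\<pi> \<bullet> S r (drift (X \<tau>) (u \<tau>)) - k \<le> u \<tau> \<bullet> w"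
        by (simp add: drift_def blinfun.add_right inner_add_right)
      have "ereal (\<pi> \<bullet> S r (drift (X \<tau>) (u \<tau>)) - k) \<le> ereal (u \<tau> \<bullet> w)" using le by simp
      also have "\<dots> \<le> L0 \<nu> (u \<tau>) + ereal (H0 \<nu> w)" by (rule inner_le_L0)
      also have "\<dots> \<le> L0 \<nu> (u \<tau>) + ereal (H0 \<nu> Q + \<kappa>)" using \<open>H0 \<nu> w \<le> H0 \<nu> Q + \<kappa>\<close> by (intro add_left_mono) simp
      finally show "ereal (\<pi> \<bullet> S (?r - \<tau>) (drift (X \<tau>) (u \<tau>)) - k) \<le> L0 \<nu> (u \<tau>) + ereal (H0 \<nu> Q + \<kappa>)"
        by (simp add: r_def)
    qed (rule tr)
    also have "(LINT \<tau>:{t..?r}|lebesgue. \<pi> \<bullet> S (?r - \<tau>) (drift (X \<tau>) (u \<tau>)) - k) = \<pi> \<bullet> (X ?r - S \<epsilon> x) - \<epsilon> * k"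
      using id \<epsilon> by (subst set_integral_diff(2)) (auto simp: set_integral_interval_const intro: set_integrable_continuous_interval)
    finally have "\<pi> \<bullet> (X ?r - S \<epsilon> x) \<le> cost ?r t u + \<epsilon> * (H0 \<nu> Q + \<kappa>) + \<epsilon> * k" by (simp add: mult.commute)
    moreover have "v (?r, X ?r) - \<phi> (?r, X ?r) - h (norm (X ?r)) \<le> v (t, x) - \<phi> (t, x) - h (norm x)"
      using max \<epsilon> t by simp
    moreover have "\<epsilon> * (time_deriv \<phi> (t, x) - x \<bullet> adj_op domA A p + \<mu>) \<le> \<epsilon> * (time_deriv \<phi> (t, x) - x \<bullet> adj_op domA A p + \<kappa>)"
      using \<epsilon> \<mu> by (intro mult_left_mono) auto
    ultimately have "0 \<le> \<epsilon> * \<kappa> + \<epsilon> * (time_deriv \<phi> (t, x) - x \<bullet> adj_op domA A p + \<kappa>) + \<epsilon> * (H0 \<nu> Q + \<kappa>) + \<epsilon> * k"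
      using dpp ex by linarith
    also have "\<dots> = \<epsilon> * (time_deriv \<phi> (t, x) - x \<bullet> adj_op domA A p + P \<bullet> a + H0 \<nu> Q + \<kappa> * (norm a + 4 + 2 * norm P))"
      by (simp add: k_def algebra_simps)
    finally show "0 \<le> time_deriv \<phi> (t, x) - x \<bullet> adj_op domA A p + P \<bullet> a + H0 \<nu> Q + \<kappa> * (norm a + 4 + 2 * norm P)"
      using \<epsilon>(1) by (simp add: zero_le_mult_iff)
  qed
  then show "let \<psi> = ?\<psi> in time_deriv \<psi> (t, x) - x \<bullet> adj_op domA A (space_grad \<phi> (t, x))
      + F x \<bullet> space_grad \<psi> (t, x) + H0 \<nu> (adjoint (blinfun_apply (G x)) (space_grad \<psi> (t, x))) \<ge> 0"
    unfolding Let_def sg td by (simp add: a_def p_def Q_def inner_commute[of P])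
qed

end

theorem theorem4p4:
  fixes domA :: "'a::{real_inner, banach, second_countable_topology} set"
    and A :: "'a \<Rightarrow> 'a"
    and S :: "real \<Rightarrow> 'a \<Rightarrow>\<^sub>L 'a"
    and B :: "'a \<Rightarrow>\<^sub>L 'a"
    and c0 :: real
    and F :: "'a \<Rightarrow> 'a"
    and G :: "'a \<Rightarrow> 'a \<Rightarrow>\<^sub>L 'a"
    and \<nu> :: "'a measure"
    and J :: "'a \<Rightarrow> 'b::banach"
    and g :: "'b \<Rightarrow> real"
    and T M :: real
  assumes "linear_operator_on domA A"
    and "closure domA = UNIV"
    and "maximal_monotone domA A"
    and "contraction_C0_semigroup S"
    and "generator_of S domA (\<lambda>x. - A x)"
    and "self_adjoint B"
    and "strictly_positive B"
    and "\<forall>x. B x \<in> adj_domain domA A"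
    and "bounded_linear (\<lambda>x. adj_op domA A (B x))"
    and "c0 \<ge> 0"
    and "\<forall>x. (adj_op domA A (B x) + c0 *\<^sub>R B x) \<bullet> x \<ge> 0"
    and "is_completion (norm_m1 B) J"
    and "sets \<nu> = sets borel"
    and "emeasure \<nu> {0} = 0"
    and "(\<integral>\<^sup>+z. ennreal ((norm z)\<^sup>2) \<partial>\<nu>) < \<infinity>"
    and "\<forall>K>0. (\<integral>\<^sup>+z. ennreal ((norm z)\<^sup>2 * exp (K * norm z)) \<partial>\<nu>) < \<infinity>"
    and "T > 0"
    and "M \<ge> 0"
    and "norm (F 0) \<le> M"
    and "\<forall>x y. norm (F x - F y) \<le> M * norm_m1 B (x - y)"
    and "\<forall>x y. norm (G x - G y) \<le> M * norm_m1 B (x - y)"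
    and "\<forall>x. norm (G x) \<le> M"
    and "g \<in> Lip_b"
  shows "\<exists>v :: real \<times> 'a \<Rightarrow> real.
    (\<forall>t\<in>{0..T}. \<forall>x. ereal (v (t, x)) = value_function \<nu> S F G (\<lambda>y. g (J y)) T t x) \<and>
    (\<exists>D1. \<forall>R>0. \<exists>\<omega>. is_modulus \<omega> \<and>
       (\<forall>x y. norm x \<le> R \<longrightarrow> norm y \<le> R \<longrightarrow> (\<forall>t\<in>{0..T}. \<forall>s\<in>{0..T}.
          \<bar>v (t, x) - v (s, y)\<bar> \<le> D1 * norm_m1 B (x - y) + \<omega> \<bar>t - s\<bar>))) \<and>
    viscosity_solution domA A B \<nu> F G T v \<and>
    (\<forall>x. v (T, x) = g (J x))"
proof -
  obtain C where C: "\<And>y. \<bar>g y\<bar> \<le> C" using assms(23) by (auto simp: Lip_b_def bounded_iff)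
  obtain L where L: "L-lipschitz_on UNIV g" using assms(23) by (auto simp: Lip_b_def)
  \<comment> \<open>The embedding is linear and carries the weak norm to the norm of the completion,
    so the Lipschitz constant of \<open>g\<close> is kept.\<close>
  have lip: "\<bar>g (J x) - g (J y)\<bar> \<le> L * norm_m1 B (x - y)" for x y
  proof -
    have "J x - J y = J (x - y)" using assms(12) by (simp add: is_completion_def linear_diff)
    then have "dist (J x) (J y) = norm_m1 B (x - y)" using assms(12) by (simp add: is_completion_def dist_norm)
    then show ?thesis using lipschitz_onD[OF L, of "J x" "J y"] by (simp add: dist_real_def)
  qed
  interpret control_problem domA A S B c0 F G M \<nu> "\<lambda>y. g (J y)" C L T
    by (intro control_problem.intro control_system.intro weak_contraction.intro generated_contraction.intro
        weak_contraction_axioms.intro control_system_axioms.intro exponential_levy.intro control_problem_axioms.intro;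
        (fact assms | rule C lip lipschitz_on_nonneg[OF L]))
  show ?thesis
  proof (intro exI[of _ v] conjI)
    show "\<forall>t\<in>{0..T}. \<forall>x. ereal (v (t, x)) = value_function \<nu> S F G (\<lambda>y. g (J y)) T t x"
      using ereal_v by simp
    show "\<exists>D1. \<forall>R>0. \<exists>\<omega>. is_modulus \<omega> \<and> (\<forall>x y. norm x \<le> R \<longrightarrow> norm y \<le> R \<longrightarrow> (\<forall>t\<in>{0..T}. \<forall>s\<in>{0..T}.
          \<bar>v (t, x) - v (s, y)\<bar> \<le> D1 * norm_m1 B (x - y) + \<omega> \<bar>t - s\<bar>))"
      using v_modulus by blast
    show "viscosity_solution domA A B \<nu> F G T v"
      using v_subsolution v_supersolution by (simp add: viscosity_solution_def)
    show "\<forall>x. v (T, x) = g (J x)" using v_terminal by simp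
  qed
qed

end
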